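(* Let $G$ be a connected toroidal graph that contains no $K_5^-$ and no $6$-cycle as a subgraph. Then at least one of the following holds: (1) the minimum degree of $G$ is at most three; (2) $G$ has an induced subgraph on five vertices $v_1,v_2,v_3,v_4,v_5$, each of degree exactly $4$ in $G$, whose edge set is exactly $\{v_1v_2,v_2v_3,v_3v_4,v_4v_5,v_5v_1,v_3v_5,v_1v_3,v_1v_4\}$ (that is, $\{v_1,v_3,v_4,v_5\}$ induces a $K_4$ and $v_2$ is adjacent to exactly $v_1$ and $v_3$ among them); (3) $G$ has an induced subgraph isomorphic to the kite graph ($K_4$ minus one edge), all four of whose vertices have degree exactly $4$ in $G$; (4) $G$ has an induced subgraph isomorphic to the house graph (a $5$-cycle together with exactly one chord, i.e. a $4$-cycle and a triangle sharing exactly one edge), all five of whose vertices have degree exactly $4$ in $G$.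
   Context: Graphs are finite and simple. A toroidal graph is a graph that can be embedded on the torus. $K_5^-$ denotes the graph obtained from the complete graph $K_5$ by deleting one edge. "Contains no $K_5^-$ and no $6$-cycle" refers to subgraphs that are not necessarily induced. *)

theory Defs
  imports "HOL-Analysis.Analysis" "Graph_Theory.Graph_Theory"
begin

text \<open>
  A finite simple graph is a \<^locale>\<open>pair_graph\<close>: a finite loopless symmetric digraph without
  parallel arcs, so that each edge \<open>uv\<close> is represented by the two arcs \<open>(u,v)\<close> and \<open>(v,u)\<close>.
\<close>

definition graph_of :: "'a set \<Rightarrow> ('a \<times> 'a) set \<Rightarrow> 'a pair_pre_digraph" where
  "graph_of V E = \<lparr>pverts = V, parcs = E \<union> E\<inverse>\<rparr>"

text \<open>By symmetry of the arc set, the degree of a vertex is its out-degree.\<close>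

definition vdegree :: "'a pair_pre_digraph \<Rightarrow> 'a \<Rightarrow> nat" where
  "vdegree G v = out_degree (with_proj G) v"

definition min_degree :: "'a pair_pre_digraph \<Rightarrow> nat" where
  "min_degree G = Min (vdegree G ` pverts G)"

definition contains_copy :: "'a pair_pre_digraph \<Rightarrow> 'b pair_pre_digraph \<Rightarrow> bool" where
  "contains_copy G H \<longleftrightarrow>
     (\<exists>H'. subgraph (with_proj H') (with_proj G) \<and> digraph_iso (with_proj H) (with_proj H'))"

definition K5_minus :: "nat pair_pre_digraph" where
  "K5_minus = graph_of {..<5} ({(i, j). i < j \<and> j < 5} - {(0, 1)})"

definition cycle_graph :: "nat \<Rightarrow> nat pair_pre_digraph" where
  "cycle_graph n = graph_of {..<n} {(i, Suc i mod n) | i. i < n}"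

definition kite :: "nat pair_pre_digraph" where
  "kite = graph_of {..<4} ({(i, j). i < j \<and> j < 4} - {(0, 1)})"

text \<open>The 5-cycle \<open>0,1,2,3,4\<close> with the chord \<open>02\<close>.\<close>

definition house :: "nat pair_pre_digraph" where
  "house = graph_of {..<5} (insert (0, 2) (parcs (cycle_graph 5)))"

text \<open>
  A topological drawing of \<open>G\<close> without crossings in a subset \<open>S\<close> of a topological space: vertices
  are distinct points, every edge is a simple arc between its end points which contains no other
  vertex, and two distinct edges meet at most in common end points. The two arcs representing an
  edge are drawn as the same curve, traversed in opposite directions. The complement of the
  drawing in \<open>S\<close> is not required to consist of discs.
\<close>

definition embedding_in ::
    "'a pair_pre_digraph \<Rightarrow> 'p::topological_space set \<Rightarrow>
     ('a \<Rightarrow> 'p) \<Rightarrow> ('a \<times> 'a \<Rightarrow> real \<Rightarrow> 'p) \<Rightarrow> bool" where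
  "embedding_in G S \<phi> \<gamma> \<longleftrightarrow>
     inj_on \<phi> (pverts G) \<and> \<phi> ` pverts G \<subseteq> S \<and>
     (\<forall>(u, v) \<in> parcs G.
        arc (\<gamma> (u, v)) \<and> path_image (\<gamma> (u, v)) \<subseteq> S \<and>
        pathstart (\<gamma> (u, v)) = \<phi> u \<and> pathfinish (\<gamma> (u, v)) = \<phi> v \<and>
        \<gamma> (v, u) = reversepath (\<gamma> (u, v)) \<and>
        path_image (\<gamma> (u, v)) \<inter> \<phi> ` pverts G = {\<phi> u, \<phi> v}) \<and>
     (\<forall>(u, v) \<in> parcs G. \<forall>(x, y) \<in> parcs G.
        {u, v} \<noteq> {x, y} \<longrightarrow>
        path_image (\<gamma> (u, v)) \<inter> path_image (\<gamma> (x, y)) \<subseteq> \<phi> ` ({u, v} \<inter> {x, y}))"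

text \<open>The torus as the product of two unit circles.\<close>

definition torus :: "(complex \<times> complex) set" where
  "torus = sphere 0 1 \<times> sphere 0 1"

definition toroidal :: "'a pair_pre_digraph \<Rightarrow> bool" where
  "toroidal G \<longleftrightarrow> (\<exists>\<phi> \<gamma>. embedding_in G torus \<phi> \<gamma>)"

end

theory Submission
  imports Defs "HOL-Combinatorics.Permutations"
begin

text \<open>
  Faces are never treated topologically. Covering the torus by a fine grid and collecting the cells met
  by the drawing of a vertex star exhibits \<open>G\<close> as a minor of a toroidal grid. For a pair of permutations
  (vertex rotation, edge involution) the number \<open>V - E + F\<close> minus twice the number of components
  does not decrease when an edge is contracted or deleted; hence \<open>G\<close> inherits from the grid a rotation system with
  \<open>V - E + F \<ge> 0\<close>, that is, with \<open>\<Sum> (1 - 4/deg) + (1 - 4/len) \<le> 0\<close> over all darts.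

  If the minimum degree is at least four, every negative contribution is due to a triangular face. Each face
  of length at least five gives its surplus to its corners, and each vertex divides what it has among its
  triangles. The absence of hexagons and of \<open>K\<^sub>5\<^sup>-\<close> restricts the short faces around a vertex so severely
  that every triangle gets at least what it needs, one of them strictly more, unless there is an induced
  kite of vertices of degree four. Thus alternative (3) always holds when (1) fails.
\<close>

section \<open>Cycle counts of pairs of permutations\<close>

text \<open>The arcs of a drawing are merely continuous and may spiral into a vertex, so no cyclic
  order of edges can be read off from it directly; and as faces need not be discs, Euler's formula
  can only be hoped for as an inequality. The grid has an obvious rotation, and a count that is
  monotone under minors carries the inequality over.

  Contraction and deletion are both multiplications by transpositions that split a cycle, so one
  monotonicity lemma serves for both.

  In the discharging a face of length \<open>l\<close> owns \<open>l - 4\<close>; hence a triangle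
  lacks exactly 1, and \<open>1 - 4/7 = 3/7\<close> is what each corner of a face of length at least
  seven can give. A vertex of degree four owns nothing; it passes on at least 3/7 unless all its
  faces are triangles, and over runs of one, two and three triangles this leaves 3/7, 3/14 and 1/7.
  Fans of three triangles at such a vertex may then balance exactly,
  \<open>1/7 + 3/7 + 3/7 = 1\<close>, so the delicate point is to find a strict gain near each of
  them: without a kite of degree four some rim vertex has degree at least five. In a closed wheel
  even the 1/7 of the hub is missing and is moved over from the opposite triangle.\<close>

definition eqc :: "'d rel \<Rightarrow> 'd rel" where
  "eqc R = (R \<union> R\<inverse>)\<^sup>*"

text \<open>For the graph of a permutation of \<open>D\<close> this is its number of cycles, fixed
  points included; for the union of two such graphs it is the number of orbits of the group which
  they generate.\<close>

definition num_classes :: "'d set \<Rightarrow> 'd rel \<Rightarrow> nat" where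
  "num_classes D R = card ((\<lambda>x. eqc R `` {x}) ` D)"

definition fun_rel :: "('d \<Rightarrow> 'd) \<Rightarrow> 'd rel" where
  "fun_rel p = {(x, p x) | x. True}"

lemma fun_rel_iff [simp]: "(x, y) \<in> fun_rel p \<longleftrightarrow> y = p x"
  by (auto simp: fun_rel_def)

lemma eqc_refl [simp]: "(x, x) \<in> eqc R"
  by (simp add: eqc_def)

lemma eqc_base: "(x, y) \<in> R \<Longrightarrow> (x, y) \<in> eqc R"
  unfolding eqc_def by blast

lemma eqc_sym: "(x, y) \<in> eqc R \<Longrightarrow> (y, x) \<in> eqc R"
proof -
  have "(R \<union> R\<inverse>)\<inverse> = R \<union> R\<inverse>" by auto
  then show "(x, y) \<in> eqc R \<Longrightarrow> (y, x) \<in> eqc R"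
    unfolding eqc_def by (metis rtrancl_converseI)
qed

lemma eqc_trans: "(x, y) \<in> eqc R \<Longrightarrow> (y, z) \<in> eqc R \<Longrightarrow> (x, z) \<in> eqc R"
  unfolding eqc_def by (rule rtrancl_trans)

lemma eqc_step: "(x, y) \<in> eqc (fun_rel p) \<longleftrightarrow> (x, p y) \<in> eqc (fun_rel p)"
proof -
  have "(y, p y) \<in> eqc (fun_rel p)" by (rule eqc_base) simp
  then show ?thesis using eqc_trans eqc_sym by metis
qed

lemma eqc_induct [consumes 1, case_names base step conv]:
  assumes "(x, y) \<in> eqc R" "P x"
    "\<And>y z. (x, y) \<in> eqc R \<Longrightarrow> (y, z) \<in> R \<Longrightarrow> P y \<Longrightarrow> P z"
    "\<And>y z. (x, y) \<in> eqc R \<Longrightarrow> (z, y) \<in> R \<Longrightarrow> P y \<Longrightarrow> P z"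
  shows "P y"
  using assms(1)[unfolded eqc_def]
proof (induction rule: rtrancl_induct)
  case base then show ?case by (rule assms(2))
next
  case (step y z)
  then show ?case using assms(3,4) by (auto simp: eqc_def)
qed

lemma eqc_least:
  assumes "R \<subseteq> eqc S" shows "eqc R \<subseteq> eqc S"
proof
  fix z assume "z \<in> eqc R"
  then obtain x y where z: "z = (x, y)" "(x, y) \<in> eqc R" by (cases z) auto
  from z(2) have "(x, y) \<in> eqc S"
    by (induction rule: eqc_induct) (use assms in \<open>auto intro: eqc_trans eqc_sym\<close>)
  then show "z \<in> eqc S" by (simp add: z)
qed

lemma eqc_mono: "R \<subseteq> S \<Longrightarrow> eqc R \<subseteq> eqc S"
  by (rule eqc_least) (auto intro: eqc_base)

lemma eqc_class_eq: "eqc R `` {x} = eqc R `` {y} \<longleftrightarrow> (x, y) \<in> eqc R"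
proof
  assume "eqc R `` {x} = eqc R `` {y}"
  moreover have "y \<in> eqc R `` {y}" by simp
  ultimately show "(x, y) \<in> eqc R" by (metis Image_singleton_iff)
qed (auto intro: eqc_trans eqc_sym)

lemma eqc_Image_class:
  assumes "eqc R \<subseteq> eqc S" shows "eqc S `` (eqc R `` {x}) = eqc S `` {x}"
  using assms by (auto intro: eqc_trans)

text \<open>Coarse classes are saturations of fine ones, so comparing two counts becomes comparing a
  set with its image.\<close>

lemma num_classes_as_image:
  assumes "eqc R \<subseteq> eqc S"
  shows "num_classes D S = card (Image (eqc S) ` ((\<lambda>x. eqc R `` {x}) ` D))"
  using eqc_Image_class[OF assms] by (simp add: num_classes_def image_image)

lemma num_classes_antimono:
  assumes "finite D" "eqc R \<subseteq> eqc S" shows "num_classes D S \<le> num_classes D R"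
  unfolding num_classes_as_image[OF assms(2)] num_classes_def[of D R] using assms(1) by (intro card_image_le) auto

lemma eqc_insertD:
  assumes "(x, y) \<in> eqc (insert (a, b) R)"
  shows "(x, y) \<in> eqc R \<or> (x, a) \<in> eqc R \<and> (b, y) \<in> eqc R \<or> (x, b) \<in> eqc R \<and> (a, y) \<in> eqc R"
  using assms
proof (induction rule: eqc_induct)
  case (step y z)
  show ?case
  proof (cases "(y, z) \<in> R")
    case True
    then show ?thesis using step.IH eqc_base[OF True] by (auto intro: eqc_trans)
  next
    case False
    then have "y = a" "z = b" using step by auto
    then show ?thesis using step.IH by (auto dest: eqc_sym)
  qed
next
  case (conv y z)
  show ?case
  proof (cases "(z, y) \<in> R")
    case True
    then show ?thesis using conv.IH eqc_sym[OF eqc_base[OF True]] by (auto intro: eqc_trans)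
  next
    case False
    then have "z = a" "y = b" using conv by auto
    then show ?thesis using conv.IH by (auto dest: eqc_sym)
  qed
qed simp

text \<open>The new pair can only fuse the classes of \<open>a\<close> and \<open>b\<close>; with
  the class of \<open>b\<close> left out, saturation is injective.\<close>

lemma num_classes_insert_le:
  assumes "finite D" shows "num_classes D R \<le> num_classes D (insert (a, b) R) + 1"
proof -
  let ?S = "insert (a, b) R" and ?A = "(\<lambda>x. eqc R `` {x}) ` D"
  have sub: "eqc R \<subseteq> eqc ?S" by (rule eqc_mono) auto
  have "inj_on (Image (eqc ?S)) (?A - {eqc R `` {b}})"
  proof (rule inj_onI)
    fix X Y assume XY: "X \<in> ?A - {eqc R `` {b}}" "Y \<in> ?A - {eqc R `` {b}}" "eqc ?S `` X = eqc ?S `` Y"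
    then obtain x y where xy: "X = eqc R `` {x}" "Y = eqc R `` {y}" by auto
    then have "(x, y) \<in> eqc ?S" using XY(3) by (simp add: eqc_Image_class[OF sub] eqc_class_eq)
    moreover have "(x, b) \<notin> eqc R" "(b, y) \<notin> eqc R"
      using XY(1,2) unfolding xy eqc_class_eq[symmetric] by auto
    ultimately have "(x, y) \<in> eqc R" using eqc_insertD by metis
    then show "X = Y" by (simp add: xy eqc_class_eq)
  qed
  then have "card (?A - {eqc R `` {b}}) = card (Image (eqc ?S) ` (?A - {eqc R `` {b}}))"
    by (rule card_image[symmetric])
  also have "\<dots> \<le> card (Image (eqc ?S) ` ?A)"
    using assms by (intro card_mono image_mono) auto
  finally have "card (?A - {eqc R `` {b}}) \<le> card (Image (eqc ?S) ` ?A)" .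
  moreover have "card ?A \<le> card (?A - {eqc R `` {b}}) + 1"
    by (simp add: card_Diff_singleton_if) linarith
  ultimately show ?thesis by (simp add: num_classes_as_image[OF sub] num_classes_def[of D R])
qed

lemma image_Diff_redundant:
  assumes "f c' = f c" "c' \<in> A - {c}" shows "f ` A \<subseteq> f ` (A - {c})"
proof
  fix y assume "y \<in> f ` A"
  then obtain x where x: "x \<in> A" "y = f x" by auto
  show "y \<in> f ` (A - {c})"
  proof (cases "x = c")
    case True
    then have "y = f c'" using assms x by simp
    then show ?thesis using assms(2) by (rule image_eqI)
  qed (use x in auto)
qed

lemma num_classes_insert_less:
  assumes "finite D" "a \<in> D" "b \<in> D" "(a, b) \<notin> eqc R"
  shows "num_classes D (insert (a, b) R) + 1 \<le> num_classes D R"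
proof -
  let ?S = "insert (a, b) R" and ?A = "(\<lambda>x. eqc R `` {x}) ` D"
  have sub: "eqc R \<subseteq> eqc ?S" by (rule eqc_mono) auto
  have "Image (eqc ?S) (eqc R `` {a}) = Image (eqc ?S) (eqc R `` {b})"
    unfolding eqc_Image_class[OF sub] eqc_class_eq by (auto intro: eqc_base)
  moreover have "eqc R `` {a} \<in> ?A - {eqc R `` {b}}"
    using assms by (auto simp: eqc_class_eq)
  ultimately have "Image (eqc ?S) ` ?A \<subseteq> Image (eqc ?S) ` (?A - {eqc R `` {b}})"
    by (rule image_Diff_redundant)
  then have "card (Image (eqc ?S) ` ?A) \<le> card (Image (eqc ?S) ` (?A - {eqc R `` {b}}))"
    by (intro card_mono) (use assms(1) in auto)
  also have "\<dots> \<le> card (?A - {eqc R `` {b}})"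
    using assms(1) by (intro card_image_le) auto
  finally have "num_classes D ?S \<le> card (?A - {eqc R `` {b}})" by (simp add: num_classes_as_image[OF sub])
  moreover have "card (?A - {eqc R `` {b}}) + 1 = card ?A"
    using card_Suc_Diff1[of ?A "eqc R `` {b}"] assms by simp
  ultimately show ?thesis by (simp add: num_classes_def[of D R])
qed

lemma eqc_fun_rel_closed:
  assumes "(x, y) \<in> eqc (fun_rel p)" "p permutes D" "x \<in> D" shows "y \<in> D"
  using assms(1)
  by (induction rule: eqc_induct) (use assms(2,3) in \<open>auto simp: permutes_in_image\<close>)

lemma eqc_fun_rel_inv:
  assumes "p permutes D" shows "eqc (fun_rel (inv p)) = eqc (fun_rel p)"
proof -
  have "fun_rel (inv p) = (fun_rel p)\<inverse>"
    using permutes_inverses[OF assms] by auto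
  then show ?thesis by (simp add: eqc_def Un_commute)
qed

text \<open>The product differs from \<open>p\<close> only at \<open>x\<close> and \<open>y\<close>.
  If these stayed apart, the points of the \<open>p\<close>-cycle of \<open>y\<close> that the
  product reaches from \<open>x\<close> would be closed under \<open>p\<close>; containing
  \<open>p y\<close>, this finite set would contain \<open>y\<close> too.\<close>

lemma transpose_merges:
  assumes fin: "finite D" and p: "p permutes D" and D: "x \<in> D" "y \<in> D" and xy: "(x, y) \<notin> eqc (fun_rel p)"
  shows "(x, y) \<in> eqc (fun_rel (p \<circ> Transposition.transpose x y))"
proof (rule ccontr)
  let ?r = "p \<circ> Transposition.transpose x y"
  assume n: "(x, y) \<notin> eqc (fun_rel ?r)"
  define S where "S = {z. (y, z) \<in> eqc (fun_rel p) \<and> (x, z) \<in> eqc (fun_rel ?r)}"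
  have "S \<subseteq> D" using eqc_fun_rel_closed[OF _ p D(2)] by (auto simp: S_def)
  then have "finite S" using fin by (rule finite_subset)
  have "(x, ?r x) \<in> eqc (fun_rel ?r)" by (rule eqc_base) simp
  then have y: "p y \<in> S" by (auto simp: S_def intro: eqc_base)
  have "p z \<in> S" if z: "z \<in> S" for z
  proof -
    have "z \<noteq> x" "z \<noteq> y" using xy n z by (auto simp: S_def dest: eqc_sym)
    then have "?r z = p z" by (simp add: transpose_apply_other)
    moreover have "(x, ?r z) \<in> eqc (fun_rel ?r)" "(y, p z) \<in> eqc (fun_rel p)"
      using z unfolding S_def by (auto simp: eqc_step[symmetric] simp del: comp_apply)
    ultimately show ?thesis by (simp add: S_def)
  qed
  then have "p ` S = S"
    using \<open>finite S\<close> permutes_inj[OF p] by (intro card_subset_eq) (auto simp: card_image inj_on_subset)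
  then have "y \<in> S" using y permutes_inj[OF p] by (auto dest: injD)
  then show False using n by (simp add: S_def)
qed

lemma transpose_merges_eqc:
  assumes fin: "finite D" and p: "p permutes D" and D: "x \<in> D" "y \<in> D" and xy: "(x, y) \<notin> eqc (fun_rel p)"
  shows "eqc (insert (x, y) (fun_rel p)) \<subseteq> eqc (fun_rel (p \<circ> Transposition.transpose x y))"
proof (rule eqc_least, clarify)
  let ?r = "p \<circ> Transposition.transpose x y"
  fix a b assume ab: "(a, b) \<in> insert (x, y) (fun_rel p)"
  have m: "(x, y) \<in> eqc (fun_rel ?r)" by (rule transpose_merges[OF assms])
  have b: "(z, ?r z) \<in> eqc (fun_rel ?r)" for z by (rule eqc_base) simp
  show "(a, b) \<in> eqc (fun_rel ?r)"
  proof (cases "(a, b) = (x, y) \<or> a \<noteq> x \<and> a \<noteq> y")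
    case True
    then show ?thesis using m ab b[of a] by (auto simp: transpose_apply_other)
  next
    case False
    then have "a = x \<and> b = p x \<or> a = y \<and> b = p y" using ab by auto
    then show ?thesis using b[of x] b[of y] m
      by (auto intro: eqc_trans eqc_sym)
  qed
qed

lemma num_classes_transpose_merge:
  assumes fin: "finite D" and p: "p permutes D" and D: "x \<in> D" "y \<in> D" and xy: "(x, y) \<notin> eqc (fun_rel p)"
  shows "num_classes D (fun_rel (p \<circ> Transposition.transpose x y)) + 1 \<le> num_classes D (fun_rel p)"
  using num_classes_antimono[OF fin transpose_merges_eqc[OF assms]] num_classes_insert_less[OF fin D xy] by linarith

text \<open>Once \<open>x\<close> and \<open>y\<close> are identified the transposition is
  invisible, and the identification costs at most one class.\<close>

lemma num_classes_transpose_le: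
  assumes fin: "finite D"
  shows "num_classes D (fun_rel p) \<le> num_classes D (fun_rel (p \<circ> Transposition.transpose x y)) + 1"
proof -
  let ?r = "p \<circ> Transposition.transpose x y"
  have m: "(x, y) \<in> eqc (insert (x, y) (fun_rel ?r))" by (rule eqc_base) simp
  have b: "(z, ?r z) \<in> eqc (insert (x, y) (fun_rel ?r))" for z by (rule eqc_base) simp
  have "eqc (fun_rel p) \<subseteq> eqc (insert (x, y) (fun_rel ?r))"
  proof (rule eqc_least, clarify)
    fix a b' assume "(a, b') \<in> fun_rel p"
    then show "(a, b') \<in> eqc (insert (x, y) (fun_rel ?r))"
      using b[of x] b[of y] b[of a] m
      by (cases "a = x \<or> a = y") (auto simp: transpose_apply_other intro: eqc_trans eqc_sym)
  qed
  from num_classes_antimono[OF fin this] num_classes_insert_le[OF fin, of "fun_rel ?r" x y]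
  have "num_classes D (insert (x, y) (fun_rel ?r)) \<le> num_classes D (fun_rel p)" "num_classes D (fun_rel ?r) \<le> num_classes D (insert (x, y) (fun_rel ?r)) + 1" by auto
  have "eqc (fun_rel ?r) \<subseteq> eqc (insert (x, y) (fun_rel p))"
  proof (rule eqc_least, clarify)
    fix a b' assume ab: "(a, b') \<in> fun_rel ?r"
    have m: "(x, y) \<in> eqc (insert (x, y) (fun_rel p))" by (rule eqc_base) simp
    have b: "(z, p z) \<in> eqc (insert (x, y) (fun_rel p))" for z by (rule eqc_base) simp
    show "(a, b') \<in> eqc (insert (x, y) (fun_rel p))"
      using b[of x] b[of y] b[of a] m ab
      by (cases "a = x \<or> a = y") (auto simp: transpose_apply_other intro: eqc_trans eqc_sym)
  qed
  from num_classes_antimono[OF fin this] num_classes_insert_le[OF fin, of "fun_rel p" x y]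
  show ?thesis by linarith
qed

lemma eqc_fixpoint:
  assumes "p permutes D" "p x = x" "(x, y) \<in> eqc (fun_rel p)" shows "y = x"
  using assms(3)
proof (induction rule: eqc_induct)
  case (conv y z)
  then have "p z = p x" using assms(2) by simp
  then show ?case using permutes_inj[OF assms(1)] by (auto dest: injD)
qed (use assms in auto)

text \<open>
  For a vertex rotation \<open>p\<close> and an edge involution \<open>q\<close> of the darts this is \<open>V + E + F - 2 C\<close>, \<open>C\<close> being
  the number of components. The sign of \<open>E\<close> makes it symmetric in \<open>p\<close>, \<open>q\<close> and \<open>p \<circ> q\<close>; subtracting the
  number \<open>2 E\<close> of darts turns it into an Euler characteristic.
\<close>

definition euler_count :: "'d set \<Rightarrow> ('d \<Rightarrow> 'd) \<Rightarrow> ('d \<Rightarrow> 'd) \<Rightarrow> int" where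
  "euler_count D p q = int (num_classes D (fun_rel p)) + int (num_classes D (fun_rel q)) + int (num_classes D (fun_rel (p \<circ> q)))
     - 2 * int (num_classes D (fun_rel p \<union> fun_rel q))"

text \<open>The transposition splits a cycle of \<open>p\<close>, a gain of one. Pulled through
  \<open>q\<close> it acts on the third permutation at \<open>x'\<close> and \<open>y'\<close>. If
  these share a cycle of \<open>p' \<circ> q\<close>, the components stay the same and at most one
  cycle is lost there; otherwise a second cycle is gained, and the two gains pay for at most one new
  component, which counts twice.\<close>

lemma euler_count_left:
  assumes fin: "finite D" and p: "p permutes D" and q: "q permutes D" and D: "x \<in> D" "y \<in> D"
    and xy: "(x, y) \<notin> eqc (fun_rel (p \<circ> Transposition.transpose x y))"
  shows "euler_count D p q \<le> euler_count D (p \<circ> Transposition.transpose x y) q"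
proof -
  define p' where "p' = p \<circ> Transposition.transpose x y"
  define x' y' where "x' = inv q x" and "y' = inv q y"
  have q': "q x' = x" "q y' = y" using permutes_inverses(1)[OF q] by (auto simp: x'_def y'_def)
  have D': "x' \<in> D" "y' \<in> D"
    using D permutes_in_image[OF permutes_inv[OF q]] by (auto simp: x'_def y'_def)
  have p'D: "p' permutes D" unfolding p'_def using p D by (intro permutes_compose permutes_swap_id)
  then have r'D: "p' \<circ> q permutes D" using q by (rule permutes_compose[rotated])
  have pp': "p = p' \<circ> Transposition.transpose x y" by (simp add: p'_def comp_assoc)
  \<comment> \<open>Conjugation by \<open>q\<close> brings the transposition to the right end, so
    the products \<open>p \<circ> q\<close> and \<open>p' \<circ> q\<close> also differ by a
    transposition.\<close>
  have "Transposition.transpose x y \<circ> q = q \<circ> Transposition.transpose x' y'"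
  proof
    fix z
    have "q z = x \<longleftrightarrow> z = x'" "q z = y \<longleftrightarrow> z = y'" using q' permutes_inj[OF q] by (auto dest: injD)
    then show "(Transposition.transpose x y \<circ> q) z = (q \<circ> Transposition.transpose x' y') z"
      using q' by (auto simp: Transposition.transpose_def)
  qed
  then have r: "p \<circ> q = (p' \<circ> q) \<circ> Transposition.transpose x' y'"
    by (simp add: pp' comp_assoc)
  have kp: "num_classes D (fun_rel p) + 1 \<le> num_classes D (fun_rel p')"
    using num_classes_transpose_merge[OF fin p'D D xy[folded p'_def]] pp' by simp
  have r'sub: "eqc (fun_rel (p' \<circ> q)) \<subseteq> eqc (fun_rel p' \<union> fun_rel q)"
  proof (rule eqc_least, clarify)
    fix a b assume "(a, b) \<in> fun_rel (p' \<circ> q)"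
    then have "(a, q a) \<in> eqc (fun_rel p' \<union> fun_rel q)" "(q a, b) \<in> eqc (fun_rel p' \<union> fun_rel q)"
      by (auto intro: eqc_base)
    then show "(a, b) \<in> eqc (fun_rel p' \<union> fun_rel q)" by (rule eqc_trans)
  qed
  have sub: "eqc (fun_rel p \<union> fun_rel q) \<subseteq> eqc (insert (x, y) (fun_rel p' \<union> fun_rel q))"
  proof (rule eqc_least, clarify)
    let ?S = "insert (x, y) (fun_rel p' \<union> fun_rel q)"
    fix a b assume ab: "(a, b) \<in> fun_rel p \<union> fun_rel q"
    have *: "(z, p' z) \<in> eqc ?S" "(z, q z) \<in> eqc ?S" "(x, y) \<in> eqc ?S" for z by (auto intro: eqc_base)
    show "(a, b) \<in> eqc ?S"
    proof (cases "b = q a")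
      case False
      then have b: "b = p' (Transposition.transpose x y a)" using ab pp' by auto
      have "(a, Transposition.transpose x y a) \<in> eqc ?S"
        using *(3) by (cases "a = x \<or> a = y") (auto simp: transpose_apply_other intro: eqc_sym)
      then show ?thesis using *(1)[of "Transposition.transpose x y a"] unfolding b by (rule eqc_trans)
    qed (use * in simp)
  qed
  show ?thesis
  proof (cases "(x', y') \<in> eqc (fun_rel (p' \<circ> q))")
    case True
    then have 1: "(x', y') \<in> eqc (fun_rel p' \<union> fun_rel q)" using r'sub by auto
    have 2: "(x', x) \<in> eqc (fun_rel p' \<union> fun_rel q)" "(y', y) \<in> eqc (fun_rel p' \<union> fun_rel q)"
      using q' by (auto intro!: eqc_base)
    have "(x, y) \<in> eqc (fun_rel p' \<union> fun_rel q)"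
      using eqc_trans[OF eqc_sym[OF 2(1)] eqc_trans[OF 1 2(2)]] .
    then have "insert (x, y) (fun_rel p' \<union> fun_rel q) \<subseteq> eqc (fun_rel p' \<union> fun_rel q)" by (auto intro: eqc_base)
    from eqc_least[OF this] sub have "eqc (fun_rel p \<union> fun_rel q) \<subseteq> eqc (fun_rel p' \<union> fun_rel q)" by auto
    from num_classes_antimono[OF fin this] have "num_classes D (fun_rel p' \<union> fun_rel q) \<le> num_classes D (fun_rel p \<union> fun_rel q)" .
    moreover have "num_classes D (fun_rel (p \<circ> q)) \<le> num_classes D (fun_rel (p' \<circ> q)) + 1"
      using num_classes_transpose_le[OF fin, of "p \<circ> q" x' y'] by (simp add: r comp_assoc)
    ultimately show ?thesis unfolding p'_def[symmetric] euler_count_def using kp by linarith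
  next
    case False
    have "num_classes D (fun_rel (p \<circ> q)) + 1 \<le> num_classes D (fun_rel (p' \<circ> q))"
      unfolding r by (rule num_classes_transpose_merge[OF fin r'D D' False])
    moreover have "num_classes D (fun_rel p' \<union> fun_rel q) \<le> num_classes D (fun_rel p \<union> fun_rel q) + 1"
      using num_classes_antimono[OF fin sub] num_classes_insert_le[OF fin, of "fun_rel p' \<union> fun_rel q" x y] by linarith
    ultimately show ?thesis unfolding p'_def[symmetric] euler_count_def using kp by linarith
  qed
qed

text \<open>Inversion keeps all cycles and reverses the product; it thus exchanges the roles of the
  two factors and turns the result for the left one into one for the right one.\<close>

lemma euler_count_inv:
  assumes p: "p permutes D" and q: "q permutes D" shows "euler_count D (inv q) (inv p) = euler_count D p q"
proof -
  have "inv q \<circ> inv p = inv (p \<circ> q)"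
    using p q by (simp add: o_inv_distrib permutes_bij)
  then have "eqc (fun_rel (inv q \<circ> inv p)) = eqc (fun_rel (p \<circ> q))"
    using eqc_fun_rel_inv[OF permutes_compose[OF q p]] by simp
  moreover have "eqc (fun_rel (inv q) \<union> fun_rel (inv p)) = eqc (fun_rel p \<union> fun_rel q)"
  proof -
    have "fun_rel (inv q) \<union> fun_rel (inv p) = (fun_rel p \<union> fun_rel q)\<inverse>"
      using permutes_inverses[OF p] permutes_inverses[OF q] by auto
    then show ?thesis by (simp add: eqc_def Un_commute)
  qed
  ultimately show ?thesis
    using eqc_fun_rel_inv[OF p] eqc_fun_rel_inv[OF q] unfolding euler_count_def
    by (simp add: num_classes_def)
qed

lemma euler_count_right:
  assumes fin: "finite D" and p: "p permutes D" and q: "q permutes D" and D: "x \<in> D" "y \<in> D"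
    and xy: "(x, y) \<notin> eqc (fun_rel (Transposition.transpose x y \<circ> q))"
  shows "euler_count D p q \<le> euler_count D p (Transposition.transpose x y \<circ> q)"
proof -
  let ?t = "Transposition.transpose x y"
  have t: "?t permutes D" using D by (rule permutes_swap_id)
  have i: "inv (?t \<circ> q) = inv q \<circ> ?t"
    using q t by (simp add: o_inv_distrib permutes_bij)
  have tq: "?t \<circ> q permutes D" using q t by (rule permutes_compose)
  have "(x, y) \<notin> eqc (fun_rel (inv q \<circ> ?t))"
    using xy eqc_fun_rel_inv[OF tq] by (simp add: i)
  from euler_count_left[OF fin permutes_inv[OF q] permutes_inv[OF p] D this]
  show ?thesis using euler_count_inv[OF p q] euler_count_inv[OF p tq] by (simp add: i)
qed

text \<open>Since \<open>(s \<circ> a) \<circ> a = s\<close>, vertices and faces change places: this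
  is duality of maps, under which contracting an edge becomes deleting one.\<close>

lemma euler_count_dual:
  assumes "a \<circ> a = id" shows "euler_count D (s \<circ> a) a = euler_count D s a"
proof -
  have aa: "a (a z) = z" for z using fun_cong[OF assms, of z] by simp
  have "eqc (fun_rel (s \<circ> a) \<union> fun_rel a) = eqc (fun_rel s \<union> fun_rel a)"
  proof
    show "eqc (fun_rel (s \<circ> a) \<union> fun_rel a) \<subseteq> eqc (fun_rel s \<union> fun_rel a)"
    proof (rule eqc_least, clarify)
      fix x y assume "(x, y) \<in> fun_rel (s \<circ> a) \<union> fun_rel a"
      moreover have "(x, a x) \<in> eqc (fun_rel s \<union> fun_rel a)" "(a x, s (a x)) \<in> eqc (fun_rel s \<union> fun_rel a)"
        by (auto intro: eqc_base)
      ultimately show "(x, y) \<in> eqc (fun_rel s \<union> fun_rel a)"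
        using eqc_trans[of x "a x" "fun_rel s \<union> fun_rel a" "s (a x)"] by auto
    qed
    show "eqc (fun_rel s \<union> fun_rel a) \<subseteq> eqc (fun_rel (s \<circ> a) \<union> fun_rel a)"
    proof (rule eqc_least, clarify)
      fix x y assume "(x, y) \<in> fun_rel s \<union> fun_rel a"
      moreover have "(x, a x) \<in> eqc (fun_rel (s \<circ> a) \<union> fun_rel a)" "(a x, s x) \<in> eqc (fun_rel (s \<circ> a) \<union> fun_rel a)"
        by (auto intro!: eqc_base simp: aa)
      ultimately show "(x, y) \<in> eqc (fun_rel (s \<circ> a) \<union> fun_rel a)"
        using eqc_trans[of x "a x" "fun_rel (s \<circ> a) \<union> fun_rel a" "s x"] by auto
    qed
  qed
  then show ?thesis by (simp add: euler_count_def comp_assoc assms num_classes_def)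
qed

text \<open>Each class spreads a unit weight evenly over its elements. This converts numbers of
  vertices, edges and faces into sums over darts.\<close>

lemma num_classes_sum:
  assumes fin: "finite D" and sub: "\<And>x. x \<in> D \<Longrightarrow> eqc R `` {x} \<subseteq> D"
  shows "real (num_classes D R) = (\<Sum>x\<in>D. 1 / real (card (eqc R `` {x})))"
proof -
  let ?f = "\<lambda>x. eqc R `` {x}"
  have "(\<Sum>x\<in>D. 1 / real (card (?f x))) = (\<Sum>y\<in>?f ` D. \<Sum>x\<in>{x \<in> D. ?f x = y}. 1 / real (card (?f x)))"
    by (rule sum.image_gen[OF fin])
  also have "\<dots> = (\<Sum>y\<in>?f ` D. 1)"
  proof (rule sum.cong[OF refl])
    fix y assume "y \<in> ?f ` D"
    then obtain x where x: "x \<in> D" "y = ?f x" by auto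
    have "z \<in> D \<and> ?f z = y \<longleftrightarrow> z \<in> y" for z
    proof -
      have "?f z = ?f x \<longleftrightarrow> (x, z) \<in> eqc R" unfolding eqc_class_eq by (auto dest: eqc_sym)
      then show ?thesis using sub[OF x(1)] x by auto
    qed
    then have e: "{x \<in> D. ?f x = y} = y" by auto
    have "(\<Sum>x\<in>{x \<in> D. ?f x = y}. 1 / real (card (?f x))) = (\<Sum>x\<in>{x \<in> D. ?f x = y}. 1 / real (card y))"
      by (rule sum.cong) auto
    also have "\<dots> = 1"
    proof -
      have "finite y" "x \<in> y" using x sub[OF x(1)] fin by (auto intro: finite_subset)
      then have "card y \<noteq> 0" by auto
      then show ?thesis unfolding e by simp
    qed
    finally show "(\<Sum>x\<in>{x \<in> D. ?f x = y}. 1 / real (card (?f x))) = 1" .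
  qed
  finally show ?thesis by (simp add: num_classes_def)
qed

section \<open>Rotation systems of minors\<close>

text \<open>The forward orbit is finite and mapped injectively into itself, hence onto itself, so
  backward steps do not leave it.\<close>

lemma eqc_fun_rel_funpow:
  assumes fin: "finite D" and p: "p permutes D" and x: "x \<in> D" and xy: "(x, y) \<in> eqc (fun_rel p)"
  shows "\<exists>k. (p ^^ k) x = y"
proof -
  define S where "S = range (\<lambda>k. (p ^^ k) x)"
  have pS: "p z \<in> S" if "z \<in> S" for z
  proof -
    obtain k where "z = (p ^^ k) x" using \<open>z \<in> S\<close> unfolding S_def by auto
    then have "p z = (p ^^ Suc k) x" by simp
    then show ?thesis unfolding S_def by (rule range_eqI)
  qed
  have "(p ^^ k) x \<in> D" for k
    by (induction k) (use x p in \<open>auto simp: permutes_in_image\<close>)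
  then have "finite S" using fin by (auto simp: S_def intro: finite_subset)
  then have S: "p ` S = S"
    using pS permutes_inj[OF p] by (intro card_subset_eq) (auto simp: card_image inj_on_subset)
  have "x \<in> S" unfolding S_def by (rule range_eqI[of _ _ 0]) simp
  have "y \<in> S" using xy
  proof (induction rule: eqc_induct)
    case (conv y z)
    then have "p z \<in> p ` S" using S by simp
    then show ?case using permutes_inj[OF p] by (auto dest: injD)
  qed (use \<open>x \<in> S\<close> pS in auto)
  then show ?thesis unfolding S_def by auto
qed

text \<open>A graph minor inside a host map \<open>(s0, a0)\<close>, with branch sets taken as sets
  of darts. The map \<open>i\<close> picks one host dart per arc and respects reversal.\<close>

locale minor_map =
  fixes D :: "'d set" and s0 a0 :: "'d \<Rightarrow> 'd" and V :: "'a set" and Lb :: "'a \<Rightarrow> 'd set"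
    and E :: "('a \<times> 'a) set" and i :: "'a \<times> 'a \<Rightarrow> 'd"
  assumes fin: "finite D" and s0: "s0 permutes D" and a0: "a0 permutes D" and a0a0: "a0 \<circ> a0 = id"
    and LbD: "u \<in> V \<Longrightarrow> Lb u \<subseteq> D"
    and disj: "u \<in> V \<Longrightarrow> v \<in> V \<Longrightarrow> u \<noteq> v \<Longrightarrow> Lb u \<inter> Lb v = {}"
    and closed0: "u \<in> V \<Longrightarrow> x \<in> Lb u \<Longrightarrow> s0 x \<in> Lb u"
    and conn0: "u \<in> V \<Longrightarrow> x \<in> Lb u \<Longrightarrow> y \<in> Lb u \<Longrightarrow>
       (x, y) \<in> eqc (fun_rel s0 \<union> {(z, a0 z) | z. z \<in> Lb u \<and> a0 z \<in> Lb u})"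
    and EV: "(u, v) \<in> E \<Longrightarrow> u \<in> V" "(u, v) \<in> E \<Longrightarrow> u \<noteq> v" and Esym: "(u, v) \<in> E \<Longrightarrow> (v, u) \<in> E"
    and iL: "(u, v) \<in> E \<Longrightarrow> i (u, v) \<in> Lb u" and ia: "(u, v) \<in> E \<Longrightarrow> i (v, u) = a0 (i (u, v))"
begin

lemma i_tail:
  assumes "(u, v) \<in> E" "w \<in> V" "i (u, v) \<in> Lb w" shows "w = u"
  using disj[of w u] iL[OF assms(1)] EV(1)[OF assms(1)] assms by auto

lemma i_inj: "inj_on i E"
proof (rule inj_onI)
  fix e e' assume ee': "e \<in> E" "e' \<in> E" "i e = i e'"
  obtain u v u' v' where e: "e = (u, v)" "e' = (u', v')" by (cases e, cases e') auto
  have "u = u'" using i_tail[of u' v' u] iL[of u v] EV(1)[of u v] ee' e by auto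
  moreover have "i (v, u) = i (v', u')" using ia[of u v] ia[of u' v'] ee' e by simp
  then have "v = v'"
    using i_tail[OF Esym, of u' v' v] iL[OF Esym, of u v] EV(1)[OF Esym, of u v] ee' e by auto
  ultimately show "e = e'" using e by simp
qed

text \<open>A contracted edge is not removed from \<open>D\<close> but dissolved into two fixed
  points of \<open>a\<close>, which keeps all counts over one and the same set.\<close>

definition contraction :: "('d \<Rightarrow> 'd) \<Rightarrow> ('d \<Rightarrow> 'd) \<Rightarrow> bool" where
  "contraction s a \<longleftrightarrow> s permutes D \<and> a permutes D \<and> a \<circ> a = id \<and> (\<forall>x. a x = a0 x \<or> a x = x) \<and>
     (\<forall>e\<in>E. a (i e) = a0 (i e)) \<and> (\<forall>u\<in>V. \<forall>x\<in>Lb u. s x \<in> Lb u) \<and>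
     (\<forall>u\<in>V. \<forall>x\<in>Lb u. \<forall>y\<in>Lb u. (x, y) \<in> eqc (fun_rel s \<union> {(z, a z) | z. z \<in> Lb u \<and> a z \<in> Lb u})) \<and>
     euler_count D s0 a0 \<le> euler_count D s a"

lemma contraction0: "contraction s0 a0"
  unfolding contraction_def using s0 a0 a0a0 closed0 conn0 by auto

text \<open>The factor \<open>t\<close> fuses the two vertex cycles in \<open>s \<circ> t\<close>
  and makes both darts of the edge fixed points of \<open>t \<circ> a\<close>, while the face
  permutation \<open>s \<circ> a\<close> is unchanged. Seen from the dual, the step merely splits a
  2-cycle of \<open>a\<close>.\<close>

lemma contraction_step:
  assumes c: "contraction s a" and e: "u \<in> V" "x \<in> Lb u" "a x \<in> Lb u" "(x, a x) \<notin> eqc (fun_rel s)"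
  defines "t \<equiv> Transposition.transpose x (a x)"
  shows "contraction (s \<circ> t) (t \<circ> a)" "num_classes D (fun_rel (s \<circ> t)) < num_classes D (fun_rel s)"
proof -
  have s: "s permutes D" and a: "a permutes D" and aa: "a \<circ> a = id"
    and a_or: "\<And>y. a y = a0 y \<or> a y = y"
    and aE: "\<And>e. e \<in> E \<Longrightarrow> a (i e) = a0 (i e)" and cl: "\<And>u x. u \<in> V \<Longrightarrow> x \<in> Lb u \<Longrightarrow> s x \<in> Lb u"
    and cn: "\<And>u x y. u \<in> V \<Longrightarrow> x \<in> Lb u \<Longrightarrow> y \<in> Lb u \<Longrightarrow>
        (x, y) \<in> eqc (fun_rel s \<union> {(z, a z) | z. z \<in> Lb u \<and> a z \<in> Lb u})"
    and N: "euler_count D s0 a0 \<le> euler_count D s a"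
    using c unfolding contraction_def by auto
  have aa': "a (a z) = z" for z using fun_cong[OF aa, of z] by simp
  have ne: "x \<noteq> a x" using e(4) by auto
  have xD: "x \<in> D" "a x \<in> D" using e LbD by auto
  have tp: "t permutes D" unfolding t_def using xD by (rule permutes_swap_id)
  have sp: "s \<circ> t permutes D" and ap: "t \<circ> a permutes D"
    using permutes_compose[OF tp s] permutes_compose[OF a tp] by auto
  have tt: "t (t z) = z" for z by (simp add: t_def)
  have ta: "(t \<circ> a) z = (if z = x \<or> z = a x then z else a z)" for z
    using aa' aa'[of z] by (auto simp: t_def Transposition.transpose_def dest: arg_cong[where f = a])
  have inv: "(t \<circ> a) \<circ> (t \<circ> a) = id"
  proof
    fix z show "((t \<circ> a) \<circ> (t \<circ> a)) z = id z"
      using ta[of z] ta[of "a z"] aa'[of z] aa'[of x] by (metis comp_apply id_apply)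
  qed
  have fix1: "(t \<circ> a) x = x" using ta by simp
  have tne: "(x, a x) \<notin> eqc (fun_rel (t \<circ> a))"
    using eqc_fixpoint[OF ap fix1] ne by metis
  have "euler_count D s a = euler_count D (s \<circ> a) a" by (rule euler_count_dual[OF aa, symmetric])
  also have "\<dots> \<le> euler_count D (s \<circ> a) (t \<circ> a)"
    using euler_count_right[OF fin permutes_compose[OF a s] a xD tne[unfolded t_def]] by (simp add: t_def)
  also have "s \<circ> a = (s \<circ> t) \<circ> (t \<circ> a)" using tt by auto
  also have "euler_count D \<dots> (t \<circ> a) = euler_count D (s \<circ> t) (t \<circ> a)" by (rule euler_count_dual[OF inv])
  finally have N': "euler_count D s0 a0 \<le> euler_count D (s \<circ> t) (t \<circ> a)" using N by simp
  have merge: "eqc (insert (x, a x) (fun_rel s)) \<subseteq> eqc (fun_rel (s \<circ> t))"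
    unfolding t_def by (rule transpose_merges_eqc[OF fin s xD e(4)])
  \<comment> \<open>A selected dart on the contracted edge would have both ends in one branch set,
    so its arc would be a loop.\<close>
  have iE: "i e' \<noteq> x \<and> i e' \<noteq> a x" if e': "e' \<in> E" for e'
  proof -
    obtain v w where vw: "e' = (v, w)" by (cases e')
    have "i (v, w) = x \<or> i (v, w) = a x \<Longrightarrow> v = u \<and> w = u"
    proof -
      assume *: "i (v, w) = x \<or> i (v, w) = a x"
      then have "i (v, w) \<in> Lb u" "a (i (v, w)) \<in> Lb u" using e aa' by auto
      moreover have "a (i (v, w)) = i (w, v)" using aE[OF e'] ia e' vw by auto
      ultimately show ?thesis using i_tail[of v w u] i_tail[of w v u] e e' vw Esym by auto
    qed
    then show ?thesis using EV(2) e' vw by auto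
  qed
  show "contraction (s \<circ> t) (t \<circ> a)"
    unfolding contraction_def
  proof (intro conjI ballI allI)
    show "(t \<circ> a) y = a0 y \<or> (t \<circ> a) y = y" for y using ta a_or by auto
    show "(t \<circ> a) (i e') = a0 (i e')" if "e' \<in> E" for e' 
      using ta[of "i e'"] iE[OF that] aE[OF that] by (simp del: comp_apply)
    fix v y assume vy: "v \<in> V" "y \<in> Lb v"
    show "(s \<circ> t) y \<in> Lb v"
    proof (cases "y = x \<or> y = a x")
      case True
      then have "v = u" using disj[OF vy(1) e(1)] vy e by auto
      then show ?thesis using True e cl by (auto simp: t_def)
    next
      case False then show ?thesis using vy cl by (auto simp: t_def)
    qed
    fix z assume z: "z \<in> Lb v"
    let ?R = "fun_rel s \<union> {(z, a z) | z. z \<in> Lb v \<and> a z \<in> Lb v}"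
    let ?S = "fun_rel (s \<circ> t) \<union> {(z, (t \<circ> a) z) | z. z \<in> Lb v \<and> (t \<circ> a) z \<in> Lb v}"
    have sub: "eqc (fun_rel (s \<circ> t)) \<subseteq> eqc ?S" by (rule eqc_mono) auto
    have "eqc ?R \<subseteq> eqc ?S"
    proof (rule eqc_least, rule subsetI)
      fix q assume q: "q \<in> ?R"
      have m: "eqc (insert (x, a x) (fun_rel s)) \<subseteq> eqc ?S" using merge sub by auto
      show "q \<in> eqc ?S"
      proof (cases "q \<in> fun_rel s")
        case True
        then have "q \<in> eqc (insert (x, a x) (fun_rel s))" by (cases q) (auto intro: eqc_base)
        then show ?thesis using m by auto
      next
        case False
        then obtain y where y: "q = (y, a y)" "y \<in> Lb v" "a y \<in> Lb v" using q by auto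
        have xx: "(x, a x) \<in> eqc ?S" using m by (auto intro: eqc_base)
        show ?thesis
        proof (cases "y = x \<or> y = a x")
          case True
          then show ?thesis using xx y aa' by (auto dest: eqc_sym)
        next
          case False
          then have "(t \<circ> a) y = a y" using ta by simp
          then have "q \<in> ?S" using y by (auto simp del: comp_apply)
          then show ?thesis by (cases q) (auto intro: eqc_base)
        qed
      qed
    qed
    then show "(y, z) \<in> eqc ?S" using cn[OF vy z] by auto
  qed (use sp ap inv N' in auto)
  show "num_classes D (fun_rel (s \<circ> t)) < num_classes D (fun_rel s)"
    using num_classes_transpose_merge[OF fin s xD e(4)] by (simp add: t_def)
qed

text \<open>Contractions lower the number of vertex cycles. When none is possible any more, internal
  edges add nothing to the cycles of \<open>s\<close>, so a connected branch set is contained in a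
  single cycle.\<close>

lemma contract_all:
  assumes "contraction s a"
  shows "\<exists>s a. contraction s a \<and> (\<forall>u\<in>V. \<forall>x\<in>Lb u. \<forall>y\<in>Lb u. (x, y) \<in> eqc (fun_rel s))"
  using assms
proof (induction "num_classes D (fun_rel s)" arbitrary: s a rule: less_induct)
  case less
  show ?case
  proof (cases "\<exists>u\<in>V. \<exists>x\<in>Lb u. a x \<in> Lb u \<and> (x, a x) \<notin> eqc (fun_rel s)")
    case True
    then obtain u x where "u \<in> V" "x \<in> Lb u" "a x \<in> Lb u" "(x, a x) \<notin> eqc (fun_rel s)" by auto
    from contraction_step[OF less.prems this] less.hyps show ?thesis by blast
  next
    case False
    have "(x, y) \<in> eqc (fun_rel s)" if u: "u \<in> V" "x \<in> Lb u" "y \<in> Lb u" for u x y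
    proof -
      have "fun_rel s \<union> {(z, a z) | z. z \<in> Lb u \<and> a z \<in> Lb u} \<subseteq> eqc (fun_rel s)"
        using False u(1) by (auto intro: eqc_base)
      from eqc_least[OF this] show ?thesis using less.prems u unfolding contraction_def by blast
    qed
    then show ?thesis using less.prems by blast
  qed
qed

text \<open>Discarded darts remain in \<open>D\<close> as common fixed points, that is, as isolated
  components to be accounted for at the end. They go one at a time, so half an edge may be gone
  while its other half is still there.\<close>

definition deletion :: "'d set \<Rightarrow> ('d \<Rightarrow> 'd) \<Rightarrow> ('d \<Rightarrow> 'd) \<Rightarrow> bool" where
  "deletion Z s a \<longleftrightarrow> s permutes D \<and> a permutes D \<and> (\<forall>z\<in>Z. s z = z \<and> a z = z) \<and>
     (\<forall>e\<in>E. a (i e) = a0 (i e)) \<and> (\<forall>u\<in>V. \<forall>x\<in>Lb u. s x \<in> Lb u) \<and>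
     (\<forall>u\<in>V. \<forall>x\<in>Lb u - Z. \<forall>y\<in>Lb u - Z. (x, y) \<in> eqc (fun_rel s)) \<and>
     euler_count D s0 a0 \<le> euler_count D s a"

text \<open>The dart is cut out of its cycle of \<open>s\<close> and then of its cycle of
  \<open>a\<close>; either cut is a transposition splitting off a fixed point, so the monotonicity
  lemmas apply.\<close>

lemma deletion_step:
  assumes d: "deletion Z s a" and z: "z \<in> D" "z \<notin> Z" "z \<notin> i ` E"
  shows "\<exists>s a. deletion (insert z Z) s a"
proof -
  have s: "s permutes D" and a: "a permutes D" 
    and Z: "\<And>y. y \<in> Z \<Longrightarrow> s y = y" "\<And>y. y \<in> Z \<Longrightarrow> a y = y"
    and aE: "\<And>e. e \<in> E \<Longrightarrow> a (i e) = a0 (i e)" and cl: "\<And>u x. u \<in> V \<Longrightarrow> x \<in> Lb u \<Longrightarrow> s x \<in> Lb u"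
    and cn: "\<And>u x y. u \<in> V \<Longrightarrow> x \<in> Lb u - Z \<Longrightarrow> y \<in> Lb u - Z \<Longrightarrow> (x, y) \<in> eqc (fun_rel s)"
    and N: "euler_count D s0 a0 \<le> euler_count D s a"
    using d unfolding deletion_def by auto
  define w where "w = inv s z"
  have w: "s w = z" using permutes_inverses(1)[OF s] by (simp add: w_def)
  have wD: "w \<in> D" using z permutes_in_image[OF permutes_inv[OF s]] by (simp add: w_def)
  have sinj: "s y = s y' \<Longrightarrow> y = y'" and ainj: "a y = a y' \<Longrightarrow> y = y'" for y y'
    using permutes_inj[OF s] permutes_inj[OF a] by (auto dest: injD)
  have azD: "a z \<in> D" using z permutes_in_image[OF a] by simp
  define s' where "s' = s \<circ> Transposition.transpose z w"
  define a' where "a' = Transposition.transpose z (a z) \<circ> a"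
  have s': "s' permutes D" unfolding s'_def using z wD by (intro permutes_compose s permutes_swap_id)
  have a': "a' permutes D" unfolding a'_def using z azD by (intro permutes_compose a permutes_swap_id)
  have s'z: "s' z = z" and a'z: "a' z = z" using w by (auto simp: s'_def a'_def)
  have s'o: "s' y = (if y = z then z else if y = w then s z else s y)" for y
    using w by (auto simp: s'_def Transposition.transpose_def)
  have a'o: "a' y = a y" if "y \<noteq> z" "a y \<noteq> z" for y
    using that ainj[of y z] by (auto simp: a'_def Transposition.transpose_def)
  have "euler_count D s a \<le> euler_count D s' a"
  proof (cases "w = z")
    case True then show ?thesis by (simp add: s'_def)
  next
    case False
    then have "(z, w) \<notin> eqc (fun_rel s')" using eqc_fixpoint[OF s' s'z] by metis
    then show ?thesis unfolding s'_def by (intro euler_count_left fin s a z wD)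
  qed
  also have "\<dots> \<le> euler_count D s' a'"
  proof (cases "a z = z")
    case True then show ?thesis by (simp add: a'_def)
  next
    case False
    then have "(z, a z) \<notin> eqc (fun_rel a')" using eqc_fixpoint[OF a' a'z] by metis
    then show ?thesis unfolding a'_def by (intro euler_count_right fin s' a z azD)
  qed
  finally have N': "euler_count D s0 a0 \<le> euler_count D s' a'" using N by simp
  have "deletion (insert z Z) s' a'"
    unfolding deletion_def
  proof (intro conjI ballI)
    fix y assume y: "y \<in> insert z Z"
    show "s' y = y"
    proof (cases "y = z")
      case False
      then have "s y = y" using y Z by auto
      then have "y \<noteq> w" using w False by auto
      then show ?thesis using s'o False \<open>s y = y\<close> by simp
    qed (use s'z in simp)
    show "a' y = y"
    proof (cases "y = z")
      case False
      then have "a y = y" using y Z by auto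
      then show ?thesis using a'o[of y] False by simp
    qed (use a'z in simp)
  next
    fix e assume e: "e \<in> E"
    obtain u v where uv: "e = (u, v)" by (cases e)
    have "a0 (i e) = i (v, u)" using ia e uv by simp
    then have "a (i e) \<noteq> z" using aE[OF e] z(3) Esym e uv by auto
    moreover have "i e \<noteq> z" using z(3) e by auto
    ultimately show "a' (i e) = a0 (i e)" using a'o aE[OF e] by simp
  next
    fix u x assume "u \<in> V" "x \<in> Lb u"
    then show "s' x \<in> Lb u" using cl[of u x] cl[of u z] w s'o by auto
  next
    fix u x y assume u: "u \<in> V" "x \<in> Lb u - insert z Z" "y \<in> Lb u - insert z Z"
    \<comment> \<open>Replacing the removed dart by its predecessor turns a walk along
      \<open>s\<close> into a walk along \<open>s'\<close>.\<close>
    define f where "f y = (if y = z then w else y)" for y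
    have st: "(f y, f (s y)) \<in> eqc (fun_rel s')" for y
    proof -
      have b: "(y, s' y) \<in> eqc (fun_rel s')" for y by (rule eqc_base) simp
      show ?thesis
      proof (cases "y = z")
        case True
        show ?thesis
        proof (cases "s z = z")
          case True
          then show ?thesis using \<open>y = z\<close> by (simp add: f_def)
        next
          case False
          then have "w \<noteq> z" using w by auto
          then show ?thesis using b[of w] \<open>y = z\<close> False by (simp add: f_def s'o)
        qed
      next
        case False
        show ?thesis
        proof (cases "y = w")
          case True then show ?thesis using w False by (simp add: f_def)
        next
          case yw: False
          then have "s y \<noteq> z" using w sinj by auto
          then show ?thesis using b[of y] False yw by (simp add: f_def s'o)
        qed
      qed
    qed
    have "(x, y) \<in> eqc (fun_rel s)" using cn u by auto
    then have "(f x, f y) \<in> eqc (fun_rel s')"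
    proof (induction rule: eqc_induct)
      case (step y y')
      then have "y' = s y" by simp
      then show ?case using eqc_trans[OF step.IH st[of y]] by simp
    next
      case (conv y y')
      then have "y = s y'" by simp
      then show ?case using eqc_trans[OF conv.IH eqc_sym[OF st[of y', folded \<open>y = s y'\<close>]]] by simp
    qed simp
    then show "(x, y) \<in> eqc (fun_rel s')" using u by (auto simp: f_def)
  qed (use s' a' N' in auto)
  then show ?thesis by blast
qed

lemma finE: "finite E"
proof (rule finite_imageD[OF _ i_inj])
  have "i ` E \<subseteq> D" using iL EV(1) LbD by fastforce
  then show "finite (i ` E)" using fin by (rule finite_subset)
qed

lemma delete_all: "\<exists>s a. deletion (D - i ` E) s a"
proof -
  obtain s a where c: "contraction s a" "\<forall>u\<in>V. \<forall>x\<in>Lb u. \<forall>y\<in>Lb u. (x, y) \<in> eqc (fun_rel s)"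
    using contract_all[OF contraction0] by blast
  then have base: "deletion {} s a" unfolding contraction_def deletion_def by simp
  have "finite Z \<Longrightarrow> Z \<subseteq> D - i ` E \<Longrightarrow> \<exists>s a. deletion Z s a" for Z
  proof (induction Z rule: finite_induct)
    case empty then show ?case using base by blast
  next
    case (insert z Z)
    then obtain s a where "deletion Z s a" by auto
    from deletion_step[OF this, of z] insert show ?case by auto
  qed
  then show ?thesis using fin by blast
qed

lemma rotation_exists:
  assumes E: "E \<noteq> {}" and N: "int (card D) - 2 \<le> euler_count D s0 a0"
  shows "\<exists>nx. (\<forall>u v. (u, v) \<in> E \<longrightarrow> (u, nx u v) \<in> E) \<and>
    (\<forall>u v w. (u, v) \<in> E \<longrightarrow> (u, w) \<in> E \<longrightarrow> (\<exists>k. (nx u ^^ k) v = w)) \<and>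
    (\<forall>u v w. (u, v) \<in> E \<longrightarrow> (u, w) \<in> E \<longrightarrow> nx u v = nx u w \<longrightarrow> v = w) \<and>
    0 \<le> (\<Sum>(u, v)\<in>E. 1 / real (card {w. (u, w) \<in> E}) +
        1 / real (card (range (\<lambda>k. ((\<lambda>(x, y). (y, nx y x)) ^^ k) (u, v)))) - 1 / 2)"
proof -
  define Z where "Z = D - i ` E"
  obtain s a where "deletion Z s a" using delete_all unfolding Z_def by blast
  then have s: "s permutes D" and a: "a permutes D" 
    and Z: "\<And>y. y \<in> Z \<Longrightarrow> s y = y" "\<And>y. y \<in> Z \<Longrightarrow> a y = y"
    and aE: "\<And>e. e \<in> E \<Longrightarrow> a (i e) = a0 (i e)" and cl: "\<And>u x. u \<in> V \<Longrightarrow> x \<in> Lb u \<Longrightarrow> s x \<in> Lb u"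
    and cn: "\<And>u x y. u \<in> V \<Longrightarrow> x \<in> Lb u - Z \<Longrightarrow> y \<in> Lb u - Z \<Longrightarrow> (x, y) \<in> eqc (fun_rel s)"
    and N': "euler_count D s0 a0 \<le> euler_count D s a"
    unfolding deletion_def by auto
  have sinj: "s y = s y' \<Longrightarrow> y = y'" for y y'
    using permutes_inj[OF s] by (auto dest: injD)
  have iD: "i e \<in> D" if "e \<in> E" for e
    using that iL EV(1) LbD by (cases e) blast
  have ex: "\<exists>w. (u, w) \<in> E \<and> i (u, w) = s (i (u, v))" if uv: "(u, v) \<in> E" for u v
  proof -
    have u: "u \<in> V" using uv by (rule EV(1))
    have *: "s (i (u, v)) \<in> Lb u" using cl[OF u iL[OF uv]] .
    have "s (i (u, v)) \<notin> Z"
    proof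
      assume z: "s (i (u, v)) \<in> Z"
      then have "s (i (u, v)) = i (u, v)" using Z(1) sinj by blast
      then show False using z uv by (auto simp: Z_def)
    qed
    then have "s (i (u, v)) \<in> i ` E" using * LbD[OF u] by (auto simp: Z_def)
    then obtain u' w where w: "(u', w) \<in> E" "s (i (u, v)) = i (u', w)" by auto
    then have "u = u'" using i_tail[OF w(1) u] * by simp
    then show ?thesis using w by metis
  qed
  define nx where "nx u v = (SOME w. (u, w) \<in> E \<and> i (u, w) = s (i (u, v)))" for u v
  have nx: "(u, nx u v) \<in> E" "i (u, nx u v) = s (i (u, v))" if "(u, v) \<in> E" for u v
    using someI_ex[OF ex[OF that]] unfolding nx_def by auto
  have nxk: "(u, (nx u ^^ k) v) \<in> E \<and> i (u, (nx u ^^ k) v) = (s ^^ k) (i (u, v))" if "(u, v) \<in> E" for u v k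
    by (induction k) (use that nx in auto)
  have cyc: "\<exists>k. (nx u ^^ k) v = w" if uv: "(u, v) \<in> E" "(u, w) \<in> E" for u v w
  proof -
    have "i (u, v) \<in> Lb u - Z" "i (u, w) \<in> Lb u - Z" using uv iL by (auto simp: Z_def)
    from cn[OF EV(1)[OF uv(1)] this] obtain k where "(s ^^ k) (i (u, v)) = i (u, w)"
      using eqc_fun_rel_funpow[OF fin s iD[OF uv(1)]] by metis
    then have "i (u, (nx u ^^ k) v) = i (u, w)" using nxk[OF uv(1)] by simp
    then have "(u, (nx u ^^ k) v) = (u, w)"
      using inj_onD[OF i_inj] nxk[OF uv(1)] uv(2) by metis
    then show ?thesis by auto
  qed
  have inj: "v = w" if "(u, v) \<in> E" "(u, w) \<in> E" "nx u v = nx u w" for u v w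
  proof -
    have "i (u, v) = i (u, w)" using nx(2)[OF that(1)] nx(2)[OF that(2)] that(3) sinj by simp
    then show ?thesis using inj_onD[OF i_inj _ that(1,2)] by simp
  qed
  define ph where "ph = (\<lambda>(x, y). (y, nx y x))"
  have ph: "ph e \<in> E" "i (ph e) = s (a (i e))" if e: "e \<in> E" for e
  proof -
    obtain u v where uv: "e = (u, v)" by (cases e)
    have "i (v, u) = a (i (u, v))" using ia aE[OF e] e uv by auto
    then show "ph e \<in> E" "i (ph e) = s (a (i e))"
      using nx[OF Esym[of u v]] e uv by (auto simp: ph_def)
  qed
  have phk: "(ph ^^ k) e \<in> E \<and> i ((ph ^^ k) e) = ((s \<circ> a) ^^ k) (i e)" if "e \<in> E" for e k
    by (induction k) (use that ph in auto)
  have sa: "s \<circ> a permutes D" using a s by (rule permutes_compose)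
  have subD: "eqc (fun_rel p) `` {x} \<subseteq> D" if "p permutes D" "x \<in> D" for p x
    using eqc_fun_rel_closed[OF _ that] by auto
  have subU: "eqc (fun_rel s \<union> fun_rel a) `` {x} \<subseteq> D" if x: "x \<in> D" for x
  proof clarify
    fix y assume "(x, y) \<in> eqc (fun_rel s \<union> fun_rel a)"
    then show "y \<in> D"
      by (induction rule: eqc_induct) (use x s a in \<open>auto simp: permutes_in_image\<close>)
  qed
  have cge: "real (card A) \<le> real (card (eqc (fun_rel p) `` {x}))"
    if "p permutes D" "x \<in> D" "A \<subseteq> eqc (fun_rel p) `` {x}" for p x A
    using card_mono[OF finite_subset[OF subD[OF that(1,2)] fin] that(3)] by simp
  have funpow_eqc: "(x, (p ^^ k) x) \<in> eqc (fun_rel p)" for p and x :: 'd and k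
    by (induction k) (auto simp: eqc_step[symmetric])
  let ?g = "\<lambda>x. 1 / real (card (eqc (fun_rel s) `` {x})) + 1 / real (card (eqc (fun_rel a) `` {x}))
      + 1 / real (card (eqc (fun_rel (s \<circ> a)) `` {x}))"
  let ?h = "\<lambda>(u, v). 1 / real (card {w. (u, w) \<in> E}) +
        1 / real (card (range (\<lambda>k. (ph ^^ k) (u, v)))) - 1 / 2"
  have gZ: "?g z \<le> 3" for z
  proof -
    have "1 / real n \<le> 1" for n by (cases "n = 0") auto
    from this[of "card (eqc (fun_rel s) `` {z})"] this[of "card (eqc (fun_rel a) `` {z})"]
      this[of "card (eqc (fun_rel (s \<circ> a)) `` {z})"] show ?thesis by linarith
  qed
  \<comment> \<open>Class sizes enter through reciprocals, so it suffices to exhibit enough members: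
    the arcs leaving \<open>u\<close>, the two halves of an edge, the darts of a facial
    walk.\<close>
  have gE: "?g (i e) \<le> ?h e + 1" if e: "e \<in> E" for e
  proof -
    obtain u v where uv: "e = (u, v)" by (cases e)
    have uvE: "(u, v) \<in> E" using e uv by simp
    have finw: "finite {w. (u, w) \<in> E}"
      by (rule finite_subset[OF _ finite_imageI[OF finE, of snd]]) force
    have 1: "1 / real (card (eqc (fun_rel s) `` {i e})) \<le> 1 / real (card {w. (u, w) \<in> E})"
    proof (rule divide_left_mono)
      have "inj_on (\<lambda>w. i (u, w)) {w. (u, w) \<in> E}"
        by (rule inj_onI) (use inj_onD[OF i_inj] in auto)
      then have "card {w. (u, w) \<in> E} = card ((\<lambda>w. i (u, w)) ` {w. (u, w) \<in> E})"
        by (rule card_image[symmetric])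
      also have "real \<dots> \<le> real (card (eqc (fun_rel s) `` {i e}))"
      proof (rule cge[OF s iD[OF e]], clarify)
        fix w assume w: "(u, w) \<in> E"
        then obtain k where "(nx u ^^ k) v = w" using cyc[OF uvE] by blast
        then have "i (u, w) = (s ^^ k) (i e)" using nxk[OF uvE] uv by metis
        then show "(i e, i (u, w)) \<in> eqc (fun_rel s)" using funpow_eqc by metis
      qed
      finally show "real (card {w. (u, w) \<in> E}) \<le> real (card (eqc (fun_rel s) `` {i e}))" .
      moreover have "card {w. (u, w) \<in> E} > 0" using finw uvE by (auto simp: card_gt_0_iff)
      ultimately show "0 < real (card (eqc (fun_rel s) `` {i e})) * real (card {w. (u, w) \<in> E})" by simp
    qed simp
    have 2: "1 / real (card (eqc (fun_rel a) `` {i e})) \<le> 1 / 2"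
    proof (rule divide_left_mono)
      have "i (v, u) = a (i e)" using ia[OF uvE] aE[OF e] uv by simp
      moreover have "i (v, u) \<noteq> i (u, v)" using inj_onD[OF i_inj _ Esym[OF uvE] uvE] EV(2)[OF uvE] by auto
      ultimately have "card {i e, a (i e)} = 2" using uv by auto
      moreover have "real (card {i e, a (i e)}) \<le> real (card (eqc (fun_rel a) `` {i e}))"
        by (rule cge[OF a iD[OF e]]) (auto intro: eqc_base)
      ultimately show "2 \<le> real (card (eqc (fun_rel a) `` {i e}))" by simp
      then show "0 < real (card (eqc (fun_rel a) `` {i e})) * 2" by simp
    qed simp
    have 3: "1 / real (card (eqc (fun_rel (s \<circ> a)) `` {i e})) \<le> 1 / real (card (range (\<lambda>k. (ph ^^ k) e)))"
    proof (rule divide_left_mono)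
      have sub: "range (\<lambda>k. (ph ^^ k) e) \<subseteq> E" using phk[OF e] by auto
      have "card (range (\<lambda>k. (ph ^^ k) e)) = card (i ` range (\<lambda>k. (ph ^^ k) e))"
        by (rule card_image[symmetric]) (rule inj_on_subset[OF i_inj sub])
      also have "real \<dots> \<le> real (card (eqc (fun_rel (s \<circ> a)) `` {i e}))"
        by (rule cge[OF sa iD[OF e]]) (use phk[OF e] funpow_eqc in auto)
      finally show "real (card (range (\<lambda>k. (ph ^^ k) e))) \<le> real (card (eqc (fun_rel (s \<circ> a)) `` {i e}))" .
      moreover have "card (range (\<lambda>k. (ph ^^ k) e)) > 0"
        using finite_subset[OF sub finE] by (auto simp: card_gt_0_iff)
      ultimately show "0 < real (card (eqc (fun_rel (s \<circ> a)) `` {i e})) * real (card (range (\<lambda>k. (ph ^^ k) e)))" by simp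
    qed simp
    show ?thesis using 1 2 3 uv by simp
  qed
  obtain e0 where e0: "e0 \<in> E" using E by blast
  have finZ: "finite Z" and ZD: "Z \<subseteq> D" using fin by (auto simp: Z_def)
  have single: "eqc (fun_rel s \<union> fun_rel a) `` {z} = {z}" if z: "z \<in> Z" for z
  proof -
    have "y = z" if "(z, y) \<in> eqc (fun_rel s \<union> fun_rel a)" for y
      using that
    proof (induction rule: eqc_induct)
      case (step y y') then show ?case using Z[OF z] by auto
    next
      case (conv y y')
      then have "s y' = s z \<or> a y' = a z" using Z[OF z] by auto
      then show ?case using sinj permutes_inj[OF a] by (auto dest: injD)
    qed simp
    then show ?thesis by auto
  qed
  \<comment> \<open>The discarded darts are singletons and the arcs fill at least one more class;
    this class offsets the \<open>- 2\<close> in the hypothesis.\<close>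
  have "card Z + 1 \<le> num_classes D (fun_rel s \<union> fun_rel a)"
  proof -
    let ?f = "\<lambda>x. eqc (fun_rel s \<union> fun_rel a) `` {x}"
    have "?f (i e0) \<notin> ?f ` Z"
    proof
      assume "?f (i e0) \<in> ?f ` Z"
      then obtain z where "z \<in> Z" "?f (i e0) = {z}" using single by auto
      moreover have "i e0 \<in> ?f (i e0)" by simp
      ultimately show False using e0 by (auto simp: Z_def)
    qed
    moreover have "inj_on ?f Z" by (rule inj_onI) (use single in auto)
    ultimately have "card (insert (?f (i e0)) (?f ` Z)) = card Z + 1"
      using finZ by (simp add: card_image)
    moreover have "insert (?f (i e0)) (?f ` Z) \<subseteq> ?f ` D" using ZD iD[OF e0] by auto
    ultimately show ?thesis unfolding num_classes_def using card_mono[of "?f ` D"] fin by (metis finite_imageI)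
  qed
  then have "real (card Z) + 1 \<le> real (num_classes D (fun_rel s \<union> fun_rel a))" by linarith
  moreover have "real (num_classes D (fun_rel s)) + real (num_classes D (fun_rel a)) + real (num_classes D (fun_rel (s \<circ> a))) = (\<Sum>x\<in>D. ?g x)"
    by (simp only: num_classes_sum[OF fin subD[OF s]] num_classes_sum[OF fin subD[OF a]] num_classes_sum[OF fin subD[OF sa]] sum.distrib)
  moreover have "real (card D) - 2 \<le> real (num_classes D (fun_rel s)) + real (num_classes D (fun_rel a)) + real (num_classes D (fun_rel (s \<circ> a)))
      - 2 * real (num_classes D (fun_rel s \<union> fun_rel a))"
    using N N' unfolding euler_count_def by linarith
  ultimately have *: "real (card D) + 2 * real (card Z) \<le> (\<Sum>x\<in>D. ?g x)" by linarith
  have D: "D = i ` E \<union> Z" "i ` E \<inter> Z = {}" using iD by (auto simp: Z_def)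
  have split: "(\<Sum>x\<in>D. ?g x) = (\<Sum>x\<in>i ` E. ?g x) + (\<Sum>x\<in>Z. ?g x)"
    unfolding D(1) by (rule sum.union_disjoint) (use finE finZ D in auto)
  have "(\<Sum>x\<in>i ` E. ?g x) = (\<Sum>e\<in>E. ?g (i e))"
    by (simp add: sum.reindex[OF i_inj])
  also have "\<dots> \<le> (\<Sum>e\<in>E. ?h e + 1)" by (rule sum_mono) (rule gE)
  also have "\<dots> = (\<Sum>e\<in>E. ?h e) + real (card E)" by (simp add: sum.distrib)
  finally have onE: "(\<Sum>x\<in>i ` E. ?g x) \<le> (\<Sum>e\<in>E. ?h e) + real (card E)" .
  have "(\<Sum>x\<in>Z. ?g x) \<le> (\<Sum>x\<in>Z. 3)" by (rule sum_mono) (rule gZ)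
  also have "\<dots> = 3 * real (card Z)" by simp
  finally have "(\<Sum>x\<in>D. ?g x) \<le> (\<Sum>e\<in>E. ?h e) + real (card E) + 3 * real (card Z)"
    using onE split by linarith
  moreover have "card D = card E + card Z"
    using card_Un_disjoint[of "i ` E" Z] D finE finZ by (simp add: card_image[OF i_inj])
  ultimately have "0 \<le> (\<Sum>e\<in>E. ?h e)" using * by simp
  then show ?thesis using nx(1) cyc inj unfolding ph_def by blast
qed

end

section \<open>The toroidal grid\<close>

text \<open>A dart is a grid point with a direction; 0, 1, 2, 3 mean east, north, west, south.
  Adding 1 turns left, adding 2 reverses.\<close>

definition grid_darts :: "int \<Rightarrow> ((int \<times> int) \<times> nat) set" where
  "grid_darts n = ({0..<n} \<times> {0..<n}) \<times> {0..<4}"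

definition grid_nb :: "int \<Rightarrow> int \<times> int \<Rightarrow> nat \<Rightarrow> int \<times> int" where
  "grid_nb n p k = (if k = 0 then ((fst p + 1) mod n, snd p) else if k = 1 then (fst p, (snd p + 1) mod n)
     else if k = 2 then ((fst p - 1) mod n, snd p) else (fst p, (snd p - 1) mod n))"

definition grid_rot :: "int \<Rightarrow> (int \<times> int) \<times> nat \<Rightarrow> (int \<times> int) \<times> nat" where
  "grid_rot n d = (if d \<in> grid_darts n then (fst d, (snd d + 1) mod 4) else d)"

definition grid_inv :: "int \<Rightarrow> (int \<times> int) \<times> nat \<Rightarrow> (int \<times> int) \<times> nat" where
  "grid_inv n d = (if d \<in> grid_darts n then (grid_nb n (fst d) (snd d), (snd d + 2) mod 4) else d)"

definition grid_adj :: "int \<Rightarrow> int \<times> int \<Rightarrow> int \<times> int \<Rightarrow> bool" where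
  "grid_adj n p q \<longleftrightarrow> (\<exists>k<4. q = grid_nb n p k)"

lemma less_4_cases: "(k::nat) < 4 \<longleftrightarrow> k = 0 \<or> k = 1 \<or> k = 2 \<or> k = 3"
  by auto

lemma in_grid_darts: "((x, y), k) \<in> grid_darts n \<longleftrightarrow> 0 \<le> x \<and> x < n \<and> 0 \<le> y \<and> y < n \<and> k < 4"
  by (auto simp: grid_darts_def)

lemma mod_plus_minus_one:
  assumes "0 \<le> x" "x < (n::int)"
  shows "((x + 1) mod n - 1) mod n = x" "((x - 1) mod n + 1) mod n = x"
  using assms by (simp_all add: mod_diff_left_eq mod_add_left_eq)

lemma grid_rot_closed: "d \<in> grid_darts n \<Longrightarrow> grid_rot n d \<in> grid_darts n"
  by (cases d) (auto simp: grid_rot_def grid_darts_def)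

lemma grid_nb_range: "0 < n \<Longrightarrow> p \<in> {0..<n} \<times> {0..<n} \<Longrightarrow> grid_nb n p k \<in> {0..<n} \<times> {0..<n}"
  by (auto simp: grid_nb_def)

lemma grid_inv_closed: "0 < n \<Longrightarrow> d \<in> grid_darts n \<Longrightarrow> grid_inv n d \<in> grid_darts n"
  using grid_nb_range[of n "fst d" "snd d"] unfolding grid_inv_def
  by (auto simp: grid_darts_def)

lemma grid_rot_apply: "(p, k) \<in> grid_darts n \<Longrightarrow> grid_rot n (p, k) = (p, (k + 1) mod 4)"
  by (simp add: grid_rot_def)

lemma grid_rot_values:
  assumes "p \<in> {0..<n} \<times> {0..<n}"
  shows "grid_rot n (p, 0) = (p, 1)" "grid_rot n (p, 1) = (p, 2)" "grid_rot n (p, 2) = (p, 3)"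
  using assms by (auto simp: grid_rot_def grid_darts_def)

lemma grid_inv_apply: "(p, k) \<in> grid_darts n \<Longrightarrow> grid_inv n (p, k) = (grid_nb n p k, (k + 2) mod 4)"
  by (simp add: grid_inv_def)

lemma grid_nb_back:
  assumes "p \<in> {0..<n} \<times> {0..<n}" "k < 4" shows "grid_nb n (grid_nb n p k) ((k + 2) mod 4) = p"
  using assms mod_plus_minus_one[of "fst p" n] mod_plus_minus_one[of "snd p" n]
  unfolding less_4_cases grid_nb_def by (cases p) (elim disjE; simp)

lemma grid_nb_round:
  assumes "p \<in> {0..<n} \<times> {0..<n}" "k < 4"
  shows "grid_nb n (grid_nb n (grid_nb n (grid_nb n p k) ((k + 3) mod 4)) ((k + 2) mod 4)) ((k + 1) mod 4) = p"
  using assms mod_plus_minus_one[of "fst p" n] mod_plus_minus_one[of "snd p" n]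
  unfolding less_4_cases grid_nb_def by (cases p) (elim disjE; simp)

lemma grid_rot_4: "(grid_rot n ^^ 4) d = d"
proof (cases "d \<in> grid_darts n")
  case True
  obtain p k where d: "d = (p, k)" by (cases d)
  have k: "k < 4" using True by (auto simp: d grid_darts_def)
  have *: "(p, m) \<in> grid_darts n" if "m < 4" for m
    using True that by (auto simp: d grid_darts_def)
  have "(grid_rot n ^^ 4) d = grid_rot n (grid_rot n (grid_rot n (grid_rot n (p, k))))"
    by (simp add: d eval_nat_numeral)
  also have "\<dots> = (p, ((k + 3) mod 4 + 1) mod 4)"
    using k[unfolded less_4_cases] * by (elim disjE; simp add: grid_rot_apply)
  also have "((k + 3) mod 4 + 1) mod 4 = k" using k by (auto simp: less_4_cases)
  finally show ?thesis by (simp add: d)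
next
  case False
  then show ?thesis by (simp add: grid_rot_def eval_nat_numeral)
qed

lemma grid_inv_inv: assumes "0 < n" shows "grid_inv n (grid_inv n d) = d"
proof (cases "d \<in> grid_darts n")
  case True
  obtain p k where d: "d = (p, k)" by (cases d)
  have p: "p \<in> {0..<n} \<times> {0..<n}" and k: "k < 4" using True by (auto simp: d grid_darts_def)
  have i: "grid_inv n d = (grid_nb n p k, (k + 2) mod 4)" using grid_inv_apply True d by simp
  then have "grid_inv n (grid_inv n d) = (p, ((k + 2) mod 4 + 2) mod 4)"
    using grid_inv_apply[of "grid_nb n p k" "(k + 2) mod 4" n] grid_inv_closed[OF assms True] grid_nb_back[OF p k]
    by simp
  also have "((k + 2) mod 4 + 2) mod 4 = k" using k by (auto simp: less_4_cases)
  finally show ?thesis by (simp add: d)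
next
  case False
  then show ?thesis by (simp add: grid_inv_def)
qed

text \<open>A facial walk goes one step ahead and turns right, hence closes up around a unit square
  after four steps.\<close>

lemma grid_face_step:
  assumes "0 < n" "(p, k) \<in> grid_darts n"
  shows "(grid_rot n \<circ> grid_inv n) (p, k) = (grid_nb n p k, (k + 3) mod 4)"
    "(grid_nb n p k, (k + 3) mod 4) \<in> grid_darts n"
proof -
  have i: "(grid_nb n p k, (k + 2) mod 4) \<in> grid_darts n"
    using grid_inv_closed[OF assms] grid_inv_apply[OF assms(2)] by simp
  have k: "((k + 2) mod 4 + 1) mod 4 = (k + 3) mod 4"
    using assms(2) by (auto simp: grid_darts_def less_4_cases)
  show "(grid_rot n \<circ> grid_inv n) (p, k) = (grid_nb n p k, (k + 3) mod 4)"
    using grid_rot_apply[OF i] grid_inv_apply[OF assms(2)] k by simp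
  then show "(grid_nb n p k, (k + 3) mod 4) \<in> grid_darts n"
    using grid_rot_closed[OF i] grid_rot_apply[OF i] k by simp
qed

lemma grid_face_4:
  assumes n: "0 < n" and d: "d \<in> grid_darts n" shows "((grid_rot n \<circ> grid_inv n) ^^ 4) d = d"
proof -
  let ?f = "grid_rot n \<circ> grid_inv n"
  obtain p k where d': "d = (p, k)" by (cases d)
  have p: "p \<in> {0..<n} \<times> {0..<n}" and k: "k < 4" using d by (auto simp: d' grid_darts_def)
  have k2: "((k + 3) mod 4 + 3) mod 4 = (k + 2) mod 4" and k1: "((k + 2) mod 4 + 3) mod 4 = (k + 1) mod 4"
    and k0: "((k + 1) mod 4 + 3) mod 4 = k" using k by (auto simp: less_4_cases)
  note s1 = grid_face_step[OF n d[unfolded d']]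
  note s2 = grid_face_step[OF n s1(2), unfolded k2]
  note s3 = grid_face_step[OF n s2(2), unfolded k1]
  note s4 = grid_face_step[OF n s3(2), unfolded k0]
  have "(?f ^^ 4) d = ?f (?f (?f (?f (p, k))))" by (simp add: d' eval_nat_numeral)
  also have "\<dots> = d" unfolding s1(1) s2(1) s3(1) s4(1) grid_nb_round[OF p k] d' ..
  finally show ?thesis .
qed

lemma permutes_if_funpow:
  assumes "\<And>x. x \<in> D \<Longrightarrow> p x \<in> D" "\<And>x. x \<notin> D \<Longrightarrow> p x = x" "\<And>x. (p ^^ Suc m) x = x"
  shows "p permutes D"
proof (rule bij_imp_permutes[OF bij_betwI[where g = "p ^^ m"]])
  have "(p ^^ m) x \<in> D" if "x \<in> D" for x using that assms(1) by (induction m) auto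
  then show "p ^^ m \<in> D \<rightarrow> D" by auto
  show "(p ^^ m) (p x) = x" for x using assms(3)[of x] by (simp add: funpow_swap1)
  show "p ((p ^^ m) x) = x" for x using assms(3)[of x] by simp
qed (use assms in auto)

lemma grid_rot_permutes: "grid_rot n permutes grid_darts n"
  by (rule permutes_if_funpow[where m = 3])
    (use grid_rot_4[of n] in \<open>auto simp: grid_rot_closed eval_nat_numeral\<close>, simp add: grid_rot_def)

lemma grid_inv_permutes: "0 < n \<Longrightarrow> grid_inv n permutes grid_darts n"
  by (rule permutes_if_funpow[where m = 1]) (auto simp: grid_inv_closed grid_inv_inv, simp add: grid_inv_def)

text \<open>No cycle has more than \<open>m\<close> elements, so every point contributes at least
  \<open>1 / m\<close> to the number of cycles.\<close>

lemma num_classes_ge_period: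
  assumes fin: "finite D" and p: "p permutes D" and m: "0 < m" and per: "\<And>x. x \<in> D \<Longrightarrow> (p ^^ m) x = x"
  shows "real (card D) / real m \<le> real (num_classes D (fun_rel p))"
proof -
  have "1 / real m \<le> 1 / real (card (eqc (fun_rel p) `` {x}))" if x: "x \<in> D" for x
  proof -
    have "eqc (fun_rel p) `` {x} \<subseteq> (\<lambda>k. (p ^^ k) x) ` {..<m}"
    proof clarify
      fix y assume "(x, y) \<in> eqc (fun_rel p)"
      then obtain k where k: "(p ^^ k) x = y" using eqc_fun_rel_funpow[OF fin p x] by blast
      have "(p ^^ (m * q)) x = x" for q
      proof (induction q)
        case (Suc q)
        then show ?case using per[OF x] by (simp add: funpow_add)
      qed simp
      then have "(p ^^ (k mod m + m * (k div m))) x = (p ^^ (k mod m)) x"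
        unfolding funpow_add by simp
      then have "y = (p ^^ (k mod m)) x" using k by simp
      then show "y \<in> (\<lambda>k. (p ^^ k) x) ` {..<m}" using m by auto
    qed
    then have "card (eqc (fun_rel p) `` {x}) \<le> card ((\<lambda>k. (p ^^ k) x) ` {..<m})"
      by (intro card_mono) auto
    also have "\<dots> \<le> m" using card_image_le[of "{..<m}"] by fastforce
    finally have le: "card (eqc (fun_rel p) `` {x}) \<le> m" .
    have "finite (eqc (fun_rel p) `` {x})"
      by (rule finite_subset[OF _ fin]) (use eqc_fun_rel_closed[OF _ p x] in auto)
    moreover have "x \<in> eqc (fun_rel p) `` {x}" by simp
    ultimately have "card (eqc (fun_rel p) `` {x}) > 0" by (metis card_gt_0_iff empty_iff)
    then show ?thesis using le by (intro divide_left_mono) auto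
  qed
  then have "(\<Sum>x\<in>D. 1 / real m) \<le> (\<Sum>x\<in>D. 1 / real (card (eqc (fun_rel p) `` {x})))"
    by (rule sum_mono)
  also have "\<dots> = real (num_classes D (fun_rel p))"
    by (rule num_classes_sum[symmetric, OF fin]) (use eqc_fun_rel_closed[OF _ p] in auto)
  finally show ?thesis by simp
qed

text \<open>Periods 4, 2 and 4 give at least \<open>1/4 + 1/2 + 1/4\<close> cycles per dart, and the
  grid is connected. As these are lower bounds, tiny grids with loops are covered too.\<close>

lemma grid_euler_count:
  assumes n: "0 < n"
  shows "int (card (grid_darts n)) - 2 \<le> euler_count (grid_darts n) (grid_rot n) (grid_inv n)"
proof -
  let ?D = "grid_darts n" and ?s = "grid_rot n" and ?a = "grid_inv n"
  have fin: "finite ?D" by (simp add: grid_darts_def)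
  have s: "?s permutes ?D" and a: "?a permutes ?D" using grid_rot_permutes grid_inv_permutes[OF n] by auto
  have 1: "real (card ?D) / 4 \<le> real (num_classes ?D (fun_rel ?s))"
    using num_classes_ge_period[OF fin s, of 4] grid_rot_4 by simp
  have 2: "real (card ?D) / 2 \<le> real (num_classes ?D (fun_rel ?a))"
    using num_classes_ge_period[OF fin a, of 2] grid_inv_inv[OF n] by (simp add: eval_nat_numeral)
  have 3: "real (card ?D) / 4 \<le> real (num_classes ?D (fun_rel (?s \<circ> ?a)))"
    using num_classes_ge_period[OF fin permutes_compose[OF a s], of 4] grid_face_4[OF n] by simp
  let ?R = "eqc (fun_rel ?s \<union> fun_rel ?a)"
  have st: "(d, ?s d) \<in> ?R" "(d, ?a d) \<in> ?R" for d by (auto intro: eqc_base)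
  have k0: "(((x, y), k), ((x, y), 0)) \<in> ?R" if "((x, y), k) \<in> ?D" for x y k
  proof -
    have p: "(x, y) \<in> {0..<n} \<times> {0..<n}" using that by (auto simp: grid_darts_def)
    have "(((x, y), 0), ((x, y), 1)) \<in> ?R" "(((x, y), 1), ((x, y), 2)) \<in> ?R" "(((x, y), 2), ((x, y), 3)) \<in> ?R"
      using st(1)[of "((x, y), 0)"] st(1)[of "((x, y), 1)"] st(1)[of "((x, y), 2)"]
      unfolding grid_rot_values[OF p] by this+
    note c = this
    have "k = 0 \<or> k = 1 \<or> k = 2 \<or> k = 3" using that by (auto simp: in_grid_darts)
    then show ?thesis
      using c eqc_sym[OF c(1)] eqc_sym[OF eqc_trans[OF c(1,2)]] eqc_sym[OF eqc_trans[OF c(1) eqc_trans[OF c(2,3)]]]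
      by (elim disjE) simp_all
  qed
  have x0: "(((int x, y), 0), ((0, y), 0)) \<in> ?R" if "int x < n" "0 \<le> y" "y < n" for x y
    using that
  proof (induction x)
    case (Suc x)
    then have D: "((int x, y), 0) \<in> ?D" "((int (Suc x), y), 2) \<in> ?D" by (auto simp: in_grid_darts)
    have "?a ((int x, y), 0) = ((int (Suc x), y), 2)"
      using D Suc.prems by (simp add: grid_inv_def grid_nb_def add.commute)
    then have "(((int x, y), 0), ((int (Suc x), y), 2)) \<in> ?R" using st(2)[of "((int x, y), 0)"] by simp
    then have "(((int x, y), 0), ((int (Suc x), y), 0)) \<in> ?R" using k0[OF D(2)] by (rule eqc_trans)
    then show ?case using Suc eqc_trans[OF eqc_sym] by fastforce
  qed simp
  have y0: "(((0, int y), 0), ((0, 0), 0)) \<in> ?R" if "int y < n" for y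
    using that
  proof (induction y)
    case (Suc y)
    then have D: "((0, int y), 0) \<in> ?D" "((0, int y), 1) \<in> ?D" "((0, int (Suc y)), 3) \<in> ?D"
      using n by (auto simp: in_grid_darts)
    have "?a ((0, int y), 1) = ((0, int (Suc y)), 3)"
      using D Suc.prems by (simp add: grid_inv_def grid_nb_def add.commute)
    then have *: "(((0, int y), 1), ((0, int (Suc y)), 3)) \<in> ?R" using st(2)[of "((0, int y), 1)"] by simp
    have "(((0, int (Suc y)), 0), ((0, int y), 0)) \<in> ?R"
      by (rule eqc_trans[OF eqc_trans[OF eqc_sym[OF k0[OF D(3)]] eqc_sym[OF *]] k0[OF D(2)]])
    moreover have "(((0, int y), 0), ((0, 0), 0)) \<in> ?R" using Suc by simp
    ultimately show ?case by (rule eqc_trans)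
  qed simp
  have all: "(d, ((0, 0), 0)) \<in> ?R" if "d \<in> ?D" for d
  proof -
    obtain x y k where d: "d = ((x, y), k)" by (metis surj_pair)
    with that have b: "0 \<le> x" "x < n" "0 \<le> y" "y < n" by (auto simp: in_grid_darts)
    have "(d, ((x, y), 0)) \<in> ?R" using k0 that d by simp
    moreover have "(((x, y), 0), ((0, y), 0)) \<in> ?R" using x0[of "nat x" y] b by simp
    moreover have "(((0, y), 0), ((0, 0), 0)) \<in> ?R" using y0[of "nat y"] b by simp
    ultimately show ?thesis using eqc_trans by metis
  qed
  have "(\<lambda>x. ?R `` {x}) ` ?D \<subseteq> {?R `` {((0, 0), 0)}}"
  proof (rule image_subsetI)
    fix d assume "d \<in> ?D"
    then show "?R `` {d} \<in> {?R `` {((0, 0), 0)}}" using all by (simp only: singleton_iff eqc_class_eq)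
  qed
  then have "num_classes ?D (fun_rel ?s \<union> fun_rel ?a) \<le> 1"
    unfolding num_classes_def using card_mono[OF finite.insertI[OF finite.emptyI]] by fastforce
  moreover have "real (card ?D) \<le> real (num_classes ?D (fun_rel ?s) + num_classes ?D (fun_rel ?a) + num_classes ?D (fun_rel (?s \<circ> ?a)))"
    using add_mono[OF add_mono[OF 1 2] 3] by simp
  then have "card ?D \<le> num_classes ?D (fun_rel ?s) + num_classes ?D (fun_rel ?a) + num_classes ?D (fun_rel (?s \<circ> ?a))"
    by (simp only: of_nat_le_iff)
  ultimately show ?thesis unfolding euler_count_def by linarith
qed

text \<open>A grid point brings all four darts into its branch set. A dart is chosen only for the
  orientation in \<open>A\<close>; the opposite arc gets its image under \<open>grid_inv\<close>,
  which makes \<open>i\<close> respect reversal.\<close>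

lemma grid_rotation_exists:
  fixes S :: "'a \<Rightarrow> (int \<times> int) set"
  assumes n: "0 < n" and Sn: "\<And>u. u \<in> V \<Longrightarrow> S u \<subseteq> {0..<n} \<times> {0..<n}"
    and disj: "\<And>u v. u \<in> V \<Longrightarrow> v \<in> V \<Longrightarrow> u \<noteq> v \<Longrightarrow> S u \<inter> S v = {}"
    and conn: "\<And>u p q. u \<in> V \<Longrightarrow> p \<in> S u \<Longrightarrow> q \<in> S u \<Longrightarrow>
        (p, q) \<in> eqc {(p, q). p \<in> S u \<and> q \<in> S u \<and> grid_adj n p q}"
    and A: "A \<subseteq> V \<times> V" "A \<inter> A\<inverse> = {}" "A \<noteq> {}"
    and E: "E = A \<union> A\<inverse>"
    and edge: "\<And>u v. (u, v) \<in> A \<Longrightarrow> \<exists>p\<in>S u. \<exists>q\<in>S v. grid_adj n p q"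
  shows "\<exists>nx. (\<forall>u v. (u, v) \<in> E \<longrightarrow> (u, nx u v) \<in> E) \<and>
    (\<forall>u v w. (u, v) \<in> E \<longrightarrow> (u, w) \<in> E \<longrightarrow> (\<exists>k. (nx u ^^ k) v = w)) \<and>
    (\<forall>u v w. (u, v) \<in> E \<longrightarrow> (u, w) \<in> E \<longrightarrow> nx u v = nx u w \<longrightarrow> v = w) \<and>
    0 \<le> (\<Sum>(u, v)\<in>E. 1 / real (card {w. (u, w) \<in> E}) +
        1 / real (card (range (\<lambda>k. ((\<lambda>(x, y). (y, nx y x)) ^^ k) (u, v)))) - 1 / 2)"
proof -
  have "\<exists>p k. p \<in> S u \<and> k < 4 \<and> grid_nb n p k \<in> S v" if "(u, v) \<in> A" for u v
    using edge[OF that] unfolding grid_adj_def by blast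
  then obtain P K where PK: "\<And>u v. (u, v) \<in> A \<Longrightarrow> P u v \<in> S u \<and> K u v < 4 \<and> grid_nb n (P u v) (K u v) \<in> S v"
    by metis
  define Lb where "Lb u = S u \<times> {0..<4::nat}" for u
  define i where "i = (\<lambda>(u, v). if (u, v) \<in> A then (P u v, K u v) else grid_inv n (P v u, K v u))"
  have PD: "(P u v, K u v) \<in> grid_darts n" if "(u, v) \<in> A" for u v
    using PK[OF that] Sn[of u] A that unfolding grid_darts_def by fastforce
  have iL: "i (u, v) \<in> Lb u" if "(u, v) \<in> E" for u v
  proof (cases "(u, v) \<in> A")
    case True then show ?thesis using PK by (auto simp: i_def Lb_def)
  next
    case False
    then have "(v, u) \<in> A" using that E by auto
    then show ?thesis using False PK PD by (auto simp: i_def Lb_def grid_inv_def)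
  qed
  have "minor_map (grid_darts n) (grid_rot n) (grid_inv n) V Lb E i"
  proof
    show "finite (grid_darts n)" by (simp add: grid_darts_def)
    show "grid_rot n permutes grid_darts n" "grid_inv n permutes grid_darts n"
      using grid_rot_permutes grid_inv_permutes[OF n] by auto
    show "grid_inv n \<circ> grid_inv n = id" using grid_inv_inv[OF n] by auto
    show LbD: "Lb u \<subseteq> grid_darts n" if "u \<in> V" for u
      using Sn[OF that] by (auto simp: Lb_def grid_darts_def)
    show "Lb u \<inter> Lb v = {}" if "u \<in> V" "v \<in> V" "u \<noteq> v" for u v
      using disj[OF that] by (auto simp: Lb_def)
    show "grid_rot n x \<in> Lb u" if "u \<in> V" "x \<in> Lb u" for u x
      using that by (auto simp: Lb_def grid_rot_def)
    show "u \<in> V" "u \<noteq> v" "(v, u) \<in> E" if "(u, v) \<in> E" for u v using that E A by auto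
    show "i (u, v) \<in> Lb u" if "(u, v) \<in> E" for u v by (rule iL[OF that])
    show "i (v, u) = grid_inv n (i (u, v))" if "(u, v) \<in> E" for u v
      using that E A by (auto simp: i_def grid_inv_inv[OF n])
    fix u x y assume u: "u \<in> V" "x \<in> Lb u" "y \<in> Lb u"
    let ?R = "fun_rel (grid_rot n) \<union> {(z, grid_inv n z) | z. z \<in> Lb u \<and> grid_inv n z \<in> Lb u}"
    have k0: "((p, k), (p, 0)) \<in> eqc ?R" if pk: "(p, k) \<in> Lb u" for p k
    proof -
      have p: "p \<in> {0..<n} \<times> {0..<n}"
        using Sn[OF u(1)] pk by (auto simp: Lb_def)
      have st: "(d, grid_rot n d) \<in> eqc ?R" for d by (rule eqc_base) simp
      have "((p, 0), (p, 1)) \<in> eqc ?R" "((p, 1), (p, 2)) \<in> eqc ?R" "((p, 2), (p, 3)) \<in> eqc ?R"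
        using st[of "(p, 0)"] st[of "(p, 1)"] st[of "(p, 2)"] unfolding grid_rot_values[OF p] by this+
      note c = this
      have "k = 0 \<or> k = 1 \<or> k = 2 \<or> k = 3" using pk by (auto simp: Lb_def)
      then show ?thesis
        using c eqc_sym[OF c(1)] eqc_sym[OF eqc_trans[OF c(1,2)]] eqc_sym[OF eqc_trans[OF c(1) eqc_trans[OF c(2,3)]]]
        by (elim disjE) simp_all
    qed
    have "((p, 0), (q, 0)) \<in> eqc ?R"
      if "(p, q) \<in> eqc {(p, q). p \<in> S u \<and> q \<in> S u \<and> grid_adj n p q}" for p q
    proof -
      have one: "((p, 0), (q, 0)) \<in> eqc ?R" if pq: "p \<in> S u" "q \<in> S u" "grid_adj n p q" for p q
      proof -
        obtain k where k: "k < 4" "q = grid_nb n p k" using pq by (auto simp: grid_adj_def)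
        have L: "(p, k) \<in> Lb u" "(q, (k + 2) mod 4) \<in> Lb u" using pq k by (auto simp: Lb_def)
        have "grid_inv n (p, k) = (q, (k + 2) mod 4)"
          using LbD[OF u(1)] L k by (auto simp: grid_inv_def)
        then have "((p, k), (q, (k + 2) mod 4)) \<in> eqc ?R" using L
          by (intro eqc_base UnI2 CollectI exI[of _ "(p, k)"]) simp
        from eqc_trans[OF eqc_sym[OF k0[OF L(1)]] eqc_trans[OF this k0[OF L(2)]]] show ?thesis .
      qed
      from that show ?thesis
      proof (induction rule: eqc_induct)
        case (step y z)
        then show ?case using one[of y z] eqc_trans[OF step.IH] by auto
      next
        case (conv y z)
        then show ?case using one[of z y] eqc_trans[OF conv.IH eqc_sym] by auto
      qed simp
    qed
    moreover have "(fst x, fst y) \<in> eqc {(p, q). p \<in> S u \<and> q \<in> S u \<and> grid_adj n p q}"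
      using u by (intro conn) (auto simp: Lb_def)
    ultimately have "((fst x, 0), (fst y, 0)) \<in> eqc ?R" by blast
    from eqc_trans[OF k0[of "fst x" "snd x"] eqc_trans[OF this eqc_sym[OF k0[of "fst y" "snd y"]]]]
    show "(x, y) \<in> eqc ?R" using u by simp
  qed
  then interpret minor_map "grid_darts n" "grid_rot n" "grid_inv n" V Lb E i .
  show ?thesis by (rule rotation_exists) (use A E grid_euler_count[OF n] in auto)
qed

section \<open>Grid minors from drawings on the torus\<close>

text \<open>The circle is cut into \<open>n\<close> half-open arcs of equal length, numbered from 0
  to \<open>n - 1\<close>.\<close>

definition cell :: "int \<Rightarrow> complex \<Rightarrow> int" where
  "cell n z = \<lfloor>of_int n * Arg2pi z / (2 * pi)\<rfloor>"

lemma cell_range: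
  assumes "0 < n" shows "0 \<le> cell n z" "cell n z < n"
proof -
  have "0 \<le> Arg2pi z" "Arg2pi z < 2 * pi" using Arg2pi[of z] by auto
  then have "0 \<le> of_int n * Arg2pi z / (2 * pi)" "of_int n * Arg2pi z / (2 * pi) < of_int n"
    using assms by (auto simp: divide_simps)
  then show "0 \<le> cell n z" "cell n z < n" unfolding cell_def by (auto simp: floor_less_iff)
qed

lemma cis_Arg2pi: "norm z = 1 \<Longrightarrow> cis (Arg2pi z) = z"
  using complex_norm_eq_1_exp[of z] by (simp add: cis_conv_exp)

text \<open>Any angle of the point differs from \<open>Arg2pi\<close> by a multiple of
  \<open>2 * pi\<close>, that is, by a multiple of \<open>n\<close> in the index.\<close>

lemma cell_cis: "cell n (cis t) = \<lfloor>of_int n * t / (2 * pi)\<rfloor> mod n" if n: "0 < n"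
proof -
  have "cis (Arg2pi (cis t)) = cis t" by (rule cis_Arg2pi) simp
  then obtain m where m: "Arg2pi (cis t) = t + 2 * of_int m * pi"
    using exp_eq[of "\<i> * of_real (Arg2pi (cis t))" "\<i> * of_real t"]
    by (auto simp: cis_conv_exp complex_eq_iff)
  have "of_int n * Arg2pi (cis t) / (2 * pi) = of_int n * t / (2 * pi) + of_int (n * m)"
    unfolding m by (simp add: field_simps)
  then have "cell n (cis t) = \<lfloor>of_int n * t / (2 * pi)\<rfloor> + n * m"
    unfolding cell_def by (simp only: floor_add_int)
  moreover have "cell n (cis t) = cell n (cis t) mod n" using cell_range[OF n] by simp
  ultimately show ?thesis by simp
qed

lemma norm_cis_diff_le: "norm (cis a - cis b) \<le> \<bar>a - b\<bar>"
proof -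
  have "cis a - cis b = cis b * (cis (a - b) - 1)" by (simp add: algebra_simps cis_mult)
  then have "norm (cis a - cis b) = norm (exp (\<i> * of_real (a - b)) - 1)"
    by (simp add: norm_mult cis_conv_exp)
  also have "\<dots> = 2 * \<bar>sin ((a - b) / 2)\<bar>" by (rule dist_exp_i_1)
  also have "\<dots> \<le> 2 * \<bar>(a - b) / 2\<bar>" using abs_sin_x_le_abs_x[of "(a - b) / 2"] by simp
  finally show ?thesis by simp
qed

lemma floor_close: "\<bar>x - y\<bar> < 1 \<Longrightarrow> \<lfloor>x\<rfloor> = \<lfloor>y\<rfloor> \<or> \<lfloor>x\<rfloor> = \<lfloor>y\<rfloor> + 1 \<or> \<lfloor>x\<rfloor> = \<lfloor>y\<rfloor> - (1::int)" for x y :: real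
  by linarith

lemma scaled_close:
  assumes "0 < (n::int)" "\<bar>a - b\<bar> < 2 * pi / of_int n"
  shows "\<bar>of_int n * a / (2 * pi) - of_int n * b / (2 * pi)\<bar> < 1"
proof -
  have "of_int n * a / (2 * pi) - of_int n * b / (2 * pi) = of_int n / (2 * pi) * (a - b)"
    by (simp add: field_simps)
  then have "\<bar>of_int n * a / (2 * pi) - of_int n * b / (2 * pi)\<bar> = of_int n / (2 * pi) * \<bar>a - b\<bar>"
    using assms(1) by (simp add: abs_mult)
  also have "\<dots> < of_int n / (2 * pi) * (2 * pi / of_int n)"
    using assms by (intro mult_strict_left_mono) auto
  also have "\<dots> = 1" using assms(1) by simp
  finally show ?thesis .
qed

lemma cell_step:
  assumes n: "0 < n" and ab: "\<bar>a - b\<bar> < 2 * pi / of_int n"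
  shows "cell n (cis b) = cell n (cis a) \<or> cell n (cis b) = (cell n (cis a) + 1) mod n
    \<or> cell n (cis b) = (cell n (cis a) - 1) mod n"
  using floor_close[OF scaled_close[OF n, of b a]] ab unfolding cell_cis[OF n]
  by (auto simp: abs_minus_commute mod_simps)

lemma cell_eq_close:
  assumes n: "0 < n" and z: "norm z = 1" "norm w = 1" and eq: "cell n z = cell n w"
  shows "norm (z - w) \<le> 2 * pi / of_int n"
proof -
  have "\<bar>of_int n * Arg2pi z / (2 * pi) - of_int n * Arg2pi w / (2 * pi)\<bar> \<le> 1"
    using eq unfolding cell_def by linarith
  moreover have "of_int n * Arg2pi z / (2 * pi) - of_int n * Arg2pi w / (2 * pi) =
      of_int n / (2 * pi) * (Arg2pi z - Arg2pi w)"
    by (simp add: field_simps)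
  ultimately have "of_int n / (2 * pi) * \<bar>Arg2pi z - Arg2pi w\<bar> \<le> 1"
    using n by (simp add: abs_mult)
  then have "\<bar>Arg2pi z - Arg2pi w\<bar> \<le> 2 * pi / of_int n"
    using n by (simp add: field_simps)
  then show ?thesis
    using norm_cis_diff_le[of "Arg2pi z" "Arg2pi w"] cis_Arg2pi z by force
qed

text \<open>A continuous logarithm exists on the contractible interval; on the unit circle its real
  part vanishes and its imaginary part is the angle.\<close>

lemma circle_lift:
  assumes "continuous_on {0..1} g" "\<And>t. t \<in> {0..1::real} \<Longrightarrow> norm (g t :: complex) = 1"
  obtains th where "continuous_on {0..1} th" "\<And>t. t \<in> {0..1} \<Longrightarrow> g t = cis (th t)"
proof -
  have "contractible {0..1::real}" by (simp add: convex_imp_contractible)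
  moreover have "g t \<noteq> 0" if "t \<in> {0..1}" for t using assms(2)[OF that] by auto
  ultimately obtain h where h: "continuous_on {0..1} h" "\<And>t. t \<in> {0..1} \<Longrightarrow> g t = exp (h t)"
    using continuous_logarithm_on_contractible[OF assms(1)] by metis
  show ?thesis
  proof
    show "continuous_on {0..1} (\<lambda>t. Im (h t))" by (intro continuous_intros h)
    fix t :: real assume t: "t \<in> {0..1}"
    have "exp (Re (h t)) = 1" using assms(2)[OF t] h(2)[OF t] by simp
    then have "Re (h t) = 0" by simp
    then have "h t = \<i> * of_real (Im (h t))" by (simp add: complex_eq_iff)
    then show "g t = cis (Im (h t))" using h(2)[OF t] by (metis cis_conv_exp)
  qed
qed

text \<open>The first coordinate is advanced before the second, so that successive cells are grid neighbours.\<close>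

definition staircase :: "(real \<Rightarrow> complex \<times> complex) \<Rightarrow> nat \<Rightarrow> nat \<Rightarrow> complex \<times> complex" where
  "staircase g K j = (fst (g (real ((j + 1) div 2) / real K)), snd (g (real (j div 2) / real K)))"

definition cell2 :: "int \<Rightarrow> complex \<times> complex \<Rightarrow> int \<times> int" where
  "cell2 n p = (cell n (fst p), cell n (snd p))"

lemma eventually_lift_close:
  assumes "continuous_on {0..1} (th :: real \<Rightarrow> real)" "0 < d"
  shows "\<forall>\<^sub>F K in sequentially. \<forall>s\<in>{0..1}. \<forall>t\<in>{0..1}. \<bar>s - t\<bar> \<le> 1 / real K \<longrightarrow> \<bar>th s - th t\<bar> < d"
proof -
  have "uniformly_continuous_on {0..1} th" by (intro compact_uniformly_continuous assms) auto
  then obtain r where r: "0 < r"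
    "\<And>s t. s \<in> {0..1} \<Longrightarrow> t \<in> {0..1} \<Longrightarrow> dist s t < r \<Longrightarrow> dist (th s) (th t) < d"
    using assms(2) unfolding uniformly_continuous_on_def by metis
  have "\<forall>\<^sub>F K in sequentially. inverse (real K) < r"
    using r(1) lim_inverse_n by (rule order_tendstoD(2)[rotated])
  then show ?thesis
  proof (rule eventually_mono)
    fix K assume "inverse (real K) < r"
    then show "\<forall>s\<in>{0..1}. \<forall>t\<in>{0..1}. \<bar>s - t\<bar> \<le> 1 / real K \<longrightarrow> \<bar>th s - th t\<bar> < d"
      using r(2) by (auto simp: dist_real_def inverse_eq_divide)
  qed
qed

text \<open>By uniform continuity of both angle functions a fine sampling changes each coordinate by
  less than one arc. The points of the staircase may lie off the curve, hence the distance
  bound.\<close>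

lemma eventually_walk:
  assumes g: "path g" "path_image g \<subseteq> torus" and n: "0 < n"
  shows "\<forall>\<^sub>F K in sequentially.
    (\<forall>j<2 * K. cell2 n (staircase g K (Suc j)) = cell2 n (staircase g K j) \<or>
        grid_adj n (cell2 n (staircase g K j)) (cell2 n (staircase g K (Suc j)))) \<and>
    (\<forall>j\<le>2 * K. staircase g K j \<in> torus \<and> dist (staircase g K j) (g (real (j div 2) / real K)) \<le> 2 * pi / of_int n)"
proof -
  have cont: "continuous_on {0..1} (\<lambda>t. fst (g t))" "continuous_on {0..1} (\<lambda>t. snd (g t))"
    using g(1) unfolding path_def by (auto intro: continuous_intros)
  have nrm: "norm (fst (g t)) = 1" "norm (snd (g t)) = 1" if "t \<in> {0..1}" for t
    using g(2) that unfolding path_image_def torus_def by (auto simp: image_subset_iff mem_Times_iff)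
  obtain x where x: "continuous_on {0..1} x" "\<And>t. t \<in> {0..1} \<Longrightarrow> fst (g t) = cis (x t)"
    using circle_lift[OF cont(1) nrm(1)] by metis
  obtain y where y: "continuous_on {0..1} y" "\<And>t. t \<in> {0..1} \<Longrightarrow> snd (g t) = cis (y t)"
    using circle_lift[OF cont(2) nrm(2)] by metis
  have d: "0 < 2 * pi / of_int n" using n by simp
  show ?thesis
    using eventually_lift_close[OF x(1) d] eventually_lift_close[OF y(1) d] eventually_gt_at_top[of 0]
  proof eventually_elim
    fix K :: nat
    assume X: "\<forall>s\<in>{0..1}. \<forall>t\<in>{0..1}. \<bar>s - t\<bar> \<le> 1 / real K \<longrightarrow> \<bar>x s - x t\<bar> < 2 * pi / of_int n"
      and Y: "\<forall>s\<in>{0..1}. \<forall>t\<in>{0..1}. \<bar>s - t\<bar> \<le> 1 / real K \<longrightarrow> \<bar>y s - y t\<bar> < 2 * pi / of_int n"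
      and K: "0 < K"
    have in01: "real m / real K \<in> {0..1}" if "m \<le> K" for m using that K by (auto simp: divide_simps)
    have near: "\<bar>real m / real K - real m' / real K\<bar> \<le> 1 / real K" if "m = m' \<or> m = Suc m' \<or> m' = Suc m" for m m'
      using that K by (auto simp: field_simps)
    have xs: "\<bar>x (real m / real K) - x (real m' / real K)\<bar> < 2 * pi / of_int n"
      if "m \<le> K" "m' \<le> K" "m = m' \<or> m = Suc m' \<or> m' = Suc m" for m m'
      using X in01[OF that(1)] in01[OF that(2)] near[OF that(3)] by blast
    have ys: "\<bar>y (real m / real K) - y (real m' / real K)\<bar> < 2 * pi / of_int n"
      if "m \<le> K" "m' \<le> K" "m = m' \<or> m = Suc m' \<or> m' = Suc m" for m m'
      using Y in01[OF that(1)] in01[OF that(2)] near[OF that(3)] by blast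
    show "(\<forall>j<2 * K. cell2 n (staircase g K (Suc j)) = cell2 n (staircase g K j) \<or>
        grid_adj n (cell2 n (staircase g K j)) (cell2 n (staircase g K (Suc j)))) \<and>
      (\<forall>j\<le>2 * K. staircase g K j \<in> torus \<and> dist (staircase g K j) (g (real (j div 2) / real K)) \<le> 2 * pi / of_int n)"
    proof (intro conjI allI impI)
      fix j assume j: "j < 2 * K"
      show "cell2 n (staircase g K (Suc j)) = cell2 n (staircase g K j) \<or>
        grid_adj n (cell2 n (staircase g K j)) (cell2 n (staircase g K (Suc j)))"
      proof (cases "even j")
        case True
        then obtain m where m: "j = 2 * m" by blast
        have le: "m \<le> K" "Suc m \<le> K" using j m by auto
        have "cell n (cis (x (real (Suc m) / real K))) \<in> {cell n (cis (x (real m / real K))),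
          (cell n (cis (x (real m / real K))) + 1) mod n, (cell n (cis (x (real m / real K))) - 1) mod n}"
          using cell_step[OF n xs[OF le]] by auto
        then show ?thesis
          unfolding staircase_def cell2_def m grid_adj_def grid_nb_def
          using x(2)[OF in01[OF le(1)]] x(2)[OF in01[OF le(2)]] 
          by (auto intro: exI[of _ "0::nat"] exI[of _ "2::nat"])
      next
        case False
        then obtain m where m: "j = 2 * m + 1" by (elim oddE)
        have le: "m \<le> K" "Suc m \<le> K" using j m by auto
        have "cell n (cis (y (real (Suc m) / real K))) \<in> {cell n (cis (y (real m / real K))),
          (cell n (cis (y (real m / real K))) + 1) mod n, (cell n (cis (y (real m / real K))) - 1) mod n}"
          using cell_step[OF n ys[OF le]] by auto
        then show ?thesis
          unfolding staircase_def cell2_def m grid_adj_def grid_nb_def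
          using y(2)[OF in01[OF le(1)]] y(2)[OF in01[OF le(2)]]
          by (auto intro: exI[of _ "1::nat"] exI[of _ "3::nat"])
      qed
    next
      fix j assume j: "j \<le> 2 * K"
      have le: "(j + 1) div 2 \<le> K" "j div 2 \<le> K" using j by auto
      show "staircase g K j \<in> torus"
        unfolding staircase_def torus_def using nrm in01[OF le(1)] in01[OF le(2)] by (auto simp: dist_norm)
      have s: "(j + 1) div 2 = j div 2 \<or> (j + 1) div 2 = Suc (j div 2) \<or> j div 2 = Suc ((j + 1) div 2)" by linarith
      have "dist (staircase g K j) (g (real (j div 2) / real K)) =
          dist (fst (g (real ((j + 1) div 2) / real K))) (fst (g (real (j div 2) / real K)))"
        by (simp add: staircase_def dist_prod_def)
      also have "\<dots> \<le> \<bar>x (real ((j + 1) div 2) / real K) - x (real (j div 2) / real K)\<bar>"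
        unfolding x(2)[OF in01[OF le(1)]] x(2)[OF in01[OF le(2)]] dist_norm by (rule norm_cis_diff_le)
      finally show "dist (staircase g K j) (g (real (j div 2) / real K)) \<le> 2 * pi / of_int n"
        using xs[OF le s] by linarith
    qed
  qed
qed

lemma cell2_eq_close:
  assumes n: "0 < n" and p: "p \<in> torus" "q \<in> torus" and eq: "cell2 n p = cell2 n q"
  shows "dist p q \<le> 4 * pi / of_int n"
proof -
  have nrm: "norm (fst p) = 1" "norm (fst q) = 1" "norm (snd p) = 1" "norm (snd q) = 1"
    using p by (auto simp: torus_def)
  have "dist p q \<le> dist (fst p) (fst q) + dist (snd p) (snd q)"
    unfolding dist_prod_def by (rule sqrt_sum_squares_le_sum) auto
  also have "\<dots> \<le> 2 * pi / of_int n + 2 * pi / of_int n"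
    using eq nrm unfolding cell2_def dist_norm by (intro add_mono cell_eq_close[OF n]) auto
  finally show ?thesis by (simp add: field_simps)
qed

text \<open>On the compact set of parameter pairs outside \<open>U\<close> the distance has a
  positive minimum, below which \<open>c / real n\<close> eventually falls.\<close>

lemma eventually_separated:
  assumes f: "continuous_on {0..1::real} f" and g: "continuous_on {0..1::real} g" and U: "open U"
    and sep: "\<And>s t. s \<in> {0..1} \<Longrightarrow> t \<in> {0..1} \<Longrightarrow> f s = (g t :: 'm :: metric_space) \<Longrightarrow> (s, t) \<in> U"
    and c: "0 < c"
  shows "\<forall>\<^sub>F n in sequentially. \<forall>s\<in>{0..1}. \<forall>t\<in>{0..1}. dist (f s) (g t) \<le> c / real n \<longrightarrow> (s, t) \<in> U"
proof -
  define C where "C = {0..1} \<times> {0..1} - U"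
  have cmp: "compact C" unfolding C_def by (intro compact_diff compact_Times U) auto
  have cont: "continuous_on C (\<lambda>p. dist (f (fst p)) (g (snd p)))"
    by (intro continuous_intros continuous_on_compose2[OF f] continuous_on_compose2[OF g]) (auto simp: C_def)
  have "\<exists>d>0. \<forall>p\<in>C. d \<le> dist (f (fst p)) (g (snd p))"
  proof (cases "C = {}")
    case True then show ?thesis by (auto intro: exI[of _ 1])
  next
    case False
    obtain p where p: "p \<in> C" "\<And>q. q \<in> C \<Longrightarrow> dist (f (fst p)) (g (snd p)) \<le> dist (f (fst q)) (g (snd q))"
      using continuous_attains_inf[OF cmp False cont] by blast
    have "f (fst p) \<noteq> g (snd p)" using p(1) sep[of "fst p" "snd p"] by (auto simp: C_def)
    then show ?thesis using p(2) by (intro exI[of _ "dist (f (fst p)) (g (snd p))"]) auto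
  qed
  then obtain d where d: "0 < d" "\<And>p. p \<in> C \<Longrightarrow> d \<le> dist (f (fst p)) (g (snd p))" by blast
  have "(\<lambda>n. c * inverse (real n)) \<longlonglongrightarrow> c * 0" by (intro tendsto_intros lim_inverse_n)
  then have "\<forall>\<^sub>F n in sequentially. c * inverse (real n) < d"
    using d(1) by (intro order_tendstoD(2)) auto
  then show ?thesis
  proof (rule eventually_mono)
    fix n assume n: "c * inverse (real n) < d"
    show "\<forall>s\<in>{0..1}. \<forall>t\<in>{0..1}. dist (f s) (g t) \<le> c / real n \<longrightarrow> (s, t) \<in> U"
    proof (intro ballI impI, rule ccontr)
      fix s t :: real assume st: "s \<in> {0..1}" "t \<in> {0..1}" "dist (f s) (g t) \<le> c / real n" "(s, t) \<notin> U"
      then have "d \<le> dist (f s) (g t)" using d(2)[of "(s, t)"] by (auto simp: C_def)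
      then show False using n st(3) by (simp add: divide_inverse)
    qed
  qed
qed

definition third :: "'a \<times> 'a \<Rightarrow> 'a \<Rightarrow> real set" where
  "third e x = (if x = fst e then {..<1/3} else {}) \<union> (if x = snd e then {2/3<..} else {})"

lemma open_third: "open (third e x)"
  by (auto simp: third_def)

lemma third_unique: "t \<in> third e x \<Longrightarrow> t \<in> third e y \<Longrightarrow> x = y"
  by (auto simp: third_def split: if_splits)

text \<open>The coincidences of cells that are tolerated. On a single edge the bound 1/6 is smaller
  than the gap 1/3 between the outer thirds, so these never share a cell; two edges may share cells
  only near a common end.\<close>

definition prox :: "'a \<times> 'a \<Rightarrow> 'a \<times> 'a \<Rightarrow> (real \<times> real) set" where
  "prox e e' = (if e = e' then {(s, t). \<bar>s - t\<bar> < 1/6} else (\<Union>x. third e x \<times> third e' x))"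

lemma open_prox: "open (prox e e')"
proof -
  have "open {p :: real \<times> real. \<bar>fst p - snd p\<bar> < 1/6}"
    by (intro open_Collect_less continuous_intros)
  moreover have "{p :: real \<times> real. \<bar>fst p - snd p\<bar> < 1/6} = {(s, t). \<bar>s - t\<bar> < 1/6}" by auto
  ultimately show ?thesis by (auto simp: prox_def intro!: open_Times open_third)
qed

lemma half_index:
  assumes "j \<le> 2 * K" "0 < K" shows "real (j div 2) / real K \<in> {0..1}"
proof -
  have "j div 2 \<le> K" using assms(1) by linarith
  then show ?thesis using assms(2) by simp
qed

text \<open>
  The branch set of a vertex consists of the cells met by the outer thirds of its edges; the cells met
  by the middle third of an edge are absorbed by the branch set of its first end point. The underlying
  closed sets being disjoint, a sufficiently fine grid keeps the branch sets apart.
\<close>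

lemma toroidal_rotation_exists:
  fixes G :: "'a pair_pre_digraph"
  assumes G: "pair_graph G" and tor: "toroidal G" and ne: "parcs G \<noteq> {}"
  defines "E \<equiv> parcs G"
  shows "\<exists>nx. (\<forall>u v. (u, v) \<in> E \<longrightarrow> (u, nx u v) \<in> E) \<and>
    (\<forall>u v w. (u, v) \<in> E \<longrightarrow> (u, w) \<in> E \<longrightarrow> (\<exists>k. (nx u ^^ k) v = w)) \<and>
    (\<forall>u v w. (u, v) \<in> E \<longrightarrow> (u, w) \<in> E \<longrightarrow> nx u v = nx u w \<longrightarrow> v = w) \<and>
    0 \<le> (\<Sum>(u, v)\<in>E. 1 / real (card {w. (u, w) \<in> E}) +
        1 / real (card (range (\<lambda>k. ((\<lambda>(x, y). (y, nx y x)) ^^ k) (u, v)))) - 1 / 2)"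
proof -
  interpret g: pair_graph G by (rule G)
  have Esym: "(v, u) \<in> E" if "(u, v) \<in> E" for u v
    using that g.pair_sym_arcs unfolding symmetric_def E_def by (auto simp: sym_def)
  have Eirr: "u \<noteq> v" if "(u, v) \<in> E" for u v using g.pair_no_loops[of "(u, v)"] that by (simp add: E_def)
  have EV: "u \<in> pverts G" "v \<in> pverts G" if "(u, v) \<in> E" for u v
    using that g.in_arcsD1 g.in_arcsD2 by (auto simp: E_def)
  obtain ph ga where emb: "embedding_in G torus ph ga" using tor by (auto simp: toroidal_def)
  have phinj: "inj_on ph (pverts G)" using emb by (simp add: embedding_in_def)
  have ga: "arc (ga (u, v))" "path_image (ga (u, v)) \<subseteq> torus" "ga (u, v) 0 = ph u" "ga (u, v) 1 = ph v"
    if "(u, v) \<in> E" for u v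
    using emb that unfolding embedding_in_def E_def by (auto simp: pathstart_def pathfinish_def)
  have meet: "path_image (ga (u, v)) \<inter> path_image (ga (x, y)) \<subseteq> ph ` ({u, v} \<inter> {x, y})"
    if "(u, v) \<in> E" "(x, y) \<in> E" "{u, v} \<noteq> {x, y}" for u v x y
    using emb that unfolding embedding_in_def E_def by blast
  obtain f :: "'a \<Rightarrow> nat" where f: "inj_on f (pverts G)"
    using finite_imp_inj_to_nat_seg[OF g.pair_finite_verts] by blast
  \<comment> \<open>A numbering of the vertices orients every edge, leaving one curve and one walk
    per edge.\<close>
  define A where "A = {e \<in> E. f (fst e) < f (snd e)}"
  have finA: "finite A" using g.pair_finite_arcs by (simp add: A_def E_def)
  have AE: "A \<subseteq> E" by (auto simp: A_def)
  have fne: "f u \<noteq> f v" if "(u, v) \<in> E" for u v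
    using inj_onD[OF f] EV[OF that] Eirr[OF that] by blast
  have EA: "E = A \<union> A\<inverse>"
    using fne Esym by (fastforce simp: A_def)
  have Aanti: "(v, u) \<notin> A" if "(u, v) \<in> A" for u v using that by (auto simp: A_def)
  have garc: "arc (ga e)" "path (ga e)" "path_image (ga e) \<subseteq> torus" "ga e 0 = ph (fst e)" "ga e 1 = ph (snd e)"
    if "e \<in> A" for e
    using ga[of "fst e" "snd e"] that AE by (auto simp: arc_imp_path)
  have gcont: "continuous_on {0..1} (ga e)" if "e \<in> A" for e using garc(2)[OF that] by (simp add: path_def)
  have gsep: "(s, t) \<in> prox e e'" if e: "e \<in> A" "e' \<in> A" and st: "s \<in> {0..1}" "t \<in> {0..1}" "ga e s = ga e' t"
    for e e' s t
  proof (cases "e = e'")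
    case True
    then have "s = t" using arcD[OF garc(1)[OF e(1)]] st by simp
    then show ?thesis using True by (simp add: prox_def)
  next
    case False
    obtain a b a' b' where ab: "e = (a, b)" "e' = (a', b')" by (cases e, cases e') auto
    have abE: "(a, b) \<in> E" "(a', b') \<in> E" using e AE ab by auto
    have "{a, b} \<noteq> {a', b'}" using False e Aanti ab by (auto simp: doubleton_eq_iff)
    from meet[OF abE this] st obtain x where x: "x \<in> {a, b}" "x \<in> {a', b'}" "ga e s = ph x"
      unfolding path_image_def ab by blast
    have in_third: "r \<in> third e'' x"
      if e'': "e'' \<in> A" "x \<in> {fst e'', snd e''}" "r \<in> {0..1}" "ga e'' r = ph x" for e'' r
    proof (cases "x = fst e''")
      case True
      then have "r = 0" using arcD[OF garc(1)[OF e''(1)], of r 0] garc(4)[OF e''(1)] e'' by simp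
      then show ?thesis using True by (simp add: third_def)
    next
      case False
      then have "x = snd e''" using e'' by auto
      then have "r = 1" using arcD[OF garc(1)[OF e''(1)], of r 1] garc(5)[OF e''(1)] e'' by simp
      then show ?thesis using \<open>x = snd e''\<close> by (simp add: third_def)
    qed
    have "s \<in> third e x" "t \<in> third e' x"
      using in_third[OF e(1), of s] in_third[OF e(2), of t] x st ab by auto
    then show ?thesis using False by (auto simp: prox_def)
  qed
  have "\<forall>\<^sub>F n in sequentially. \<forall>e\<in>A. \<forall>e'\<in>A. \<forall>s\<in>{0..1}. \<forall>t\<in>{0..1}.
      dist (ga e s) (ga e' t) \<le> 8 * pi / real n \<longrightarrow> (s, t) \<in> prox e e'"
    by (intro eventually_ball_finite finA ballI eventually_separated gcont open_prox gsep) auto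
  from eventually_conj[OF this eventually_gt_at_top[of 0]] obtain n0 :: nat where n0: "0 < n0"
    and close: "\<And>e e' s t. e \<in> A \<Longrightarrow> e' \<in> A \<Longrightarrow> s \<in> {0..1} \<Longrightarrow> t \<in> {0..1} \<Longrightarrow>
      dist (ga e s) (ga e' t) \<le> 8 * pi / real n0 \<Longrightarrow> (s, t) \<in> prox e e'"
    by (auto simp: eventually_sequentially)
  define n where "n = int n0"
  have n: "0 < n" using n0 by (simp add: n_def)
  have "\<forall>\<^sub>F K in sequentially. \<forall>e\<in>A.
    (\<forall>j<2 * K. cell2 n (staircase (ga e) K (Suc j)) = cell2 n (staircase (ga e) K j) \<or>
        grid_adj n (cell2 n (staircase (ga e) K j)) (cell2 n (staircase (ga e) K (Suc j)))) \<and>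
    (\<forall>j\<le>2 * K. staircase (ga e) K j \<in> torus \<and>
      dist (staircase (ga e) K j) (ga e (real (j div 2) / real K)) \<le> 2 * pi / of_int n)"
    by (intro eventually_ball_finite finA ballI eventually_walk garc n)
  from eventually_conj[OF this eventually_gt_at_top[of 0]] obtain K :: nat where K: "0 < K"
    and walk: "\<And>e j. e \<in> A \<Longrightarrow> j < 2 * K \<Longrightarrow> cell2 n (staircase (ga e) K (Suc j)) = cell2 n (staircase (ga e) K j) \<or>
        grid_adj n (cell2 n (staircase (ga e) K j)) (cell2 n (staircase (ga e) K (Suc j)))"
    and smp: "\<And>e j. e \<in> A \<Longrightarrow> j \<le> 2 * K \<Longrightarrow> staircase (ga e) K j \<in> torus"
      "\<And>e j. e \<in> A \<Longrightarrow> j \<le> 2 * K \<Longrightarrow> dist (staircase (ga e) K j) (ga e (real (j div 2) / real K)) \<le> 2 * pi / of_int n"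
    by (auto simp: eventually_sequentially)
  define M where "M = 2 * K"
  define W where "W e j = cell2 n (staircase (ga e) K j)" for e j
  define ta where "ta j = real (j div 2) / real K" for j
  have ta01: "ta j \<in> {0..1}" if "j \<le> M" for j using half_index K that by (simp add: ta_def M_def)
  have ta0: "ta 0 = 0" and taM: "ta M = 1" using K by (auto simp: ta_def M_def)
  have tamono: "ta i \<le> ta j" if "i \<le> j" for i j
    using div_le_mono[OF that, of 2] unfolding ta_def by (intro divide_right_mono) auto
  have step: "W e (Suc j) = W e j \<or> grid_adj n (W e j) (W e (Suc j))" if "e \<in> A" "j < M" for e j
    using walk[OF that[unfolded M_def]] by (simp add: W_def)
  \<comment> \<open>The threshold \<open>8 * pi / n\<close> consists of \<open>2 * pi / n\<close>
    for each staircase leaving its curve and \<open>4 * pi / n\<close> for two points in the same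
    cell.\<close>
  have sep: "(ta j, ta j') \<in> prox e e'"
    if e: "e \<in> A" "e' \<in> A" and j: "j \<le> M" "j' \<le> M" and eq: "W e j = W e' j'" for e e' j j'
  proof (rule close[OF e ta01[OF j(1)] ta01[OF j(2)]])
    have "dist (ga e (ta j)) (ga e' (ta j')) \<le> dist (staircase (ga e) K j) (ga e (ta j)) +
        dist (staircase (ga e) K j) (staircase (ga e') K j') + dist (staircase (ga e') K j') (ga e' (ta j'))"
      by metric
    also have "\<dots> \<le> 2 * pi / of_int n + 4 * pi / of_int n + 2 * pi / of_int n"
      using smp e j cell2_eq_close[OF n smp(1)[OF e(1), of j] smp(1)[OF e(2), of j']] eq
      unfolding ta_def M_def W_def by (intro add_mono) auto
    also have "\<dots> = 8 * pi / real n0" by (simp add: n_def field_simps)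
    finally show "dist (ga e (ta j)) (ga e' (ta j')) \<le> 8 * pi / real n0" .
  qed
  define B where "B v = {W e j | e j. e \<in> A \<and> j \<le> M \<and> ta j \<in> third e v}" for v
  \<comment> \<open>The walk of \<open>e\<close> belongs to its tail until it first touches the core
    \<open>B (snd e)\<close> of its head. Cutting at the first contact makes the two branch sets
    adjacent.\<close>
  define k where "k e = (LEAST j. W e j \<in> B (snd e))" for e
  have BI: "W e j \<in> B v" if "e \<in> A" "j \<le> M" "ta j \<in> third e v" for e j v
    unfolding B_def using that by blast
  have BM: "W e M \<in> B (snd e)" if "e \<in> A" for e
    using that taM by (intro BI) (auto simp: third_def)
  have kB: "W e (k e) \<in> B (snd e)" and kM: "k e \<le> M" if "e \<in> A" for e
    unfolding k_def using LeastI[of "\<lambda>j. W e j \<in> B (snd e)", OF BM[OF that]]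
      Least_le[of "\<lambda>j. W e j \<in> B (snd e)", OF BM[OF that]] by auto
  have kmin: "W e j \<notin> B (snd e)" if "j < k e" for e j using not_less_Least that unfolding k_def by blast
  have ends: "fst e \<noteq> snd e" if "e \<in> A" for e using that by (auto simp: A_def)
  have third_of: "\<exists>x. ta j \<in> third e x \<and> ta j' \<in> third e' x"
    if "e \<in> A" "e' \<in> A" "j \<le> M" "j' \<le> M" "W e j = W e' j'" "e \<noteq> e'" for e e' j j'
    using sep[OF that(1-5)] that(6) by (auto simp: prox_def)
  \<comment> \<open>The first third of a walk stays clear of the core of the head, so the cut comes
    after it and the core of the tail is not lost.\<close>
  have F1: "W e j \<notin> B (snd e)" if e: "e \<in> A" and j: "j \<le> M" "ta j < 1/3" for e j
  proof
    assume "W e j \<in> B (snd e)"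
    then obtain e' j' where e': "W e j = W e' j'" "e' \<in> A" "j' \<le> M" "ta j' \<in> third e' (snd e)"
      unfolding B_def by blast
    show False
    proof (cases "e = e'")
      case True
      then have "\<bar>ta j - ta j'\<bar> < 1/6" using sep[OF e e'(2) j(1) e'(3,1)] by (simp add: prox_def)
      moreover have "ta j' > 2/3" using e'(4) True ends[OF e] by (auto simp: third_def)
      ultimately show False using j(2) by linarith
    next
      case False
      from third_of[OF e e'(2) j(1) e'(3,1) False] obtain x where x: "ta j \<in> third e x" "ta j' \<in> third e' x" by blast
      have "x = snd e" using third_unique[OF x(2) e'(4)] .
      moreover have "x = fst e" using x(1) j(2) by (auto simp: third_def split: if_splits)
      ultimately show False using ends[OF e] by simp
    qed
  qed
  define S where "S u = {W e j | e j. e \<in> A \<and> fst e = u \<and> j < k e} \<union>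
      {W e j | e j. e \<in> A \<and> snd e = u \<and> j \<le> M \<and> 2/3 < ta j}" for u
  have BS: "B v \<subseteq> S v" for v
  proof
    fix p assume "p \<in> B v"
    then obtain e j where e: "p = W e j" "e \<in> A" "j \<le> M" "ta j \<in> third e v" unfolding B_def by blast
    show "p \<in> S v"
    proof (cases "v = fst e \<and> ta j < 1/3")
      case True
      have "j < k e"
      proof (rule ccontr)
        assume "\<not> j < k e"
        then have "ta (k e) < 1/3" using tamono[of "k e" j] True by linarith
        then show False using F1[OF e(2) kM[OF e(2)]] kB[OF e(2)] by blast
      qed
      then show ?thesis using e True unfolding S_def by blast
    next
      case False
      then have "v = snd e" "2/3 < ta j" using e(4) by (auto simp: third_def split: if_splits)
      then show ?thesis using e unfolding S_def by blast
    qed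
  qed
  have Bsuf: "W e j \<in> B (snd e)" if "e \<in> A" "j \<le> M" "2/3 < ta j" for e j
    using that by (intro BI) (auto simp: third_def)
  \<comment> \<open>A cell before the cut that lies in the core of a vertex other than the tail
    would lie in the core of the head, against the minimality of \<open>k e\<close>.\<close>
  have disj1: False
    if e: "e \<in> A" "j < k e" and p: "W e j \<in> B v" and v: "fst e \<noteq> v" for e j v
  proof -
    obtain e' j' where e': "W e j = W e' j'" "e' \<in> A" "j' \<le> M" "ta j' \<in> third e' v"
      using p unfolding B_def by blast
    have jM: "j \<le> M" using e kM[OF e(1)] by simp
    show False
    proof (cases "e = e'")
      case True
      then have "v = snd e" using e'(4) v by (auto simp: third_def split: if_splits)
      then show False using kmin[OF e(2)] p by simp
    next
      case False
      from third_of[OF e(1) e'(2) jM e'(3,1) False] obtain x where x: "ta j \<in> third e x" "ta j' \<in> third e' x" by blast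
      have "x = v" using third_unique[OF x(2) e'(4)] .
      then have "v = snd e" using x(1) v by (auto simp: third_def split: if_splits)
      then show False using kmin[OF e(2)] p by simp
    qed
  qed
  \<comment> \<open>Two edges share a cell only near a common end \<open>x\<close>; the cell is then
    in the core of \<open>x\<close>, and \<open>x\<close> is not the tail of both.\<close>
  have disj2: False
    if e: "e \<in> A" "j < k e" and e': "e' \<in> A" "j' < k e'" and eq: "W e j = W e' j'" and v: "fst e \<noteq> fst e'"
    for e j e' j'
  proof -
    have jM: "j \<le> M" "j' \<le> M" using e e' kM[OF e(1)] kM[OF e'(1)] by auto
    have "e \<noteq> e'" using v by auto
    from third_of[OF e(1) e'(1) jM eq this] obtain x where x: "ta j \<in> third e x" "ta j' \<in> third e' x" by blast
    have "W e j \<in> B x" unfolding B_def using e jM x by blast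
    moreover have "W e' j' \<in> B x" unfolding B_def using e' jM x by blast
    ultimately show False using disj1[OF e, of x] disj1[OF e', of x] v by metis
  qed
  have disj: "S u \<inter> S v = {}" if uv: "u \<noteq> v" for u v
  proof (rule ccontr)
    assume "S u \<inter> S v \<noteq> {}"
    then obtain p where p: "p \<in> S u" "p \<in> S v" by blast
    have c: "(\<exists>e j. e \<in> A \<and> fst e = u \<and> j < k e \<and> p = W e j) \<or> p \<in> B u" if "p \<in> S u" for u
      using that Bsuf unfolding S_def by blast
    have bb: False if "p \<in> B u" "p \<in> B v"
    proof -
      obtain e j e' j' where e: "p = W e j" "e \<in> A" "j \<le> M" "ta j \<in> third e u"
        and e': "p = W e' j'" "e' \<in> A" "j' \<le> M" "ta j' \<in> third e' v"
        using \<open>p \<in> B u\<close> \<open>p \<in> B v\<close> unfolding B_def by blast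
      show False
      proof (cases "e = e'")
        case True
        then have "\<bar>ta j - ta j'\<bar> < 1/6" using sep[OF e(2) e'(2) e(3) e'(3)] e e' by (simp add: prox_def)
        then show False using e(4) e'(4) uv True by (auto simp: third_def split: if_splits)
      next
        case False
        from third_of[OF e(2) e'(2) e(3) e'(3) _ False] e(1) e'(1)
        obtain x where x: "ta j \<in> third e x" "ta j' \<in> third e' x" by auto
        then show False using third_unique[OF x(1) e(4)] third_unique[OF x(2) e'(4)] uv by simp
      qed
    qed
    from c[OF p(1)] c[OF p(2)] show False
      using disj1 disj2 bb uv by metis
  qed
  have start: "W e 0 = cell2 n (ph (fst e))" and finish: "W e M = cell2 n (ph (snd e))" if "e \<in> A" for e
    using garc(4,5)[OF that] K by (auto simp: W_def M_def staircase_def)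
  have conn: "(p, q) \<in> eqc {(p, q). p \<in> S u \<and> q \<in> S u \<and> grid_adj n p q}"
    if pq: "p \<in> S u" "q \<in> S u" for u p q
  proof -
    let ?R = "{(p, q). p \<in> S u \<and> q \<in> S u \<and> grid_adj n p q}"
    have st: "(W e j, W e (Suc j)) \<in> eqc ?R"
      if "e \<in> A" "j < M" "W e j \<in> S u" "W e (Suc j) \<in> S u" for e j
      using step[OF that(1,2)] that by (auto intro: eqc_base)
    \<comment> \<open>Every cell is joined to the cell of the point of \<open>u\<close>: an initial
      segment through its beginning, a final segment through its end.\<close>
    have "(cell2 n (ph u), p) \<in> eqc ?R" if p: "p \<in> S u" for p
    proof -
      consider e j where "p = W e j" "e \<in> A" "fst e = u" "j < k e"
        | e j where "p = W e j" "e \<in> A" "snd e = u" "j \<le> M" "2/3 < ta j"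
        using p unfolding S_def by blast
      then show ?thesis
      proof cases
        case (1 e j)
        have inS: "W e i \<in> S u" if "i \<le> j" for i unfolding S_def using 1 that by fastforce
        have "i \<le> j \<Longrightarrow> (W e 0, W e i) \<in> eqc ?R" for i
        proof (induction i)
          case (Suc i)
          have "i < M" using Suc.prems 1(4) kM[OF 1(2)] by linarith
          then show ?case using Suc st[OF 1(2) _ inS[of i] inS[of "Suc i"]] eqc_trans[of "W e 0" "W e i"] by simp
        qed simp
        from this[of j] show ?thesis using start[OF 1(2)] 1 by simp
      next
        case (2 e j)
        have inS: "W e i \<in> S u" if "j \<le> i" "i \<le> M" for i
        proof -
          have "2/3 < ta i" using tamono[OF that(1)] 2(5) by linarith
          then show ?thesis unfolding S_def using 2 that by blast
        qed
        have "j + d \<le> M \<Longrightarrow> (W e j, W e (j + d)) \<in> eqc ?R" for d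
        proof (induction d)
          case (Suc d)
          then have "(W e (j + d), W e (Suc (j + d))) \<in> eqc ?R"
            by (intro st[OF 2(2)] inS) auto
          then show ?case using Suc eqc_trans[of "W e j" "W e (j + d)"] by simp
        qed simp
        from this[of "M - j"] show ?thesis using finish[OF 2(2)] 2 eqc_sym by fastforce
      qed
    qed
    from eqc_trans[OF eqc_sym[OF this[OF pq(1)]] this[OF pq(2)]] show ?thesis .
  qed
  show ?thesis
  proof (rule grid_rotation_exists[OF n, where S = S and V = "pverts G" and A = A])
    show "S u \<subseteq> {0..<n} \<times> {0..<n}" for u
      using cell_range[OF n] by (auto simp: S_def W_def cell2_def)
    show "A \<subseteq> pverts G \<times> pverts G" using AE EV by auto
    show "A \<inter> A\<inverse> = {}" using Aanti by auto
    show "A \<noteq> {}" using ne EA by (auto simp: E_def)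
    show "E = A \<union> A\<inverse>" by (rule EA)
    fix u v assume uv: "(u, v) \<in> A"
    let ?e = "(u, v)"
    \<comment> \<open>Parameter 0 lies in the first third, so some cell precedes the cut. It differs
      from the next cell because the branch sets are disjoint, so the two are grid
      neighbours.\<close>
    have k0: "k ?e \<noteq> 0"
    proof
      assume "k ?e = 0"
      then have "W ?e 0 \<in> B v" using kB[OF uv] by simp
      then show False using F1[OF uv, of 0] ta0 by simp
    qed
    have "W ?e (k ?e - 1) \<in> S u" unfolding S_def using uv k0 by fastforce
    moreover have "W ?e (k ?e) \<in> S v" using kB[OF uv] BS by auto
    moreover have "S u \<inter> S v = {}" using disj ends[OF uv] by simp
    moreover have "W ?e (k ?e) = W ?e (k ?e - 1) \<or> grid_adj n (W ?e (k ?e - 1)) (W ?e (k ?e))"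
      using step[OF uv, of "k ?e - 1"] k0 kM[OF uv] by simp
    ultimately show "\<exists>p\<in>S u. \<exists>q\<in>S v. grid_adj n p q" by (metis disjoint_iff)
  qed (use disj conn in auto)
qed

section \<open>Short faces\<close>

text \<open>\<open>px\<close> is a parameter of its own so that reversing the orientation is a mere
  exchange of parameters. In \<open>no_K5_minus\<close> the pair \<open>a\<close>, \<open>b\<close>
  is the missing edge; whether it is present is left open, as copies need not be induced.\<close>

locale rotation =
  fixes E :: "('a \<times> 'a) set" and nx px :: "'a \<Rightarrow> 'a \<Rightarrow> 'a"
  assumes finE: "finite E"
    and Esym: "(u, v) \<in> E \<Longrightarrow> (v, u) \<in> E"
    and Eirr: "(u, u) \<notin> E"
    and nxE: "(u, v) \<in> E \<Longrightarrow> (u, nx u v) \<in> E"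
    and pxE: "(u, v) \<in> E \<Longrightarrow> (u, px u v) \<in> E"
    and px_nx: "(u, v) \<in> E \<Longrightarrow> px u (nx u v) = v"
    and nx_px: "(u, v) \<in> E \<Longrightarrow> nx u (px u v) = v"
    and cyc: "(u, v) \<in> E \<Longrightarrow> (u, w) \<in> E \<Longrightarrow> \<exists>k. (nx u ^^ k) v = w"
    and deg_ge_4: "(u, v) \<in> E \<Longrightarrow> 4 \<le> card {w. (u, w) \<in> E}"
    and no_hexagon: "\<lbrakk>(a, b) \<in> E; (b, c) \<in> E; (c, d) \<in> E; (d, e) \<in> E; (e, f) \<in> E; (f, a) \<in> E;
        distinct [a, b, c, d, e, f]\<rbrakk> \<Longrightarrow> False"
    and no_K5_minus: "\<lbrakk>distinct [a, b, c, d, e]; (a, c) \<in> E; (a, d) \<in> E; (a, e) \<in> E; (b, c) \<in> E;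
        (b, d) \<in> E; (b, e) \<in> E; (c, d) \<in> E; (c, e) \<in> E; (d, e) \<in> E\<rbrakk> \<Longrightarrow> False"
begin

abbreviation adj :: "'a \<Rightarrow> 'a \<Rightarrow> bool" where
  "adj u v \<equiv> (u, v) \<in> E"

lemma adj_neq: "adj u v \<Longrightarrow> u \<noteq> v"
  using Eirr by auto

lemma nx_inj: "adj u v \<Longrightarrow> adj u w \<Longrightarrow> nx u v = nx u w \<Longrightarrow> v = w"
  using px_nx by metis

lemma fin_nbrs: "finite {w. adj u w}"
  by (rule finite_subset[OF _ finite_imageI[OF finE, of snd]]) force

lemma nxk_E: "adj u v \<Longrightarrow> adj u ((nx u ^^ k) v)"
  by (induction k) (auto simp: nxE)

lemma nbrs_period:
  assumes v: "adj u v" and m: "0 < m" "(nx u ^^ m) v = v"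
  shows "{w. adj u w} = (\<lambda>i. (nx u ^^ i) v) ` {..<m}"
proof
  show "(\<lambda>i. (nx u ^^ i) v) ` {..<m} \<subseteq> {w. adj u w}" using nxk_E[OF v] by auto
  show "{w. adj u w} \<subseteq> (\<lambda>i. (nx u ^^ i) v) ` {..<m}"
  proof clarify
    fix w assume "adj u w"
    then obtain k where k: "(nx u ^^ k) v = w" using cyc[OF v] by blast
    have "(nx u ^^ (m * q)) v = v" for q
    proof (induction q)
      case (Suc q)
      then show ?case using m by (simp add: funpow_add)
    qed simp
    then have "(nx u ^^ (k mod m + m * (k div m))) v = (nx u ^^ (k mod m)) v"
      unfolding funpow_add by simp
    then have "w = (nx u ^^ (k mod m)) v" using k by simp
    then show "w \<in> (\<lambda>i. (nx u ^^ i) v) ` {..<m}" using m by auto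
  qed
qed

lemma period_ge_deg:
  assumes v: "adj u v" and m: "0 < m" "(nx u ^^ m) v = v"
  shows "card {w. adj u w} \<le> m"
  unfolding nbrs_period[OF assms] using card_image_le[of "{..<m}" "\<lambda>i. (nx u ^^ i) v"] by simp

lemma nxk_inj: "adj u v \<Longrightarrow> adj u w \<Longrightarrow> (nx u ^^ k) v = (nx u ^^ k) w \<Longrightarrow> v = w"
proof (induction k)
  case (Suc k)
  then show ?case using nx_inj[OF nxk_E[of u v k] nxk_E[of u w k]] by simp
qed simp

lemma nxk_distinct:
  assumes v: "adj u v" and ij: "i < j" "j < card {w. adj u w}"
  shows "(nx u ^^ i) v \<noteq> (nx u ^^ j) v"
proof
  assume "(nx u ^^ i) v = (nx u ^^ j) v"
  also have "\<dots> = (nx u ^^ i) ((nx u ^^ (j - i)) v)"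
    using ij funpow_add[of i "j - i" "nx u"] by simp
  finally have "v = (nx u ^^ (j - i)) v" by (rule nxk_inj[OF v nxk_E[OF v]])
  then show False using period_ge_deg[OF v, of "j - i"] ij by simp
qed

lemma deg_bij: 
  assumes v: "adj u v"
  shows "bij_betw (\<lambda>i. (nx u ^^ i) v) {..<card {w. adj u w}} {w. adj u w}"
    and "(nx u ^^ card {w. adj u w}) v = v"
proof -
  let ?d = "card {w. adj u w}"
  have inj: "inj_on (\<lambda>i. (nx u ^^ i) v) {..<?d}"
  proof (rule linorder_inj_onI')
    show "(nx u ^^ i) v \<noteq> (nx u ^^ j) v" if "i \<in> {..<?d}" "j \<in> {..<?d}" "i < j" for i j
      using nxk_distinct[OF v that(3)] that by simp
  qed
  have sub: "(\<lambda>i. (nx u ^^ i) v) ` {..<?d} \<subseteq> {w. adj u w}" using nxk_E[OF v] by auto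
  have "card ((\<lambda>i. (nx u ^^ i) v) ` {..<?d}) = ?d" using card_image[OF inj] by simp
  then have im: "(\<lambda>i. (nx u ^^ i) v) ` {..<?d} = {w. adj u w}"
    by (rule card_subset_eq[OF fin_nbrs sub])
  then show "bij_betw (\<lambda>i. (nx u ^^ i) v) {..<?d} {w. adj u w}" using inj by (simp add: bij_betw_def)
  have "(nx u ^^ ?d) v \<in> (\<lambda>i. (nx u ^^ i) v) ` {..<?d}" unfolding im using nxk_E[OF v] by simp
  then obtain i where i: "i < ?d" "(nx u ^^ ?d) v = (nx u ^^ i) v" by auto
  have "(nx u ^^ ?d) v = (nx u ^^ i) ((nx u ^^ (?d - i)) v)"
    using i funpow_add[of i "?d - i" "nx u"] by simp
  with i have "v = (nx u ^^ (?d - i)) v" using nxk_inj[OF v nxk_E[OF v]] by metis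
  then have "?d \<le> ?d - i" using period_ge_deg[OF v, of "?d - i"] i by simp
  then have "i = 0" using i by simp
  then show "(nx u ^^ ?d) v = v" using i by simp
qed

text \<open>Rotation cycles of length at most three are excluded by the degree. Most distinctness
  arguments below rest on this.\<close>

lemma nx_ne:
  assumes "adj u v"
  shows "nx u v \<noteq> v" "nx u (nx u v) \<noteq> v" "nx u (nx u (nx u v)) \<noteq> v"
  using nxk_distinct[OF assms, of 0 1] nxk_distinct[OF assms, of 0 2] nxk_distinct[OF assms, of 0 3]
    deg_ge_4[OF assms] by (auto simp: eval_nat_numeral)

lemma nx2: "adj u x \<Longrightarrow> nx u x = y \<Longrightarrow> nx u y = x \<Longrightarrow> False"
  using nx_ne by blast

lemma nx3: "adj u x \<Longrightarrow> nx u x = y \<Longrightarrow> nx u y = z \<Longrightarrow> nx u z = x \<Longrightarrow> False"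
  using nx_ne by blast

lemma px_cyc:
  assumes "adj u v" "adj u w" shows "\<exists>k. (px u ^^ k) v = w"
proof -
  obtain k where k: "(nx u ^^ k) w = v" using cyc[OF assms(2,1)] by blast
  have "(px u ^^ k) ((nx u ^^ k) w) = w"
  proof (induction k)
    case (Suc k)
    have "(px u ^^ Suc k) ((nx u ^^ Suc k) w) = (px u ^^ k) (px u (nx u ((nx u ^^ k) w)))"
      by (simp add: funpow_swap1)
    then show ?case using Suc px_nx[OF nxk_E[OF assms(2)]] by simp
  qed simp
  then show ?thesis using k by blast
qed

text \<open>Reversing the orientation exchanges \<open>nx\<close> and \<open>px\<close> and reads
  facial walks backwards, so each lemma on faces yields its mirror image.\<close>

lemma mirror: "rotation E px nx"
proof
  show "finite E" by (rule finE)
  show "(v, u) \<in> E" if "(u, v) \<in> E" for u v by (rule Esym[OF that])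
  show "(u, u) \<notin> E" for u by (rule Eirr)
  show "(u, px u v) \<in> E" if "(u, v) \<in> E" for u v by (rule pxE[OF that])
  show "(u, nx u v) \<in> E" if "(u, v) \<in> E" for u v by (rule nxE[OF that])
  show "nx u (px u v) = v" if "(u, v) \<in> E" for u v by (rule nx_px[OF that])
  show "px u (nx u v) = v" if "(u, v) \<in> E" for u v by (rule px_nx[OF that])
  show "\<exists>k. (px u ^^ k) v = w" if "(u, v) \<in> E" "(u, w) \<in> E" for u v w by (rule px_cyc[OF that])
  show "4 \<le> card {w. (u, w) \<in> E}" if "(u, v) \<in> E" for u v by (rule deg_ge_4[OF that])
qed (use no_hexagon no_K5_minus in \<open>blast+\<close>)

text \<open>
  \<open>TC x a y\<close>, \<open>QC x a y m\<close> and \<open>PC x a y k l\<close> say that the facial walk passing \<open>x, a, y\<close> is closed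
  of length 3, 4 and 5, respectively.
\<close>

definition TC :: "'a \<Rightarrow> 'a \<Rightarrow> 'a \<Rightarrow> bool" where
  "TC x a y \<longleftrightarrow> adj x a \<and> adj a y \<and> adj y x \<and> nx a x = y \<and> nx y a = x \<and> nx x y = a"

definition QC :: "'a \<Rightarrow> 'a \<Rightarrow> 'a \<Rightarrow> 'a \<Rightarrow> bool" where
  "QC x a y m \<longleftrightarrow> adj x a \<and> adj a y \<and> adj y m \<and> adj m x \<and>
     nx a x = y \<and> nx y a = m \<and> nx m y = x \<and> nx x m = a"

definition PC :: "'a \<Rightarrow> 'a \<Rightarrow> 'a \<Rightarrow> 'a \<Rightarrow> 'a \<Rightarrow> bool" where
  "PC x a y k l \<longleftrightarrow> adj x a \<and> adj a y \<and> adj y k \<and> adj k l \<and> adj l x \<and>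
     nx a x = y \<and> nx y a = k \<and> nx k y = l \<and> nx l k = x \<and> nx x l = a"

lemma TC_rot: "TC x a y \<Longrightarrow> TC a y x"
  and QC_rot: "QC x a y m \<Longrightarrow> QC a y m x"
  and PC_rot: "PC x a y k l \<Longrightarrow> PC a y k l x"
  by (auto simp: TC_def QC_def PC_def)

lemma TCN: "TC x a y \<Longrightarrow> nx a x = y \<and> nx y a = x \<and> nx x y = a"
  and QCN: "QC x a y m \<Longrightarrow> nx a x = y \<and> nx y a = m \<and> nx m y = x \<and> nx x m = a"
  and PCN: "PC x a y k l \<Longrightarrow> nx a x = y \<and> nx y a = k \<and> nx k y = l \<and> nx l k = x \<and> nx x l = a"
  by (auto simp: TC_def QC_def PC_def)

lemma TCD: "TC x a y \<Longrightarrow> adj x a \<and> adj a x \<and> adj a y \<and> adj y a \<and> adj x y \<and> adj y x \<and> distinct [x, a, y]"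
  unfolding TC_def using Esym adj_neq by auto

text \<open>On a closed walk of length at most five any two positions are at most two steps apart,
  and such vertices differ: there are no loops, and \<open>nx\<close> moves every neighbour. So
  short faces are genuine cycles.\<close>

lemma QCD: "QC x a y m \<Longrightarrow> adj x a \<and> adj a x \<and> adj a y \<and> adj y a \<and> adj y m \<and> adj m y \<and> adj m x \<and> adj x m \<and>
    distinct [x, a, y, m]"
  unfolding QC_def using Esym adj_neq nx_ne(1)[of a x] nx_ne(1)[of y a] by auto

lemma PCD: "PC x a y k l \<Longrightarrow> adj x a \<and> adj a x \<and> adj a y \<and> adj y a \<and> adj y k \<and> adj k y \<and>
    adj k l \<and> adj l k \<and> adj l x \<and> adj x l \<and> distinct [x, a, y, k, l]"
  unfolding PC_def using Esym adj_neq nx_ne(1)[of a x] nx_ne(1)[of y a] nx_ne(1)[of k y]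
    nx_ne(1)[of l k] nx_ne(1)[of x l] by auto

lemma px_iff: "adj a x \<Longrightarrow> adj a y \<Longrightarrow> px a y = x \<longleftrightarrow> nx a x = y"
  using px_nx nx_px by metis

lemma TC_mirror: "rotation.TC E px y a x \<longleftrightarrow> TC x a y"
  unfolding TC_def rotation.TC_def[OF mirror] using px_iff Esym by blast

lemma QC_mirror: "rotation.QC E px y a x m \<longleftrightarrow> QC x a y m"
  unfolding QC_def rotation.QC_def[OF mirror] using px_iff Esym by blast

lemma PC_mirror: "rotation.PC E px y a x l k \<longleftrightarrow> PC x a y k l"
  unfolding PC_def rotation.PC_def[OF mirror] using px_iff Esym by blast

lemma rot4_distinct:
  assumes "adj u n0" "nx u n0 = n1" "nx u n1 = n2" "nx u n2 = n3"
  shows "distinct [n0, n1, n2, n3]" "adj u n1" "adj u n2" "adj u n3"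
proof -
  show a: "adj u n1" "adj u n2" "adj u n3" using nxE assms by blast+
  show "distinct [n0, n1, n2, n3]"
    using nx_ne[OF assms(1)] nx_ne[OF a(1)] nx_ne[OF a(2)] assms by auto
qed

text \<open>If \<open>e = m\<close>, this vertex has three neighbours in the K4, giving K5 minus an
  edge. Otherwise a cycle through the K4 can make a detour to both outer vertices and becomes a
  hexagon.\<close>

lemma K4_two_attached:
  assumes "adj w x" "adj w y" "adj w z" "adj x y" "adj x z" "adj y z"
    and m: "adj m w" "adj m x" "m \<noteq> y" "m \<noteq> z"
    and e: "adj e p" "adj e q" "p \<in> {w, x, y, z}" "q \<in> {w, x, y, z}" "p \<noteq> q" "{p, q} \<noteq> {w, x}"
      "e \<notin> {w, x, y, z}"
  shows False
proof -
  have d: "w \<noteq> x" "w \<noteq> y" "w \<noteq> z" "x \<noteq> y" "x \<noteq> z" "y \<noteq> z" "m \<noteq> w" "m \<noteq> x"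
    using adj_neq assms by auto
  note sym = assms(1-8)[THEN Esym] Esym[OF m(1)] Esym[OF m(2)] Esym[OF e(1)] Esym[OF e(2)]
  have c: "p = y \<or> p = z \<or> q = y \<or> q = z" using e by auto
  have K5y: False if "adj m y" using no_K5_minus[of m z w x y] that m assms(1-6) d sym Esym by auto
  have K5z: False if "adj m z" using no_K5_minus[of m y w x z] that m assms(1-6) d sym Esym by auto
  show False
  proof (cases "e = m")
    case True
    then show False using c e K5y K5z by auto
  next
    case False
    have one: False if "adj e y" "adj e w" 
      using no_hexagon[of m x z y e w] that assms d sym False e(7) Esym by auto
    have two: False if "adj e y" "adj e x"
      using no_hexagon[of m w z y e x] that assms d sym False e(7) Esym by auto
    have three: False if "adj e z" "adj e w"
      using no_hexagon[of m x y z e w] that assms d sym False e(7) Esym by auto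
    have four: False if "adj e z" "adj e x"
      using no_hexagon[of m w y z e x] that assms d sym False e(7) Esym by auto
    have five: False if "adj e y" "adj e z"
      using no_hexagon[of m x y e z w] that assms d sym False e(7) Esym by auto
    show False using one two three four five e by auto
  qed
qed

text \<open>The outer boundary of the three faces, closed through \<open>u\<close>, is a
  hexagon.\<close>

lemma no_T4T: "TC n0 u n1 \<Longrightarrow> QC n1 u n2 m \<Longrightarrow> TC n2 u n3 \<Longrightarrow> False"
proof -
  assume a: "TC n0 u n1" "QC n1 u n2 m" "TC n2 u n3"
  note d = TCD[OF a(1)] QCD[OF a(2)] TCD[OF a(3)]
  note e = TCN[OF a(1)] QCN[OF a(2)] TCN[OF a(3)]
  have r: "distinct [n0, n1, n2, n3]" using rot4_distinct[of u n0 n1 n2 n3] d e by auto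
  have "m \<noteq> n0" using nx2[of n1 u n0] d e by auto
  moreover have "m \<noteq> n3" using nx2[of n2 u n3] d e by auto
  ultimately show False using no_hexagon[of u n0 n1 m n2 n3] d r by auto
qed

text \<open>Replacing the side \<open>a y\<close> of the pentagon by the other two sides of the
  triangle gives a hexagon, unless the apex is the vertex opposite to this side.\<close>

lemma apex5: "PC x a y k l \<Longrightarrow> TC y a c \<Longrightarrow> c = l"
proof (rule ccontr)
  assume a: "PC x a y k l" "TC y a c" "c \<noteq> l"
  note d = PCD[OF a(1)] TCD[OF a(2)]
  note e = PCN[OF a(1)] TCN[OF a(2)]
  have "c \<noteq> k" using nx2[of y a k] d e by auto
  moreover have "c \<noteq> x" using nx2[of a x y] d e by auto
  ultimately show False using no_hexagon[of a c y k l x] d a(3) by auto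
qed

lemma apex5': "PC x a y k l \<Longrightarrow> TC c a x \<Longrightarrow> c = k"
  using rotation.apex5[OF mirror, of y a x l k c] unfolding TC_mirror PC_mirror by blast

text \<open>The apices are forced to be \<open>k\<close> and \<open>l\<close>; then only the edge
  \<open>n1 n2\<close> can be missing from a K5.\<close>

lemma no_T5T: "TC n0 u n1 \<Longrightarrow> PC n1 u n2 k l \<Longrightarrow> TC n2 u n3 \<Longrightarrow> False"
proof -
  assume a: "TC n0 u n1" "PC n1 u n2 k l" "TC n2 u n3"
  note d = TCD[OF a(1)] PCD[OF a(2)] TCD[OF a(3)]
  note e = TCN[OF a(1)] PCN[OF a(2)] TCN[OF a(3)]
  have "n0 = k" using apex5'[OF a(2,1)] .
  moreover have "n3 = l" using apex5[OF a(2,3)] .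
  ultimately show False using no_K5_minus[of n1 n2 u k l] d by auto
qed

text \<open>Both apices are forced, and the two triangles would then both traverse the dart from
  \<open>a\<close> to \<open>l\<close>.\<close>

lemma tri5_nonadjacent: "PC x a y k l \<Longrightarrow> TC y a c \<Longrightarrow> TC l k c' \<Longrightarrow> False"
proof -
  assume a: "PC x a y k l" "TC y a c" "TC l k c'"
  note d = PCD[OF a(1)] TCD[OF a(2)] TCD[OF a(3)]
  note e = PCN[OF a(1)] TCN[OF a(2)] TCN[OF a(3)]
  have c: "c = l" using apex5[OF a(1,2)] .
  have "c' = a" using apex5[OF PC_rot[OF PC_rot[OF a(1)]] a(3)] .
  then show False using c d e nx_inj[of a y k] by auto
qed

text \<open>If not, the two quads bound a hexagon unless \<open>m = n3\<close>; in that case the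
  triangle supplies the edges for another hexagon or for K5 minus an edge.\<close>

lemma QQ_after_T:
  assumes a: "TC n0 a n1" "QC n1 a n2 m" "QC n2 a n3 m'" shows "m' = n1"
proof (rule ccontr)
  assume ne: "m' \<noteq> n1"
  note d = TCD[OF a(1)] QCD[OF a(2)] QCD[OF a(3)]
  note e = TCN[OF a(1)] QCN[OF a(2)] QCN[OF a(3)]
  have r: "distinct [n0, n1, n2, n3]" using rot4_distinct[of a n0 n1 n2 n3] d e by auto
  have mm: "m \<noteq> m'" using nx2[of n2 a m] d e by auto
  have m3: "m = n3" using no_hexagon[of a n1 m n2 m' n3] d r mm ne by auto
  show False
  proof (cases "m' = n0")
    case True
    then show False using no_K5_minus[of n1 n2 a n0 n3] d r m3 by auto
  next
    case False
    then show False using no_hexagon[of a n0 n1 n3 m' n2] d r m3 ne by auto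
  qed
qed

text \<open>By \<open>QQ_after_T\<close> and its mirror image the vertex opposite to
  \<open>a\<close> in the middle quad would be both \<open>n1\<close> and \<open>n0\<close>.\<close>

lemma no_T444: "TC n0 a n1 \<Longrightarrow> QC n1 a n2 m \<Longrightarrow> QC n2 a n3 m' \<Longrightarrow> QC n3 a n0 m'' \<Longrightarrow> False"
proof -
  assume a: "TC n0 a n1" "QC n1 a n2 m" "QC n2 a n3 m'" "QC n3 a n0 m''"
  have "m' = n1" by (rule QQ_after_T[OF a(1-3)])
  moreover have "m' = n0"
    using rotation.QQ_after_T[OF mirror, of n1 a n0 n3 m'' n2 m'] a unfolding TC_mirror QC_mirror by blast
  ultimately show False using TCD[OF a(1)] by auto
qed

text \<open>The faces around \<open>a\<close> are a triangle, a quad, a pentagon and a quad. The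
  apex of a triangle on the side \<open>n3 k\<close> is \<open>n2\<close>, and the chord
  \<open>n2 n3\<close> leads to a hexagon or to K5 minus an edge.\<close>

lemma bad_pentagon_side:
  assumes a: "TC n0 a n1" "QC n1 a n2 m" "PC n2 a n3 k l" "QC n3 a n0 m''" "TC k n3 c" shows False
proof -
  note d = TCD[OF a(1)] QCD[OF a(2)] PCD[OF a(3)] QCD[OF a(4)] TCD[OF a(5)]
  note e = TCN[OF a(1)] QCN[OF a(2)] PCN[OF a(3)] QCN[OF a(4)] TCN[OF a(5)]
  have r: "distinct [n0, n1, n2, n3]" using rot4_distinct[of a n0 n1 n2 n3] d e by auto
  have c: "c = n2" using apex5[OF PC_rot[OF a(3)] a(5)] .
  have m0: "m \<noteq> n0" using nx2[of n1 a n0] d e by auto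
  show False
  proof (cases "m = n3")
    case False
    then show False using no_hexagon[of a n3 n2 m n1 n0] d r c m0 by auto
  next
    case True
    show False
    proof (cases "k = n0")
      case True
      then show False using no_K5_minus[of n1 n2 a n0 n3] d r c \<open>m = n3\<close> by auto
    next
      case False
      have "k \<noteq> n1" using d e True c nx2[of n3 k n2] by auto
      then show False using no_hexagon[of a n0 n1 n3 k n2] d r c \<open>m = n3\<close> False by auto
    qed
  qed
qed

text \<open>The apex is \<open>a\<close> itself, so \<open>k\<close> and \<open>l\<close> are among
  the four neighbours of \<open>a\<close> and must be \<open>n0\<close> and \<open>n1\<close> in one
  order or the other.\<close>

lemma bad_pentagon_opposite:
  assumes a: "TC n0 a n1" "QC n1 a n2 m" "PC n2 a n3 k l" "QC n3 a n0 m''" "TC l k c"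
    and N: "\<And>z. adj a z \<Longrightarrow> z \<in> {n0, n1, n2, n3}"
  shows False
proof -
  note d = TCD[OF a(1)] QCD[OF a(2)] PCD[OF a(3)] QCD[OF a(4)] TCD[OF a(5)]
  note e = TCN[OF a(1)] QCN[OF a(2)] PCN[OF a(3)] QCN[OF a(4)] TCN[OF a(5)]
  have r: "distinct [n0, n1, n2, n3]" using rot4_distinct[of a n0 n1 n2 n3] d e by auto
  have c: "c = a" using apex5[OF PC_rot[OF PC_rot[OF a(3)]] a(5)] .
  have m0: "m \<noteq> n0" using nx2[of n1 a n0] d e by auto
  have m1: "m'' \<noteq> n1" using nx2[of n0 n1 a] d e by auto
  have "k \<in> {n0, n1}" "l \<in> {n0, n1}" using N[of k] N[of l] c d by auto
  then consider "k = n1" "l = n0" | "k = n0" "l = n1" using d by auto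
  then show False
  proof cases
    case 1
    have "m \<noteq> n3" using d e 1 by auto
    then show False using no_hexagon[of a n3 n1 m n2 n0] d r m0 1 by auto
  next
    case 2
    show False
    proof (cases "m'' = n2")
      case True
      then show False using no_K5_minus[of n1 n3 a n0 n2] d r 2 by auto
    next
      case False
      then show False using no_hexagon[of a n3 m'' n0 n1 n2] d r m1 2 by auto
    qed
  qed
qed

text \<open>Both \<open>a\<close> and \<open>n3\<close> see a triangle between two quads opposite to
  the same pentagon. Excluding hexagons one after the other identifies \<open>j\<close> with
  \<open>n1\<close>, \<open>m\<close> with \<open>m''\<close> and \<open>m3\<close> with
  \<open>n0\<close>, after which a last hexagon is there.\<close>

lemma bad_adjacent:
  assumes a: "TC n0 a n1" "QC n1 a n2 m" "PC n2 a n3 k l" "QC n3 a n0 m''"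
    and b: "TC j n3 m''" "QC k n3 j m3"
    and N: "\<And>z. adj a z \<Longrightarrow> z \<in> {n0, n1, n2, n3}" and N3: "\<And>z. adj n3 z \<Longrightarrow> z \<in> {m'', a, k, j}"
  shows False
proof -
  note d = TCD[OF a(1)] QCD[OF a(2)] PCD[OF a(3)] QCD[OF a(4)] TCD[OF b(1)] QCD[OF b(2)]
  note e = TCN[OF a(1)] QCN[OF a(2)] PCN[OF a(3)] QCN[OF a(4)] TCN[OF b(1)] QCN[OF b(2)]
  have r: "distinct [n0, n1, n2, n3]" using rot4_distinct[of a n0 n1 n2 n3] d e by auto
  have r3: "distinct [m'', a, k, j]" using rot4_distinct[of n3 m'' a k j] d e by auto
  have j0: "j \<noteq> n0" using nx2[of m'' n0 n3] d e by auto
  have m1: "m'' \<noteq> n1" using nx2[of n0 n1 a] d e by auto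
  have m0: "m \<noteq> n0" using nx2[of n1 a n0] d e by auto
  have j: "j = n1" using no_hexagon[of a n1 n0 m'' j n3] d r r3 j0 m1 by auto
  have m2: "m'' \<noteq> n2" using no_K5_minus[of n0 n3 a n1 n2] d r j by auto
  have k0: "k \<noteq> n0" using no_K5_minus[of a m'' n3 n0 n1] d r3 j by auto
  have m: "m = m''"
  proof (rule ccontr)
    assume ne: "m \<noteq> m''"
    have "m \<noteq> n3" using N3[of n2] d m2 j by auto
    then show False using no_hexagon[of n1 m n2 a n3 m''] d r j ne m1 m2 by auto
  qed
  have m3: "m3 = n0"
  proof (rule ccontr)
    assume ne: "m3 \<noteq> n0"
    have "m3 \<noteq> a" using N[of k] d r3 j k0 by auto
    then show False using no_hexagon[of n1 m3 k n3 a n0] d r r3 j ne k0 by auto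
  qed
  then show False using no_hexagon[of a n2 m'' n3 k n0] d r r3 m j k0 by auto
qed


text \<open>The three apices alternate with the corners in a hexagon; equal apices would close a
  rotation after three steps.\<close>

lemma no_three_neighbours: "TC a b c \<Longrightarrow> TC b a x \<Longrightarrow> TC c b y \<Longrightarrow> TC a c z \<Longrightarrow> False"
proof -
  assume a: "TC a b c" "TC b a x" "TC c b y" "TC a c z"
  note d = TCD[OF a(1)] TCD[OF a(2)] TCD[OF a(3)] TCD[OF a(4)]
  note e = TCN[OF a(1)] TCN[OF a(2)] TCN[OF a(3)] TCN[OF a(4)]
  have 1: "x \<noteq> c" using nx2[of a b c] d e by auto
  have 2: "y \<noteq> a" using nx2[of b c a] d e by auto
  have 3: "z \<noteq> b" using nx2[of c a b] d e by auto
  have 4: "x \<noteq> y" using nx3[of b a c y] d e by auto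
  have 5: "y \<noteq> z" using nx3[of c b a z] d e by auto
  have 6: "x \<noteq> z" using nx3[of a c b x] d e by auto
  show False using no_hexagon[of a x b y c z] d 1 2 3 4 5 6 by auto
qed

text \<open>Otherwise \<open>y n0 n1 n2 m n3\<close> is a hexagon. Hence a quad next to two
  triangles completes their kite to a K4, on which the following lemmas build.\<close>

lemma kite_quad:
  assumes a: "TC n0 y n1" "TC n1 y n2" "QC n2 y n3 m" shows "m = n0"
proof (rule ccontr)
  assume ne: "m \<noteq> n0"
  note d = TCD[OF a(1)] TCD[OF a(2)] QCD[OF a(3)]
  note e = TCN[OF a(1)] TCN[OF a(2)] QCN[OF a(3)]
  have r: "distinct [n0, n1, n2, n3]" using rot4_distinct[of y n0 n1 n2 n3] d e by auto
  have "m \<noteq> n1" using nx2[of n2 y n1] d e by auto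
  then show False using no_hexagon[of y n0 n1 n2 m n3] d r ne by auto
qed

lemma kite_quad_facts:
  assumes a: "TC n0 y n1" "TC n1 y n2" "QC n2 y n3 m"
  shows "adj n3 n0" "adj n2 n0" "adj n3 y" "distinct [y, n0, n1, n2, n3]"
proof -
  have m: "m = n0" by (rule kite_quad[OF a])
  note d = TCD[OF a(1)] TCD[OF a(2)] QCD[OF a(3)]
  note e = TCN[OF a(1)] TCN[OF a(2)] QCN[OF a(3)]
  show "distinct [y, n0, n1, n2, n3]" using rot4_distinct[of y n0 n1 n2 n3] d e by auto
  show "adj n3 n0" "adj n2 n0" "adj n3 y" using d m by auto
qed

text \<open>A quad or pentagon on the other flank would give \<open>n3\<close> a third neighbour in
  the K4.\<close>

lemma kite_quad_other_flank:
  assumes a: "TC n0 y n1" "TC n1 y n2" "QC n2 y n3 m"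
  shows "QC n3 y n0 m' \<Longrightarrow> False" "PC n3 y n0 k l \<Longrightarrow> False"
proof -
  note d = TCD[OF a(1)] TCD[OF a(2)] QCD[OF a(3)]
  note f = kite_quad_facts[OF a]
  have K5: False if "adj n3 n1 \<or> adj n3 n2"
  proof (cases "adj n3 n1")
    case True
    then show False using no_K5_minus[of n2 n3 y n0 n1] d f Esym by auto
  next
    case False
    then show False using that no_K5_minus[of n1 n3 y n0 n2] d f Esym by auto
  qed
  show False if q: "QC n3 y n0 m'"
  proof -
    have "m' = n2" using rotation.kite_quad[OF mirror, of n2 y n1 n0 n3 m'] a q
      unfolding TC_mirror QC_mirror by blast
    then show False using QCD[OF q] K5 by auto
  qed
  show False if p: "PC n3 y n0 k l"
  proof -
    have "n1 = l" using apex5[OF p] TC_rot[OF TC_rot[OF a(1)]] TC_rot[OF a(1)] a(1) by blast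
    then show False using PCD[OF p] K5 by auto
  qed
qed

text \<open>The vertex \<open>n3\<close> is attached to the K4 at \<open>y\<close> and
  \<open>n0\<close>, and \<open>c\<close> at another pair, one member of which is
  \<open>n1\<close>.\<close>

lemma kite_quad_opposite:
  assumes a: "TC n0 y n1" "TC n1 y n2" "QC n2 y n3 m" and c: "adj c n1" "c \<notin> {y, n0, n2}"
  shows "adj c y \<or> adj c n0 \<or> adj c n2 \<Longrightarrow> False"
proof -
  assume or: "adj c y \<or> adj c n0 \<or> adj c n2"
  note d = TCD[OF a(1)] TCD[OF a(2)] QCD[OF a(3)]
  note f = kite_quad_facts[OF a]
  have cn: "c \<notin> {y, n0, n1, n2}" using c adj_neq by auto
  have K: "adj y n0" "adj y n1" "adj y n2" "adj n0 n1" "adj n0 n2" "adj n1 n2" using d f Esym by auto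
  show False
    using K4_two_attached[OF K, of n3 c n1 y] K4_two_attached[OF K, of n3 c n1 n0]
      K4_two_attached[OF K, of n3 c n1 n2] or c(1) cn f d by (auto simp: doubleton_eq_iff)
qed

text \<open>Any short face beside the kite at its other end \<open>n1\<close> brings in a vertex
  with a second neighbour in the K4. Thus a quad flank at \<open>y\<close> forbids one at
  \<open>n1\<close>.\<close>

lemma kite_quad_far:
  assumes a: "TC n0 y n1" "TC n1 y n2" "QC n2 y n3 m"
  shows "TC n0 n1 c \<Longrightarrow> False" "QC n0 n1 c m' \<Longrightarrow> False" "PC n0 n1 c k l \<Longrightarrow> False"
    "TC c n1 n2 \<Longrightarrow> False" "QC c n1 n2 m' \<Longrightarrow> False" "PC c n1 n2 k l \<Longrightarrow> False"
proof -
  note d = TCD[OF a(1)] TCD[OF a(2)] QCD[OF a(3)]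
  note e = TCN[OF a(1)] TCN[OF a(2)] QCN[OF a(3)]
  have z: "nx n1 n2 = y" "nx n1 y = n0" using e by auto
  have t: "TC n2 n1 y" "TC y n1 n0" using TC_rot[OF a(1)] TC_rot[OF TC_rot[OF a(2)]] TC_rot[OF TC_rot[OF a(1)]] TC_rot[OF a(2)]
    by blast+
  have R: False if "adj n1 n0" "nx n1 n0 = c" "adj c y \<or> adj c n0 \<or> adj c n2" for c
  proof -
    have r: "distinct [n2, y, n0, c]" "adj n1 c" using rot4_distinct[of n1 n2 y n0 c] z that d by auto
    show False using kite_quad_opposite[OF a, of c] r Esym that by auto
  qed
  have L: False if "adj n1 c" "nx n1 c = n2" "adj c y \<or> adj c n0 \<or> adj c n2" for c
  proof -
    have r: "distinct [c, n2, y, n0]" using rot4_distinct[of n1 c n2 y n0] z that d by auto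
    show False using kite_quad_opposite[OF a, of c] r Esym that by auto
  qed
  show False if "TC n0 n1 c" using R[of c] TCD[OF that] TCN[OF that] by auto
  show False if q: "QC n0 n1 c m'"
  proof -
    have "m' = n2" using kite_quad[OF t q] .
    then show False using R[of c] QCD[OF q] QCN[OF q] by auto
  qed
  show False if p: "PC n0 n1 c k l"
  proof -
    have "TC y n1 n0" by (rule t)
    then have "y = k" using apex5'[OF p] by blast
    then show False using R[of c] PCD[OF p] PCN[OF p] by auto
  qed
  show False if "TC c n1 n2" using L[of c] TCD[OF that] TCN[OF that] by auto
  show False if q: "QC c n1 n2 m'"
  proof -
    have "m' = n0" using rotation.kite_quad[OF mirror, of n0 n1 y n2 c m'] t q
      unfolding TC_mirror QC_mirror by blast
    then show False using L[of c] QCD[OF q] QCN[OF q] by auto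
  qed
  show False if p: "PC c n1 n2 k l"
  proof -
    have "y = l" using apex5[OF p t(1)] .
    then show False using L[of c] PCD[OF p] PCN[OF p] by auto
  qed
qed

lemma fan_distinct:
  assumes a: "TC n0 v n1" "TC n1 v n2" "TC n2 v n3" shows "distinct [v, n0, n1, n2, n3]"
  using rot4_distinct[of v n0 n1 n2 n3] TCD[OF a(1)] TCD[OF a(2)] TCD[OF a(3)] TCN[OF a(1)] TCN[OF a(2)] TCN[OF a(3)]
  by auto

lemma fan_chords:
  assumes a: "TC n0 v n1" "TC n1 v n2" "TC n2 v n3" and "adj n0 n2" "adj n1 n3" shows False
  using no_K5_minus[of n0 n3 v n1 n2] TCD[OF a(1)] TCD[OF a(2)] TCD[OF a(3)] assms(4,5) fan_distinct[OF a] Esym by auto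

text \<open>A triangle across \<open>n0 n1\<close> enlarges the fan to a hexagon or gives K5 minus
  an edge. A quad turns \<open>v n0 n1 n2\<close> into a K4 with too much attached to it. A pentagon
  must have \<open>v\<close> as the vertex opposite to this edge, and again there is a
  hexagon.\<close>

lemma fan_rim_end:
  assumes a: "TC n0 v n1" "TC n1 v n2" "TC n2 v n3"
  shows "TC n0 n1 m \<Longrightarrow> False" "QC n0 n1 m m' \<Longrightarrow> False" "PC n0 n1 k l j \<Longrightarrow> False"
proof -
  note d = TCD[OF a(1)] TCD[OF a(2)] TCD[OF a(3)]
  note e = TCN[OF a(1)] TCN[OF a(2)] TCN[OF a(3)]
  note r = fan_distinct[OF a]
  have nn2: "nx n1 n0 \<noteq> n2" "nx n1 n0 \<noteq> v" using nx3[of n1 n0 n2 v] nx2[of n1 n0 v] d e by auto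
  show False if t: "TC n0 n1 m"
  proof -
    note d' = TCD[OF t] and e' = TCN[OF t]
    have "m \<noteq> v" "m \<noteq> n2" using nn2 e' by auto
    moreover have "m \<noteq> n3"
    proof
      assume m: "m = n3"
      then show False using no_K5_minus[of n0 n2 v n1 n3] d d' r by auto
    qed
    ultimately show False using no_hexagon[of v n0 m n1 n2 n3] d d' r by auto
  qed
  show False if q: "QC n0 n1 m m'"
  proof -
    note d' = QCD[OF q] and e' = QCN[OF q]
    have mv: "m \<noteq> v" "m \<noteq> n2" using nn2 e' by auto
    have m'v: "m' \<noteq> v" using nx2[of n0 n1 v] e e' d by auto
    have m': "m' = n2" using no_hexagon[of n0 m' m n1 n2 v] d d' r mv m'v by auto
    have K: "adj v n0" "adj v n1" "adj v n2" "adj n0 n1" "adj n0 n2" "adj n1 n2" using d d' m' by auto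
    show False
    proof (cases "m = n3")
      case True
      then show False using fan_chords[OF a] K d' Esym by auto
    next
      case False
      have K': "adj n1 n2" "adj n1 v" "adj n1 n0" "adj n2 v" "adj n2 n0" "adj v n0" using K Esym by auto
      show False using K4_two_attached[OF K', of m n3 v n2] d d' m' mv r by (auto simp: doubleton_eq_iff)
    qed
  qed
  show False if p: "PC n0 n1 k l j"
  proof -
    note d' = PCD[OF p] and e' = PCN[OF p]
    have l: "l = v"
    proof -
      have "TC n1 n0 v" using TC_rot[OF TC_rot[OF a(1)]] TC_rot[OF a(1)] by blast
      then have "TC v n1 n0" using TC_rot[OF \<open>TC n1 n0 v\<close>] TC_rot[OF TC_rot[OF \<open>TC n1 n0 v\<close>]] by blast
      then show ?thesis using apex5'[OF p] by blast
    qed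
    have k: "k \<noteq> n2" using nn2 e' by auto
    have "j \<noteq> n2" using e e' l nx_inj[of v k n1] d d' by auto
    moreover have "j \<noteq> n3" using e e' l nx_inj[of v k n2] d d' k by auto
    ultimately show False using no_hexagon[of v j n0 n1 n2 n3] d d' r l by auto
  qed
qed

lemma fan_rim_end':
  assumes a: "TC n0 v n1" "TC n1 v n2" "TC n2 v n3"
  shows "TC m n2 n3 \<Longrightarrow> False" "QC m n2 n3 m' \<Longrightarrow> False" "PC k n2 n3 j l \<Longrightarrow> False"
proof -
  have b: "rotation.TC E px n3 v n2" "rotation.TC E px n2 v n1" "rotation.TC E px n1 v n0"
    using a by (auto simp: TC_mirror)
  note c = rotation.fan_rim_end[OF mirror b, unfolded TC_mirror QC_mirror PC_mirror]
  show "TC m n2 n3 \<Longrightarrow> False" "QC m n2 n3 m' \<Longrightarrow> False" "PC k n2 n3 j l \<Longrightarrow> False"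
    using c by blast+
qed

text \<open>A pentagon may occur across the middle edge; bordering a triangle of the fan, it will
  pay through \<open>tri5\<close>.\<close>

lemma fan_rim_middle:
  assumes a: "TC n0 v n1" "TC n1 v n2" "TC n2 v n3"
  shows "TC n1 n2 m \<Longrightarrow> False" "QC n1 n2 m m' \<Longrightarrow> False"
proof -
  note d = TCD[OF a(1)] TCD[OF a(2)] TCD[OF a(3)]
  note e = TCN[OF a(1)] TCN[OF a(2)] TCN[OF a(3)]
  note r = fan_distinct[OF a]
  have nn: "nx n2 n1 \<noteq> n3" "nx n2 n1 \<noteq> v" using nx3[of n2 n1 n3 v] nx2[of n2 n1 v] d e by auto
  show False if t: "TC n1 n2 m"
  proof -
    note d' = TCD[OF t] and e' = TCN[OF t]
    have "m \<noteq> v" "m \<noteq> n3" using nn e' by auto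
    moreover have "m \<noteq> n0" using nx3[of n1 m n2 v] d d' e e' by auto
    ultimately show False using no_hexagon[of v n0 n1 m n2 n3] d d' r by auto
  qed
  show False if q: "QC n1 n2 m m'"
  proof -
    note d' = QCD[OF q] and e' = QCN[OF q]
    have m: "m \<noteq> v" "m \<noteq> n3" using nn e' by auto
    have m': "m' \<noteq> v" using nx2[of n1 n2 v] e e' d by auto
    have m'0: "m' \<noteq> n0" using nx3[of n1 n0 n2 v] nx3[of n1 n2 v n0] e e' d by auto
    have "m = n0" using no_hexagon[of v n0 n1 m' m n2] d d' r m m' m'0 by auto
    moreover have "m' = n3" using no_hexagon[of v n3 n2 m m' n1] d d' r m m' by auto
    ultimately show False using fan_chords[OF a] d' Esym by auto
  qed
qed

text \<open>Five rim vertices and \<open>v\<close> would form a hexagon. So four consecutive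
  triangles are a closed wheel.\<close>

lemma four_triangles_close:
  assumes a: "TC n0 v n1" "TC n1 v n2" "TC n2 v n3" "TC n3 v n4" shows "n4 = n0"
proof (rule ccontr)
  assume ne: "n4 \<noteq> n0"
  have "distinct [v, n0, n1, n2, n3]" "distinct [v, n1, n2, n3, n4]"
    using fan_distinct a by blast+
  then show False using no_hexagon[of v n0 n1 n2 n3 n4] ne
      TCD[OF a(1)] TCD[OF a(2)] TCD[OF a(3)] TCD[OF a(4)] by auto
qed

lemma wheel_no_chord:
  assumes a: "TC n0 v n1" "TC n1 v n2" "TC n2 v n3" "TC n3 v n0" shows "\<not> adj n0 n2"
  using no_K5_minus[of n1 n3 v n0 n2] fan_distinct[OF a(1-3)]
    TCD[OF a(1)] TCD[OF a(2)] TCD[OF a(3)] TCD[OF a(4)] by auto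

text \<open>A second common neighbour could be inserted into the rim edge, giving a hexagon through
  the hub. This will exclude bowties outside a wheel.\<close>

lemma wheel_common_nbr:
  assumes a: "TC n0 v n1" "TC n1 v n2" "TC n2 v n3" "TC n3 v n0" and m: "adj m n0" "adj m n1"
  shows "m = v"
proof (rule ccontr)
  assume mv: "m \<noteq> v"
  have "m \<noteq> n2" using wheel_no_chord[OF a] m Esym by auto
  moreover have "m \<noteq> n3" using wheel_no_chord[OF a(2-4,1)] m Esym by auto
  moreover have "m \<noteq> n0" "m \<noteq> n1" using m adj_neq by auto
  ultimately show False using no_hexagon[of n0 m n1 n2 v n3] mv m Esym fan_distinct[OF a(1-3)]
    TCD[OF a(1)] TCD[OF a(2)] TCD[OF a(3)] TCD[OF a(4)] by auto
qed

text \<open>Two consecutive quads form a hexagon unless one of them has its far vertex at an outer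
  neighbour of the other. These alternatives must go the same way all around, and then the four
  neighbours of \<open>a\<close> are pairwise adjacent.\<close>

lemma all_quads:
  assumes a: "QC n0 a n1 m0" "QC n1 a n2 m1" "QC n2 a n3 m2" "QC n3 a n0 m3" shows False
proof -
  note d = QCD[OF a(1)] QCD[OF a(2)] QCD[OF a(3)] QCD[OF a(4)]
  note e = QCN[OF a(1)] QCN[OF a(2)] QCN[OF a(3)] QCN[OF a(4)]
  have r: "distinct [n0, n1, n2, n3]" using rot4_distinct[of a n0 n1 n2 n3] d e by auto
  have or: "m = p2 \<or> m' = p0" if q: "QC p0 a p1 m" "QC p1 a p2 m'" "p0 \<noteq> p2" for p0 p1 p2 m m'
  proof (rule ccontr)
    assume n: "\<not> (m = p2 \<or> m' = p0)"
    have "m \<noteq> m'" using nx2[of p1 a m] QCN[OF q(1)] QCN[OF q(2)] QCD[OF q(1)] by auto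
    then show False using no_hexagon[of a p0 m p1 m' p2] n q(3) QCD[OF q(1)] QCD[OF q(2)] by auto
  qed
  note o = or[OF a(1,2)] or[OF a(2,3)] or[OF a(3,4)] or[OF a(4,1)]
  have "(m0 = n2 \<and> m1 = n3 \<and> m2 = n0 \<and> m3 = n1) \<or> (m0 = n3 \<and> m1 = n0 \<and> m2 = n1 \<and> m3 = n2)"
    using o r by auto
  then show False using no_K5_minus[of a n0 n1 n2 n3] d r by auto
qed

end

section \<open>Face lengths\<close>

lemma orbit_card:
  assumes fin: "finite S" and cl: "\<And>x. x \<in> S \<Longrightarrow> f x \<in> S" and inj: "inj_on f S" and e: "e \<in> S"
  defines "n \<equiv> card (range (\<lambda>k. (f ^^ k) e))"
  shows "0 < n" "(f ^^ n) e = e" "\<And>m. 0 < m \<Longrightarrow> (f ^^ m) e = e \<Longrightarrow> n \<le> m"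
proof -
  have kS: "(f ^^ k) e \<in> S" for k by (induction k) (use e cl in auto)
  have kinj: "(f ^^ k) x = (f ^^ k) y \<Longrightarrow> x \<in> range (\<lambda>k. (f ^^ k) e) \<Longrightarrow> y \<in> range (\<lambda>k. (f ^^ k) e) \<Longrightarrow> x = y" for k x y
  proof (induction k arbitrary: x y)
    case (Suc k)
    have r: "f z \<in> range (\<lambda>k. (f ^^ k) e)" if z: "z \<in> range (\<lambda>k. (f ^^ k) e)" for z
    proof -
      obtain i where "z = (f ^^ i) e" using z by auto
      then have "f z = (f ^^ Suc i) e" by simp
      then show ?thesis by (rule range_eqI)
    qed
    have "f x = f y" using Suc.IH[of "f x" "f y"] Suc.prems r by (simp add: funpow_swap1)
    then show ?case using inj_onD[OF inj] Suc.prems(2,3) kS by auto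
  qed simp
  have finr: "finite (range (\<lambda>k. (f ^^ k) e))"
    by (rule finite_subset[OF _ fin]) (use kS in auto)
  have dec: "\<exists>m>0. m \<le> j \<and> (f ^^ m) e = e" if ij: "i < j" "(f ^^ i) e = (f ^^ j) e" for i j
  proof -
    have "(f ^^ j) e = (f ^^ i) ((f ^^ (j - i)) e)"
      using ij funpow_add[of i "j - i" f] by simp
    then have "(f ^^ i) e = (f ^^ i) ((f ^^ (j - i)) e)" using ij by simp
    then have "e = (f ^^ (j - i)) e" using kinj[of i e "(f ^^ (j - i)) e", OF _ range_eqI[of _ _ 0]] by simp
    then show ?thesis using ij(1) by (intro exI[of _ "j - i"]) auto
  qed
  have "\<not> inj_on (\<lambda>k. (f ^^ k) e) UNIV" using finr finite_imageD by (metis infinite_UNIV_nat)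
  then obtain i j where "i < j" "(f ^^ i) e = (f ^^ j) e"
    unfolding inj_on_def by (metis linorder_neqE_nat)
  then have ex: "\<exists>m. 0 < m \<and> (f ^^ m) e = e" using dec by blast
  define p where "p = (LEAST m. 0 < m \<and> (f ^^ m) e = e)"
  have p: "0 < p" "(f ^^ p) e = e" using LeastI_ex[OF ex] by (auto simp: p_def)
  have pmin: "p \<le> m" if "0 < m" "(f ^^ m) e = e" for m unfolding p_def by (rule Least_le) (use that in simp)
  have "range (\<lambda>k. (f ^^ k) e) = (\<lambda>k. (f ^^ k) e) ` {..<p}"
  proof -
    have "(f ^^ k) e = (f ^^ (k mod p)) e" for k
    proof -
      have "(f ^^ (p * q)) e = e" for q
      proof (induction q)
        case (Suc q) then show ?case using p by (simp add: funpow_add)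
      qed simp
      then have "(f ^^ (k mod p + p * (k div p))) e = (f ^^ (k mod p)) e" unfolding funpow_add by simp
      then show ?thesis by simp
    qed
    then have sub: "(f ^^ k) e \<in> (\<lambda>k. (f ^^ k) e) ` {..<p}" for k
      using p(1) by (intro image_eqI[of _ _ "k mod p"]) auto
    show ?thesis
    proof (rule equalityI)
      show "range (\<lambda>k. (f ^^ k) e) \<subseteq> (\<lambda>k. (f ^^ k) e) ` {..<p}" by (rule image_subsetI) (rule sub)
      show "(\<lambda>k. (f ^^ k) e) ` {..<p} \<subseteq> range (\<lambda>k. (f ^^ k) e)" by (rule image_mono) simp
    qed
  qed
  moreover have "inj_on (\<lambda>k. (f ^^ k) e) {..<p}"
  proof (rule linorder_inj_onI')
    fix i j assume "i \<in> {..<p}" "j \<in> {..<p}" "i < j"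
    then have ij: "i < j" "j < p" by auto
    show "(f ^^ i) e \<noteq> (f ^^ j) e"
    proof
      assume "(f ^^ i) e = (f ^^ j) e"
      then obtain m where "0 < m" "m \<le> j" "(f ^^ m) e = e" using dec[OF ij(1)] by blast
      then show False using pmin[of m] ij(2) by simp
    qed
  qed
  ultimately have "n = p" unfolding n_def by (simp add: card_image)
  then show "0 < n" "(f ^^ n) e = e" "\<And>m. 0 < m \<Longrightarrow> (f ^^ m) e = e \<Longrightarrow> n \<le> m" using p pmin by auto
qed

text \<open>\<open>f\<close> permutes \<open>S\<close>, so shifting along it does not change a sum.
  Averaging over \<open>n\<close> shifts avoids choosing representatives of faces.\<close>

lemma sum_average_le:
  fixes w :: "'d \<Rightarrow> real"
  assumes fin: "finite S" and cl: "\<And>x. x \<in> S \<Longrightarrow> f x \<in> S" and inj: "inj_on f S" and n: "0 < n"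
    and le: "\<And>x. x \<in> S \<Longrightarrow> (\<Sum>i<n. w ((f ^^ i) x)) \<le> b"
  shows "(\<Sum>x\<in>S. w x) \<le> real (card S) * (b / real n)"
proof -
  have bij: "bij_betw f S S"
    unfolding bij_betw_def using inj cl card_subset_eq[OF fin _ card_image[OF inj]] by blast
  have bk: "bij_betw (f ^^ i) S S" for i
  proof (induction i)
    case 0
    then show ?case using bij_betw_id[of S] by (simp add: id_def)
  next
    case (Suc i)
    then show ?case using bij_betw_trans[OF Suc bij] by (simp add: comp_def)
  qed
  have "(\<Sum>x\<in>S. w ((f ^^ i) x)) = (\<Sum>x\<in>S. w x)" for i
    by (rule sum.reindex_bij_betw[OF bk])
  then have "real n * (\<Sum>x\<in>S. w x) = (\<Sum>i<n. \<Sum>x\<in>S. w ((f ^^ i) x))" by simp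
  also have "\<dots> = (\<Sum>x\<in>S. \<Sum>i<n. w ((f ^^ i) x))" by (rule sum.swap)
  also have "\<dots> \<le> (\<Sum>x\<in>S. b)" by (rule sum_mono) (rule le)
  also have "\<dots> = real (card S) * b" by simp
  finally show ?thesis using n by (simp add: field_simps)
qed

context rotation
begin

definition fc :: "'a \<times> 'a \<Rightarrow> 'a \<times> 'a" where
  "fc = (\<lambda>(x, y). (y, nx y x))"

text \<open>The dart \<open>(u, v)\<close> also stands for the corner at \<open>u\<close> between
  \<open>px u v\<close> and \<open>v\<close>: the face traversing this dart is the one with that
  corner.\<close>

definition len :: "'a \<times> 'a \<Rightarrow> nat" where
  "len e = card (range (\<lambda>k. (fc ^^ k) e))"

definition deg :: "'a \<Rightarrow> nat" where
  "deg u = card {w. adj u w}"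

lemma fc_pair [simp]: "fc (x, y) = (y, nx y x)"
  by (simp add: fc_def)

lemma fc_E: "e \<in> E \<Longrightarrow> fc e \<in> E"
  by (cases e) (auto intro: nxE Esym)

lemma fc_inj: "inj_on fc E"
proof (rule inj_onI)
  fix e e' assume ee: "e \<in> E" "e' \<in> E" "fc e = fc e'"
  obtain x y x' y' where e: "e = (x, y)" "e' = (x', y')" by (cases e, cases e') auto
  then have "y = y'" "nx y x = nx y x'" using ee by auto
  then show "e = e'" using nx_inj[of y x x'] ee e Esym by auto
qed

lemma len_period:
  assumes "e \<in> E" shows "0 < len e" "(fc ^^ len e) e = e" "\<And>m. 0 < m \<Longrightarrow> (fc ^^ m) e = e \<Longrightarrow> len e \<le> m"
  unfolding len_def using orbit_card[OF finE fc_E fc_inj assms] by blast+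

lemma fck_E: "e \<in> E \<Longrightarrow> (fc ^^ k) e \<in> E"
  by (induction k) (auto intro: fc_E)

lemma len_fc: "e \<in> E \<Longrightarrow> len (fc e) = len e"
proof -
  assume e: "e \<in> E"
  note p = len_period[OF e] and q = len_period[OF fc_E[OF e]]
  have "(fc ^^ len e) (fc e) = fc e" using p(2) by (metis funpow_swap1)
  then have 1: "len (fc e) \<le> len e" using q(3) p(1) by blast
  have "fc ((fc ^^ len (fc e)) e) = fc e" using q(2) by (simp add: funpow_swap1)
  then have "(fc ^^ len (fc e)) e = e" using inj_onD[OF fc_inj _ fck_E[OF e] e] by blast
  then show ?thesis using 1 p(3) q(1) by (simp add: le_antisym)
qed

lemma len_next: "adj u v \<Longrightarrow> len (v, nx v u) = len (u, v)"
  using len_fc[of "(u, v)"] by simp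

lemma len_ge_3: "adj u v \<Longrightarrow> 3 \<le> len (u, v)"
proof (rule ccontr)
  assume uv: "adj u v" and "\<not> 3 \<le> len (u, v)"
  then have "len (u, v) = 1 \<or> len (u, v) = 2" using len_period(1)[OF uv] by auto
  then show False
  proof
    assume "len (u, v) = 1"
    then show False using len_period(2)[OF uv] adj_neq[OF uv] by simp
  next
    assume "len (u, v) = 2"
    then have "nx v u = u" using len_period(2)[OF uv] by (simp add: eval_nat_numeral)
    then show False using nx_ne(1)[OF Esym[OF uv]] by simp
  qed
qed

lemma walk_adj:
  assumes "adj u v" shows "adj v (nx v u)" "adj (nx v u) v"
  using assms nxE Esym by blast+

lemma corner_TC: "adj u v \<Longrightarrow> len (u, v) = 3 \<Longrightarrow> TC (px u v) u v"
proof -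
  assume uv: "adj u v" and l: "len (u, v) = 3"
  define w where "w = nx v u"
  have *: "nx w v = u" "nx u w = v"
    using len_period(2)[OF uv, unfolded l] by (auto simp: eval_nat_numeral w_def)
  have a: "adj v w" "adj w v" using walk_adj[OF uv] by (auto simp: w_def)
  have b: "adj w u" "adj u w" using walk_adj[OF a(1)] * by auto
  have "px u v = w" using px_nx[OF b(2)] * by simp
  then show "TC (px u v) u v" using uv a b * by (simp add: TC_def w_def)
qed

lemma corner_QC: "adj u v \<Longrightarrow> len (u, v) = 4 \<Longrightarrow> \<exists>m. QC (px u v) u v m"
proof -
  assume uv: "adj u v" and l: "len (u, v) = 4"
  define w where "w = nx v u"
  define x where "x = nx w v"
  have *: "nx x w = u" "nx u x = v"
    using len_period(2)[OF uv, unfolded l] by (auto simp: eval_nat_numeral w_def x_def)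
  have a: "adj v w" "adj w v" using walk_adj[OF uv] by (auto simp: w_def)
  have b: "adj w x" "adj x w" using walk_adj[OF a(1)] by (auto simp: x_def)
  have c: "adj x u" "adj u x" using walk_adj[OF b(1)] * by auto
  have "px u v = x" using px_nx[OF c(2)] * by simp
  then show ?thesis using uv a b c * by (auto simp: QC_def w_def x_def)
qed

lemma corner_PC: "adj u v \<Longrightarrow> len (u, v) = 5 \<Longrightarrow> \<exists>k l. PC (px u v) u v k l"
proof -
  assume uv: "adj u v" and l: "len (u, v) = 5"
  define w where "w = nx v u"
  define x where "x = nx w v"
  define y where "y = nx x w"
  have "(fc ^^ 5) (u, v) = (nx y x, nx (nx y x) y)"
    by (simp add: eval_nat_numeral w_def x_def y_def)
  then have *: "nx y x = u" "nx u y = v" using len_period(2)[OF uv, unfolded l] by auto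
  have a: "adj v w" "adj w v" using walk_adj[OF uv] by (auto simp: w_def)
  have b: "adj w x" "adj x w" using walk_adj[OF a(1)] by (auto simp: x_def)
  have c: "adj x y" "adj y x" using walk_adj[OF b(1)] by (auto simp: y_def)
  have d: "adj y u" "adj u y" using walk_adj[OF c(1)] * by auto
  have "px u v = y" using px_nx[OF d(2)] * by simp
  then show ?thesis using uv a b c d * by (auto simp: PC_def w_def x_def y_def)
qed

lemma TC_len: 
  assumes "TC x a y" shows "len (a, y) = 3" "len (y, x) = 3" "len (x, a) = 3" "px a y = x"
proof -
  note d = TCD[OF assms] and e = TCN[OF assms]
  have "(fc ^^ 3) (a, y) = (a, y)" using e by (simp add: eval_nat_numeral)
  then have "len (a, y) \<le> 3" using len_period(3)[of "(a, y)" 3] d by simp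
  then show l: "len (a, y) = 3" using len_ge_3[of a y] d by simp
  show "len (y, x) = 3" using len_next[of a y] d e l by simp
  then show "len (x, a) = 3" using len_next[of y x] d e by simp
  show "px a y = x" using px_nx[of a x] d e by simp
qed

text \<open>A hexagonal face which is not a 6-cycle is a bowtie: its boundary walk passes the centre twice.\<close>

definition centre :: "'a \<times> 'a \<Rightarrow> bool" where
  "centre e \<longleftrightarrow> fst ((fc ^^ 3) e) = fst e"

lemma hexagon_walk:
  assumes ab: "adj a b" and l: "len (a, b) = 6"
  obtains c d e f where "nx b a = c" "nx c b = d" "nx d c = e" "nx e d = f" "nx f e = a" "nx a f = b"
    "adj b c" "adj c d" "adj d e" "adj e f" "adj f a"
proof
  define c d e f where "c = nx b a" and "d = nx c b" and "e = nx d c" and "f = nx e d"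
  note df = c_def d_def e_def f_def
  show "nx b a = c" "nx c b = d" "nx d c = e" "nx e d = f" by (simp_all add: df)
  have "(fc ^^ 6) (a, b) = (nx f e, nx (nx f e) f)" by (simp add: eval_nat_numeral df)
  then show *: "nx f e = a" "nx a f = b" using len_period(2)[OF ab, unfolded l] by auto
  show "adj b c" using walk_adj[OF ab] by (simp add: c_def)
  then show "adj c d" using walk_adj by (simp add: d_def)
  then show "adj d e" using walk_adj by (simp add: e_def)
  then show "adj e f" using walk_adj by (simp add: f_def)
  then show "adj f a" using walk_adj * by blast
qed

text \<open>Vertices one or two steps apart on the walk differ, so if it is not a 6-cycle, two
  antipodal ones coincide.\<close>

lemma hexagon_centre:
  assumes ab: "adj a b" and l: "len (a, b) = 6"
  shows "centre (a, b) \<or> centre (fc (a, b)) \<or> centre (fc (fc (a, b)))"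
proof (rule ccontr)
  assume n: "\<not> ?thesis"
  obtain c d e f where w: "nx b a = c" "nx c b = d" "nx d c = e" "nx e d = f" "nx f e = a" "nx a f = b"
    "adj b c" "adj c d" "adj d e" "adj e f" "adj f a" using hexagon_walk[OF assms] by metis
  have ne: "a \<noteq> d" "b \<noteq> e" "c \<noteq> f" using n w by (auto simp: centre_def eval_nat_numeral)
  have "distinct [a, b, c, d, e, f]"
    using ne w(7-11) ab adj_neq nx_ne(1)[of b a] nx_ne(1)[of c b] nx_ne(1)[of d c] nx_ne(1)[of e d]
      nx_ne(1)[of f e] nx_ne(1)[of a f] Esym w by auto
  then show False using no_hexagon[of a b c d e f] ab w by blast
qed

lemma centre_shift: 
  assumes "adj a b" "len (a, b) = 6" shows "centre ((fc ^^ 3) (a, b)) \<longleftrightarrow> centre (a, b)"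
proof -
  have "(fc ^^ 3) ((fc ^^ 3) (a, b)) = (fc ^^ 6) (a, b)"
    by (simp add: numeral_eq_Suc del: fc_pair)
  also have "\<dots> = (a, b)" using len_period(2)[OF assms(1)] assms(2) by simp
  finally have *: "(fc ^^ 3) ((fc ^^ 3) (a, b)) = (a, b)" .
  show ?thesis unfolding centre_def * by (rule eq_commute)
qed

text \<open>The walk is \<open>a b c a d e\<close>, and \<open>b \<noteq> d\<close> since its period
  is not three. A triangle filling the gap from \<open>b\<close> to \<open>c\<close> or from
  \<open>d\<close> to \<open>e\<close> would close the rotation at \<open>b\<close> or
  \<open>d\<close> after two steps, hence the last two facts.\<close>

lemma centre_corners:
  assumes ab: "adj a b" and l: "len (a, b) = 6" and c: "centre (a, b)"
  obtains c d e where "distinct [b, c, d, e]" "adj a c" "adj a d" "adj a e" "nx a e = b" "nx a c = d"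
    "len (a, d) = 6" "nx a b = c \<Longrightarrow> len (a, c) \<noteq> 3" "nx a d = e \<Longrightarrow> len (a, e) \<noteq> 3"
proof -
  obtain c d' d e where w: "nx b a = c" "nx c b = d'" "nx d' c = d" "nx d d' = e" "nx e d = a" "nx a e = b"
    "adj b c" "adj c d'" "adj d' d" "adj d e" "adj e a" using hexagon_walk[OF ab l] by metis
  have d': "d' = a" using c w by (auto simp: centre_def eval_nat_numeral)
  have lens: "len (b, c) = 6" "len (c, a) = 6" "len (a, d) = 6" 
    using len_next[OF ab] len_next[of b c] len_next[of c a] w d' l by auto
  have bd: "b \<noteq> d"
  proof
    assume "b = d"
    then have "(fc ^^ 3) (a, b) = (a, b)" using w d' by (simp add: eval_nat_numeral)
    then show False using len_period(3)[OF ab, of 3] l by simp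
  qed
  have "adj a c" "adj a d" "adj a e" using w d' Esym by auto
  moreover have "b \<noteq> c" "d \<noteq> e" "b \<noteq> e" "c \<noteq> d" 
    using w d' adj_neq nx_ne(1)[of a e] nx_ne(1)[of a c] Esym by auto
  moreover have "c \<noteq> e" using bd w d' by auto
  moreover have "len (a, c) \<noteq> 3" if "nx a b = c"
  proof
    assume "len (a, c) = 3"
    from corner_TC[OF \<open>adj a c\<close> this] have t: "TC b a c" using px_nx[OF ab] that by simp
    show False using nx2[OF Esym[OF ab] w(1)] TCN[OF t] by blast
  qed
  moreover have "len (a, e) \<noteq> 3" if "nx a d = e"
  proof
    assume "len (a, e) = 3"
    from corner_TC[OF \<open>adj a e\<close> this] have t: "TC d a e" using px_nx[OF \<open>adj a d\<close>] that by simp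
    show False using nx2[OF Esym[OF \<open>adj a d\<close>] w(4)[unfolded d']] TCN[OF t] by blast
  qed
  ultimately show ?thesis using that[of c d e] bd w d' lens by auto
qed

text \<open>One of the two edges at the corner has a triangle on its other side.\<close>

definition tri5 :: "'a \<times> 'a \<Rightarrow> bool" where
  "tri5 e \<longleftrightarrow> (case e of (u, v) \<Rightarrow> len (v, u) = 3 \<or> len (u, px u v) = 3)"

text \<open>The corner is opposite to a lone triangle between two quads. This is the one case in
  which a pentagon has to pay at a corner although no triangle borders it there.\<close>

definition bad :: "'a \<times> 'a \<Rightarrow> bool" where
  "bad e \<longleftrightarrow> (case e of (u, v) \<Rightarrow> deg u = 4 \<and> len (u, nx u v) = 4 \<and> len (u, nx u (nx u v)) = 3 \<and>
     len (u, nx u (nx u (nx u v))) = 4)"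

text \<open>
  The charge sent to the vertex \<open>u\<close> by the face at the corner before the dart \<open>(u, v)\<close>.
  The two corners at the centre of a bowtie get less, so that the others get as much as those of a heptagon.
\<close>

definition wt :: "'a \<times> 'a \<Rightarrow> real" where
  "wt e = (if len e \<le> 4 then 0 else if len e = 5 then (if tri5 e \<or> bad e then 1/2 else 0)
     else if len e = 6 \<and> centre e then 1/7 else 3/7)"

lemma wt_nonneg: "0 \<le> wt e"
  by (simp add: wt_def)

text \<open>Centres come in antipodal pairs and there is at least one, so the total is at most
  \<open>4 * 3/7 + 2 * 1/7 = 2\<close>, which is \<open>6 - 4\<close>.\<close>

lemma sum_hexagon:
  assumes ab: "adj a b" and l: "len (a, b) = 6" shows "(\<Sum>i<6. wt ((fc ^^ i) (a, b))) \<le> 2"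
proof -
  let ?e = "(a, b)"
  have le: "len ((fc ^^ i) ?e) = 6" for i
    by (induction i) (use l ab len_fc fck_E in auto)
  have w: "wt ((fc ^^ i) ?e) = (if centre ((fc ^^ i) ?e) then 1/7 else 3/7)" for i
    using le[of i] by (simp add: wt_def)
  have c: "centre ((fc ^^ (i + 3)) ?e) \<longleftrightarrow> centre ((fc ^^ i) ?e)" for i
  proof -
    obtain x y where xy: "(fc ^^ i) ?e = (x, y)" by (cases "(fc ^^ i) ?e")
    then have "adj x y" using fck_E[OF ab, of i] by simp
    have "(fc ^^ (3 + i)) ?e = (fc ^^ 3) ((fc ^^ i) ?e)" unfolding funpow_add by simp
    then have "(fc ^^ (i + 3)) ?e = (fc ^^ 3) (x, y)" using xy by (simp only: add.commute)
    then show ?thesis using centre_shift[OF \<open>adj x y\<close>] le[of i] xy by simp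
  qed
  have "centre ((fc ^^ 0) ?e) \<or> centre ((fc ^^ 1) ?e) \<or> centre ((fc ^^ 2) ?e)"
    using hexagon_centre[OF ab l] by (simp add: eval_nat_numeral)
  moreover have "(\<Sum>i<6. wt ((fc ^^ i) ?e)) = (\<Sum>i\<in>{0, 1, 2, 3, 4, 5}. wt ((fc ^^ i) ?e))"
    by (rule sum.cong) auto
  ultimately show ?thesis using c[of 0] c[of 1] c[of 2] unfolding w by (auto simp: numeral_eq_Suc)
qed

lemma deg4_cyc:
  assumes "adj a n0" "deg a = 4"
  shows "nx a (nx a (nx a (nx a n0))) = n0"
    "adj a z \<Longrightarrow> z \<in> {n0, nx a n0, nx a (nx a n0), nx a (nx a (nx a n0))}"
    "{w. adj a w} = {n0, nx a n0, nx a (nx a n0), nx a (nx a (nx a n0))}"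
proof -
  have 4: "(nx a ^^ 4) n0 = n0" using deg_bij(2)[OF assms(1)] assms(2) by (simp add: deg_def)
  then show "nx a (nx a (nx a (nx a n0))) = n0" by (simp add: eval_nat_numeral)
  have "{w. adj a w} = (\<lambda>i. (nx a ^^ i) n0) ` {..<4}" by (rule nbrs_period[OF assms(1) _ 4]) simp
  also have "{..<4} = {0, 1, 2, 3::nat}" by auto
  finally show N: "{w. adj a w} = {n0, nx a n0, nx a (nx a n0), nx a (nx a (nx a n0))}"
    by (simp add: eval_nat_numeral)
  then show "adj a z \<Longrightarrow> z \<in> {n0, nx a n0, nx a (nx a n0), nx a (nx a (nx a n0))}" by blast
qed

end

section \<open>Payments of the faces\<close>

context rotation
begin

lemma bad_corners:
  assumes ay: "adj a y" and b: "bad (a, y)"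
  obtains n0 n1 n2 m m'' where "nx a y = n0" "px a y = n2" "TC n0 a n1" "QC n1 a n2 m" "QC y a n0 m''"
    "\<And>z. adj a z \<Longrightarrow> z \<in> {n0, n1, n2, y}"
proof -
  define n0 n1 n2 where "n0 = nx a y" and "n1 = nx a n0" and "n2 = nx a n1"
  have d: "deg a = 4" and l: "len (a, n0) = 4" "len (a, n1) = 3" "len (a, n2) = 4"
    using b by (auto simp: bad_def n0_def n1_def n2_def)
  have c: "nx a n2 = y" using deg4_cyc(1)[OF ay d] by (simp add: n0_def n1_def n2_def)
  have A: "adj a n0" "adj a n1" "adj a n2" using ay nxE by (auto simp: n0_def n1_def n2_def)
  have p: "px a n0 = y" "px a n1 = n0" "px a n2 = n1" "px a y = n2"
    using px_nx[OF ay] px_nx[OF A(1)] px_nx[OF A(2)] px_nx[OF A(3)] c by (auto simp: n0_def n1_def n2_def)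
  have t: "TC n0 a n1" using corner_TC[OF A(2) l(2)] p by simp
  obtain m where m: "QC n1 a n2 m" using corner_QC[OF A(3) l(3)] p by auto
  obtain m'' where m'': "QC y a n0 m''" using corner_QC[OF A(1) l(1)] p by auto
  have "\<And>z. adj a z \<Longrightarrow> z \<in> {n0, n1, n2, y}"
    using deg4_cyc(2)[OF ay d] by (auto simp: n0_def n1_def n2_def)
  then show ?thesis using that[OF n0_def[symmetric] p(4) t m m''] by blast
qed

text \<open>Across the two sides at \<open>a\<close> lie the quads. The other sides are settled by
  the lemmas on bad pentagons, \<open>x l\<close> by the mirror image of the argument for
  \<open>y k\<close>.\<close>

lemma bad_no_tri:
  assumes p: "PC x a y k l" and b: "bad (a, y)"
  shows "len (y, a) \<noteq> 3" "len (k, y) \<noteq> 3" "len (l, k) \<noteq> 3" "len (x, l) \<noteq> 3" "len (a, x) \<noteq> 3"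
proof -
  note d = PCD[OF p] and e = PCN[OF p]
  have ay: "adj a y" using d by simp
  obtain n0 n1 n2 m m'' where n: "nx a y = n0" "px a y = n2" "TC n0 a n1" "QC n1 a n2 m" "QC y a n0 m''"
    "\<And>z. adj a z \<Longrightarrow> z \<in> {n0, n1, n2, y}" using bad_corners[OF ay b] by metis
  have n2: "n2 = x" using n(2) px_nx[of a x] d e by simp
  note p' = p[folded n2]
  have "len (a, n0) = 4" using b n(1) by (simp add: bad_def)
  then show "len (y, a) \<noteq> 3" using len_next[of y a] n(1) d by simp
  have "nx a (nx a (nx a y)) = n2" using TCN[OF n(3)] QCN[OF n(4)] n(1) by simp
  then show "len (a, x) \<noteq> 3" using b n2 by (auto simp: bad_def)
  show "len (k, y) \<noteq> 3"
  proof
    assume "len (k, y) = 3"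
    from TC_rot[OF corner_TC[OF _ this]] d have "TC k y (px k y)" by simp
    then show False using bad_pentagon_side[OF n(3,4) p' n(5)] by blast
  qed
  show "len (l, k) \<noteq> 3"
  proof
    assume "len (l, k) = 3"
    from TC_rot[OF corner_TC[OF _ this]] d have "TC l k (px l k)" by simp
    then show False using bad_pentagon_opposite[OF n(3,4) p' n(5) _ n(6)] by blast
  qed
  show "len (x, l) \<noteq> 3"
  proof
    assume "len (x, l) = 3"
    from corner_TC[OF _ this] d have t: "TC (px x l) n2 l" using n2 by simp
    show False
      by (rule rotation.bad_pentagon_side[OF mirror, unfolded TC_mirror QC_mirror PC_mirror,
          OF n(3) n(5) p' n(4) t])
  qed
qed

lemma bad_bad:
  assumes p: "PC x a y k l" and b: "bad (a, y)" and b': "bad (y, k)" shows False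
proof -
  note d = PCD[OF p] and e = PCN[OF p]
  have ay: "adj a y" and yk: "adj y k" using d by auto
  obtain n0 n1 n2 m m'' where n: "nx a y = n0" "px a y = n2" "TC n0 a n1" "QC n1 a n2 m" "QC y a n0 m''"
    "\<And>z. adj a z \<Longrightarrow> z \<in> {n0, n1, n2, y}" using bad_corners[OF ay b] by metis
  have n2: "n2 = x" using n(2) px_nx[of a x] d e by simp
  obtain j q r m3 m4 where c: "nx y k = j" "px y k = r" "TC j y q" "QC q y r m4" "QC k y j m3"
    "\<And>z. adj y z \<Longrightarrow> z \<in> {j, q, r, k}" using bad_corners[OF yk b'] by metis
  have r: "r = a" using c(2) px_nx[of y a] d e by simp
  \<comment> \<open>The quad across \<open>a y\<close> belongs to both configurations; read from
    \<open>y\<close> it identifies their vertices.\<close>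
  have q: "q = m''" using QCN[OF c(4)] QCN[OF n(5)] QCD[OF c(4)] QCD[OF n(5)] r nx_inj[of y q m''] by auto
  show False
    by (rule bad_adjacent[OF n(3,4) p[folded n2] n(5) c(3)[unfolded q] c(5) n(6)])
      (use c(6) q r in auto)
qed

lemma tri5_pair:
  assumes p: "PC x a y k l" shows "\<not> (len (y, a) = 3 \<and> len (k, y) = 3)" "\<not> (len (y, a) = 3 \<and> len (l, k) = 3)"
proof -
  note d = PCD[OF p]
  have t: "TC u v (px u v)" if "adj u v" "len (u, v) = 3" for u v
    using TC_rot[OF corner_TC[OF that]] .
  show "\<not> (len (y, a) = 3 \<and> len (k, y) = 3)"
  proof
    assume "len (y, a) = 3 \<and> len (k, y) = 3"
    then have "TC (px y a) y a" "TC k y (px k y)" using t[of k y] corner_TC[of y a] d by auto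
    then show False using no_T5T[OF _ PC_rot[OF p]] by blast
  qed
  show "\<not> (len (y, a) = 3 \<and> len (l, k) = 3)"
    using tri5_nonadjacent[OF p] t[of y a] t[of l k] d by blast
qed

text \<open>If a side borders a triangle, it is the only one and no corner is bad, so just its two
  ends are paid. Otherwise only bad corners are paid, no two of them consecutive, hence at most two
  of the five. Two halves are the surplus \<open>5 - 4\<close>.\<close>

lemma sum_pentagon:
  assumes ay: "adj a y" and l5: "len (a, y) = 5" shows "(\<Sum>i<5. wt ((fc ^^ i) (a, y))) \<le> 1"
proof -
  obtain k l where p0: "PC (px a y) a y k l" using corner_PC[OF assms] by blast
  define x where "x = px a y"
  note p = p0[folded x_def]
  note d = PCD[OF p] and e = PCN[OF p]
  have f: "(fc ^^ 0) (a, y) = (a, y)" "(fc ^^ 1) (a, y) = (y, k)" "(fc ^^ 2) (a, y) = (k, l)"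
    "(fc ^^ 3) (a, y) = (l, x)" "(fc ^^ 4) (a, y) = (x, a)"
    using e by (auto simp: eval_nat_numeral)
  have ls: "len (y, k) = 5" "len (k, l) = 5" "len (l, x) = 5" "len (x, a) = 5"
    using len_next[of a y] len_next[of y k] len_next[of k l] len_next[of l x] d e l5 by auto
  have px: "px a y = x" "px y k = a" "px k l = y" "px l x = k" "px x a = l"
    using px_nx[of a x] px_nx[of y a] px_nx[of k y] px_nx[of l k] px_nx[of x l] d e by auto
  define t0 t1 t2 t3 t4 where "t0 = (len (y, a) = 3)" and "t1 = (len (k, y) = 3)" and "t2 = (len (l, k) = 3)"
    and "t3 = (len (x, l) = 3)" and "t4 = (len (a, x) = 3)"
  define b0 b1 b2 b3 b4 where "b0 = bad (a, y)" and "b1 = bad (y, k)" and "b2 = bad (k, l)"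
    and "b3 = bad (l, x)" and "b4 = bad (x, a)"
  have w: "wt (a, y) = (if t0 \<or> t4 \<or> b0 then 1/2 else 0)" "wt (y, k) = (if t1 \<or> t0 \<or> b1 then 1/2 else 0)"
    "wt (k, l) = (if t2 \<or> t1 \<or> b2 then 1/2 else 0)" "wt (l, x) = (if t3 \<or> t2 \<or> b3 then 1/2 else 0)"
    "wt (x, a) = (if t4 \<or> t3 \<or> b4 then 1/2 else 0)"
    using l5 ls px by (auto simp: wt_def tri5_def t0_def t1_def t2_def t3_def t4_def b0_def b1_def b2_def b3_def b4_def)
  note p1 = PC_rot[OF p] note p2 = PC_rot[OF p1] note p3 = PC_rot[OF p2] note p4 = PC_rot[OF p3]
  have T: "\<not> (t0 \<and> t1)" "\<not> (t0 \<and> t2)" "\<not> (t1 \<and> t2)" "\<not> (t1 \<and> t3)" "\<not> (t2 \<and> t3)" "\<not> (t2 \<and> t4)"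
    "\<not> (t3 \<and> t4)" "\<not> (t3 \<and> t0)" "\<not> (t4 \<and> t0)" "\<not> (t4 \<and> t1)"
    using tri5_pair[OF p] tri5_pair[OF p1] tri5_pair[OF p2] tri5_pair[OF p3] tri5_pair[OF p4]
    unfolding t0_def t1_def t2_def t3_def t4_def by blast+
  have B0: "b0 \<Longrightarrow> \<not> t0 \<and> \<not> t1 \<and> \<not> t2 \<and> \<not> t3 \<and> \<not> t4"
    using bad_no_tri[OF p] unfolding t0_def t1_def t2_def t3_def t4_def b0_def by simp
  have B1: "b1 \<Longrightarrow> \<not> t0 \<and> \<not> t1 \<and> \<not> t2 \<and> \<not> t3 \<and> \<not> t4"
    using bad_no_tri[OF p1] unfolding t0_def t1_def t2_def t3_def t4_def b1_def by simp
  have B2: "b2 \<Longrightarrow> \<not> t0 \<and> \<not> t1 \<and> \<not> t2 \<and> \<not> t3 \<and> \<not> t4"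
    using bad_no_tri[OF p2] unfolding t0_def t1_def t2_def t3_def t4_def b2_def by simp
  have B3: "b3 \<Longrightarrow> \<not> t0 \<and> \<not> t1 \<and> \<not> t2 \<and> \<not> t3 \<and> \<not> t4"
    using bad_no_tri[OF p3] unfolding t0_def t1_def t2_def t3_def t4_def b3_def by simp
  have B4: "b4 \<Longrightarrow> \<not> t0 \<and> \<not> t1 \<and> \<not> t2 \<and> \<not> t3 \<and> \<not> t4"
    using bad_no_tri[OF p4] unfolding t0_def t1_def t2_def t3_def t4_def b4_def by simp
  have B: "b0 \<or> b1 \<or> b2 \<or> b3 \<or> b4 \<Longrightarrow> \<not> (t0 \<or> t1 \<or> t2 \<or> t3 \<or> t4)"
    using B0 B1 B2 B3 B4 by argo
  have BB: "\<not> (b0 \<and> b1)" "\<not> (b1 \<and> b2)" "\<not> (b2 \<and> b3)" "\<not> (b3 \<and> b4)" "\<not> (b4 \<and> b0)"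
    using bad_bad[OF p] bad_bad[OF p1] bad_bad[OF p2] bad_bad[OF p3] bad_bad[OF p4]
    unfolding b0_def b1_def b2_def b3_def b4_def by blast+
  have "(\<Sum>i<5. wt ((fc ^^ i) (a, y))) = (\<Sum>i\<in>{0, 1, 2, 3, 4}. wt ((fc ^^ i) (a, y)))"
    by (rule sum.cong) auto
  also have "\<dots> = wt (a, y) + wt (y, k) + wt (k, l) + wt (l, x) + wt (x, a)"
    using f by simp
  also have "\<dots> \<le> 1"
  proof (cases "t0 \<or> t1 \<or> t2 \<or> t3 \<or> t4")
    case True
    then have "\<not> (b0 \<or> b1 \<or> b2 \<or> b3 \<or> b4)" using B by blast
    then show ?thesis using True T unfolding w by (elim disjE) simp_all
  next
    case False
    then show ?thesis using BB unfolding w by auto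
  qed
  finally show ?thesis .
qed

lemma sum_len_class:
  assumes n: "0 < n" and le: "\<And>e. e \<in> E \<Longrightarrow> len e = n \<Longrightarrow> (\<Sum>i<n. wt ((fc ^^ i) e)) \<le> real n - 4"
  shows "(\<Sum>e\<in>{e \<in> E. len e = n}. wt e) \<le> (\<Sum>e\<in>{e \<in> E. len e = n}. 1 - 4 / real (len e))"
proof -
  let ?S = "{e \<in> E. len e = n}"
  have "(\<Sum>e\<in>?S. wt e) \<le> real (card ?S) * ((real n - 4) / real n)"
    by (rule sum_average_le[where f = fc]) (use finE fc_E len_fc inj_on_subset[OF fc_inj] n le in auto)
  also have "\<dots> = (\<Sum>e\<in>?S. 1 - 4 / real (len e))" using n by (simp add: diff_divide_distrib)
  finally show ?thesis .
qed

text \<open>A dart of a triangle has \<open>1 - 4/3 = - 1/3\<close>. For lengths from seven on the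
  payment is covered dart by dart, for five and six only on average over the face.\<close>

lemma sum_wt_le:
  "(\<Sum>e\<in>E. wt e) - real (card {e \<in> E. len e = 3}) / 3 \<le> (\<Sum>e\<in>E. 1 - 4 / real (len e))"
proof -
  let ?g = "\<lambda>e. 1 - 4 / real (len e)"
  let ?A = "{e \<in> E. len e = 3}" and ?B = "{e \<in> E. len e = 5}" and ?C = "{e \<in> E. len e = 6}"
    and ?R = "{e \<in> E. len e \<noteq> 3 \<and> len e \<noteq> 5 \<and> len e \<noteq> 6}"
  have split: "sum h E = sum h ?A + sum h ?B + sum h ?C + sum h ?R" for h :: "'a \<times> 'a \<Rightarrow> real"
  proof -
    have "E = ?A \<union> (?B \<union> (?C \<union> ?R))" by auto
    then have "sum h E = sum h (?A \<union> (?B \<union> (?C \<union> ?R)))" by simp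
    also have "\<dots> = sum h ?A + (sum h ?B + (sum h ?C + sum h ?R))"
      using finE by (subst sum.union_disjoint; (subst sum.union_disjoint; (subst sum.union_disjoint)?)?) auto
    finally show ?thesis by simp
  qed
  have "sum wt ?A = 0" by (rule sum.neutral) (simp add: wt_def)
  moreover have "sum ?g ?A = - real (card ?A) / 3" by simp
  moreover have "sum wt ?B \<le> sum ?g ?B" by (rule sum_len_class) (use sum_pentagon in auto)
  moreover have "sum wt ?C \<le> sum ?g ?C" by (rule sum_len_class) (use sum_hexagon in auto)
  moreover have "sum wt ?R \<le> sum ?g ?R"
  proof (rule sum_mono)
    fix e assume e: "e \<in> ?R"
    then have "len e = 4 \<or> 7 \<le> len e" using len_ge_3[of "fst e" "snd e"] by force
    then show "wt e \<le> ?g e"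
    proof
      assume 7: "7 \<le> len e"
      then have "4 / real (len e) \<le> 4 / 7" by (intro divide_left_mono) auto
      then show ?thesis using 7 by (simp add: wt_def)
    qed (simp add: wt_def)
  qed
  ultimately show ?thesis using split[of wt] split[of ?g] by linarith
qed

section \<open>Shares of vertices of degree four\<close>

definition surplus :: "'a \<Rightarrow> real" where
  "surplus u = real (deg u) - 4 + (\<Sum>v\<in>{v. adj u v}. wt (u, v))"

definition tri :: "'a \<Rightarrow> nat" where
  "tri u = card {v. adj u v \<and> len (u, v) = 3}"

text \<open>All triangular corners at \<open>u\<close> receive the same amount; the three shares of
  a triangle have to cover its debt 1.\<close>

definition share :: "'a \<Rightarrow> real" where
  "share u = surplus u / real (tri u)"

lemma deg_ge: "adj u v \<Longrightarrow> 4 \<le> deg u"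
  using deg_ge_4 by (simp add: deg_def)

lemma surplus_ge:
  assumes "A \<subseteq> {v. adj u v}" shows "real (deg u) - 4 + (\<Sum>v\<in>A. wt (u, v)) \<le> surplus u"
  unfolding surplus_def using sum_mono2[OF fin_nbrs assms, of "\<lambda>v. wt (u, v)"] wt_nonneg by simp

lemma tri_le:
  assumes "A \<subseteq> {v. adj u v \<and> len (u, v) \<noteq> 3}" shows "tri u \<le> deg u - card A"
proof -
  have "{v. adj u v \<and> len (u, v) = 3} \<subseteq> {v. adj u v} - A" using assms by auto
  then have "tri u \<le> card ({v. adj u v} - A)" unfolding tri_def
    by (intro card_mono) (use fin_nbrs in auto)
  also have "\<dots> = deg u - card A" unfolding deg_def
    by (rule card_Diff_subset) (use assms fin_nbrs in \<open>auto intro: finite_subset[OF _ fin_nbrs]\<close>)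
  finally show ?thesis .
qed

lemma tri_pos: "adj u v \<Longrightarrow> len (u, v) = 3 \<Longrightarrow> 0 < tri u"
  unfolding tri_def by (subst card_gt_0_iff) (auto intro: finite_subset[OF _ fin_nbrs])

lemma share_ge:
  assumes v: "adj u v" "len (u, v) = 3" and t: "tri u \<le> t" and s: "r * real t \<le> surplus u" and r: "0 \<le> r"
  shows "r \<le> share u"
proof -
  have "r * real (tri u) \<le> r * real t" using t r by (intro mult_left_mono) auto
  then have "r * real (tri u) \<le> surplus u" using s by linarith
  then show ?thesis unfolding share_def using tri_pos[OF v] by (simp add: pos_le_divide_eq)
qed

lemma sandwiched:
  assumes v: "adj u v" "len (u, v) \<noteq> 3" and l: "len (u, px u v) = 3" and r: "len (u, nx u v) = 3"
  shows "6 \<le> len (u, v)"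
proof -
  have A: "adj u (px u v)" "adj u (nx u v)" using v pxE nxE by blast+
  have t1: "TC (px u (px u v)) u (px u v)" by (rule corner_TC[OF A(1) l])
  have t2: "TC v u (nx u v)" using corner_TC[OF A(2) r] px_nx[OF v(1)] by simp
  have "len (u, v) \<noteq> 4" using no_T4T[OF t1 _ t2] corner_QC[OF v(1)] by blast
  moreover have "len (u, v) \<noteq> 5" using no_T5T[OF t1 _ t2] corner_PC[OF v(1)] by blast
  ultimately show ?thesis using len_ge_3[OF v(1)] v(2) by linarith
qed

text \<open>The two visits of the bowtie use two corners at \<open>a\<close>, and the other two
  corners lie inside its loops, where there is no triangle.\<close>

lemma centre_deg4:
  assumes d: "deg a = 4" and b: "adj a b" "len (a, b) = 6" "centre (a, b)" and w: "adj a w" "len (a, w) = 3"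
  shows False
proof -
  obtain c d e where x: "distinct [b, c, d, e]" "adj a c" "adj a d" "adj a e" "nx a e = b" "nx a c = d"
    "len (a, d) = 6" "nx a b = c \<Longrightarrow> len (a, c) \<noteq> 3" "nx a d = e \<Longrightarrow> len (a, e) \<noteq> 3"
    using centre_corners[OF b] by metis
  have N: "{b, c, d, e} = {w. adj a w}"
    using x b(1) d by (intro card_subset_eq fin_nbrs) (auto simp: deg_def)
  have "nx a b \<in> {b, c, d, e}" "nx a d \<in> {b, c, d, e}" using N nxE b x by blast+
  then have "nx a b = c" "nx a d = e"
    using nx_ne(1)[OF b(1)] nx_ne(1)[OF x(3)] nx2[OF x(4,5)] nx2[OF x(2,6)]
      nx_inj[OF b(1) x(2)] nx_inj[OF x(3) x(4)] x by auto
  then have "len (a, c) \<noteq> 3" "len (a, e) \<noteq> 3" using x by auto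
  moreover have "w \<in> {b, c, d, e}" using N w by blast
  ultimately show False using w b x by auto
qed

lemma wt_long: "6 \<le> len e \<Longrightarrow> \<not> (len e = 6 \<and> centre e) \<Longrightarrow> wt e = 3/7"
  by (auto simp: wt_def)

lemma wt_long_deg4:
  assumes "deg u = 4" "adj u w" "len (u, w) = 3" "adj u v" "6 \<le> len (u, v)"
  shows "wt (u, v) = 3/7"
  using centre_deg4[OF assms(1,4) _ _ assms(2,3)] wt_long[OF assms(5)] by blast

lemma deg4_setup:
  assumes d: "deg u = 4" and n1: "adj u n1"
  obtains n2 n3 n0 where "nx u n1 = n2" "nx u n2 = n3" "nx u n3 = n0" "nx u n0 = n1"
    "px u n1 = n0" "px u n2 = n1" "px u n3 = n2" "px u n0 = n3"
    "adj u n2" "adj u n3" "adj u n0" "distinct [n0, n1, n2, n3]"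
    "surplus u = wt (u, n0) + wt (u, n1) + wt (u, n2) + wt (u, n3)" "{w. adj u w} = {n0, n1, n2, n3}"
proof -
  define n2 n3 n0 where "n2 = nx u n1" and "n3 = nx u n2" and "n0 = nx u n3"
  have c: "nx u n0 = n1" using deg4_cyc(1)[OF n1 d] by (simp add: n2_def n3_def n0_def)
  have A: "adj u n2" "adj u n3" "adj u n0" using n1 nxE by (auto simp: n2_def n3_def n0_def)
  have p: "px u n1 = n0" "px u n2 = n1" "px u n3 = n2" "px u n0 = n3"
    using px_nx[OF n1] px_nx[OF A(1)] px_nx[OF A(2)] px_nx[OF A(3)] c by (auto simp: n2_def n3_def n0_def)
  have D: "distinct [n0, n1, n2, n3]" 
    using rot4_distinct(1)[OF A(3) c] by (auto simp: n2_def n3_def)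
  have N: "{w. adj u w} = {n0, n1, n2, n3}" using deg4_cyc(3)[OF n1 d] by (auto simp: n2_def n3_def n0_def)
  have "surplus u = wt (u, n0) + wt (u, n1) + wt (u, n2) + wt (u, n3)"
    unfolding surplus_def N using D d by simp
  then show ?thesis using that[of n2 n3 n0] c A p D N by (simp add: n2_def n3_def n0_def)
qed

text \<open>If the opposite corner is a triangle, both flanks are long by \<open>sandwiched\<close>:
  6/7 for two triangles. If not, the triangle is alone and some corner pays: a long face, a pentagon
  flank, or between two quad flanks the opposite corner, which by \<open>no_T444\<close> is not a
  quad and is bad if a pentagon.\<close>

lemma run1_deg4:
  assumes d: "deg u = 4" and v: "adj u v" "len (u, v) = 3" and l: "len (u, px u v) \<noteq> 3" and r: "len (u, nx u v) \<noteq> 3"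
  shows "3/7 \<le> share u"
proof -
  obtain n2 n3 n0 where n: "nx u v = n2" "nx u n2 = n3" "nx u n3 = n0" "nx u n0 = v"
    "px u v = n0" "px u n2 = v" "px u n3 = n2" "px u n0 = n3"
    "adj u n2" "adj u n3" "adj u n0" "distinct [n0, v, n2, n3]"
    and surplus: "surplus u = wt (u, n0) + wt (u, v) + wt (u, n2) + wt (u, n3)" and N: "{w. adj u w} = {n0, v, n2, n3}"
    by (rule deg4_setup[OF d v(1)])
  note W = wt_long_deg4[OF d v]
  have t: "TC n0 u v" using corner_TC[OF v] n by simp
  show ?thesis
  proof (cases "len (u, n3) = 3")
    case True
    have "6 \<le> len (u, n2)" using sandwiched[OF n(9)] r n v True by simp
    moreover have "6 \<le> len (u, n0)" using sandwiched[OF n(11)] l n v True by simp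
    ultimately have s: "6/7 \<le> surplus u" using W[OF n(9)] W[OF n(11)] surplus wt_nonneg[of "(u, v)"] wt_nonneg[of "(u, n3)"] by simp
    have "tri u \<le> deg u - card {n2, n0}" by (rule tri_le) (use n l r in auto)
    then have "tri u \<le> 2" using d n by auto
    from share_ge[OF v this, of "3/7"] s show ?thesis by simp
  next
    case False
    have "tri u \<le> deg u - card {n2, n0, n3}" by (rule tri_le) (use n l r False in auto)
    then have t1: "tri u \<le> 1" using d n by auto
    have "3/7 \<le> wt (u, n0) + wt (u, n2) + wt (u, n3)"
    proof (cases "6 \<le> len (u, n0) \<or> 6 \<le> len (u, n2) \<or> 6 \<le> len (u, n3)")
      case True
      then show ?thesis using W[OF n(9)] W[OF n(10)] W[OF n(11)]
        wt_nonneg[of "(u, n0)"] wt_nonneg[of "(u, n2)"] wt_nonneg[of "(u, n3)"] by auto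
    next
      case F: False
      have len45: "len (u, n0) \<in> {4, 5}" "len (u, n2) \<in> {4, 5}" "len (u, n3) \<in> {4, 5}"
        using F False l r n len_ge_3[OF n(9)] len_ge_3[OF n(10)] len_ge_3[OF n(11)] by auto
      have "wt (u, n0) = 1/2 \<or> wt (u, n2) = 1/2 \<or> wt (u, n3) = 1/2"
      proof (cases "len (u, n0) = 5 \<or> len (u, n2) = 5")
        case True
        have "tri5 (u, n0)" "tri5 (u, n2)" using TC_len(3)[OF t] v(2) n(6) by (simp_all add: tri5_def)
        then show ?thesis using True by (auto simp: wt_def)
      next
        case 44: False
        then have q: "len (u, n0) = 4" "len (u, n2) = 4" using len45 by auto
        obtain m where m: "QC v u n2 m" using corner_QC[OF n(9) q(2)] n by auto
        obtain m'' where m'': "QC n3 u n0 m''" using corner_QC[OF n(11) q(1)] n by auto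
        have "len (u, n3) \<noteq> 4"
        proof
          assume "len (u, n3) = 4"
          from corner_QC[OF n(10) this] n no_T444[OF t m _ m''] show False by auto
        qed
        then have "len (u, n3) = 5" using len45 by auto
        moreover have "bad (u, n3)" using d q v n by (simp add: bad_def)
        ultimately show ?thesis by (simp add: wt_def)
      qed
      then show ?thesis using wt_nonneg[of "(u, n0)"] wt_nonneg[of "(u, n2)"] wt_nonneg[of "(u, n3)"] by auto
    qed
    then have "3/7 \<le> surplus u" using surplus wt_nonneg[of "(u, v)"] by linarith
    from share_ge[OF v t1, of "3/7"] this show ?thesis by simp
  qed
qed

text \<open>Any flank other than a quad pays at least 3/7, a pentagon because it borders a triangle,
  and two quad flanks are impossible. The surplus is divided by two.\<close>

lemma run2_deg4:
  assumes d: "deg u = 4" and v: "adj u v" "len (u, v) = 3" and r: "len (u, nx u v) = 3"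
    and l: "len (u, px u v) \<noteq> 3" and r2: "len (u, nx u (nx u v)) \<noteq> 3"
  shows "3/14 \<le> share u"
    "len (u, px u v) \<noteq> 4 \<Longrightarrow> len (u, nx u (nx u v)) \<noteq> 4 \<Longrightarrow> 3/7 \<le> share u"
proof -
  obtain n2 n3 n0 where n: "nx u v = n2" "nx u n2 = n3" "nx u n3 = n0" "nx u n0 = v"
    "px u v = n0" "px u n2 = v" "px u n3 = n2" "px u n0 = n3"
    "adj u n2" "adj u n3" "adj u n0" "distinct [n0, v, n2, n3]"
    and surplus: "surplus u = wt (u, n0) + wt (u, v) + wt (u, n2) + wt (u, n3)" and N: "{w. adj u w} = {n0, v, n2, n3}"
    by (rule deg4_setup[OF d v(1)])
  note W = wt_long_deg4[OF d v]
  have t: "TC n0 u v" "TC v u n2" using corner_TC[OF v] corner_TC[OF n(9)] r n by auto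
  have "tri u \<le> deg u - card {n3, n0}" by (rule tri_le) (use n l r2 in auto)
  then have t2: "tri u \<le> 2" using d n by auto
  have w0: "3/7 \<le> wt (u, n0)" if "len (u, n0) \<noteq> 4"
  proof (cases "len (u, n0) = 5")
    case True
    then show ?thesis using TC_len(3)[OF t(1)] n by (auto simp: wt_def tri5_def)
  next
    case False
    then have "6 \<le> len (u, n0)" using that l n len_ge_3[OF n(11)] by auto
    then show ?thesis using W[OF n(11)] by simp
  qed
  have w3: "3/7 \<le> wt (u, n3)" if "len (u, n3) \<noteq> 4"
  proof (cases "len (u, n3) = 5")
    case True
    then show ?thesis using r n by (auto simp: wt_def tri5_def)
  next
    case False
    then have "6 \<le> len (u, n3)" using that r2 n len_ge_3[OF n(10)] by auto
    then show ?thesis using W[OF n(10)] by simp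
  qed
  have nn: "0 \<le> wt (u, n0)" "0 \<le> wt (u, v)" "0 \<le> wt (u, n2)" "0 \<le> wt (u, n3)" by (rule wt_nonneg)+
  have "3/7 \<le> surplus u"
  proof (cases "len (u, n0) = 4 \<and> len (u, n3) = 4")
    case True
    obtain m where m: "QC n2 u n3 m" using corner_QC[OF n(10)] True n by auto
    obtain m' where "QC n3 u n0 m'" using corner_QC[OF n(11)] True n by auto
    then have False using kite_quad_other_flank(1)[OF t m] by blast
    then show ?thesis ..
  next
    case False
    then show ?thesis using w0 w3 nn surplus by linarith
  qed
  then show "3/14 \<le> share u" using share_ge[OF v t2, of "3/14"] by simp
  assume "len (u, px u v) \<noteq> 4" "len (u, nx u (nx u v)) \<noteq> 4"
  then have "len (u, n0) \<noteq> 4" "len (u, n3) \<noteq> 4" using n by auto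
  then have "6/7 \<le> surplus u" using w0 w3 nn surplus by linarith
  then show "3/7 \<le> share u" using share_ge[OF v t2, of "3/7"] by simp
qed

text \<open>The fourth corner lies between triangles, so its face is long; its 3/7 is divided by
  three.\<close>

lemma run3_deg4:
  assumes d: "deg u = 4" and v: "adj u v" "len (u, v) = 3" "len (u, nx u v) = 3" "len (u, nx u (nx u v)) = 3"
    and l: "len (u, px u v) \<noteq> 3"
  shows "1/7 \<le> share u"
proof -
  obtain n2 n3 n0 where n: "nx u v = n2" "nx u n2 = n3" "nx u n3 = n0" "nx u n0 = v"
    "px u v = n0" "px u n2 = v" "px u n3 = n2" "px u n0 = n3"
    "adj u n2" "adj u n3" "adj u n0" "distinct [n0, v, n2, n3]"
    and surplus: "surplus u = wt (u, n0) + wt (u, v) + wt (u, n2) + wt (u, n3)" and N: "{w. adj u w} = {n0, v, n2, n3}"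
    by (rule deg4_setup[OF d v(1)])
  have "6 \<le> len (u, n0)" using sandwiched[OF n(11)] l v n by simp
  then have "wt (u, n0) = 3/7" using wt_long_deg4[OF d v(1,2) n(11)] by simp
  then have s: "3/7 \<le> surplus u" using surplus wt_nonneg[of "(u, v)"] wt_nonneg[of "(u, n2)"] wt_nonneg[of "(u, n3)"] by linarith
  have "tri u \<le> deg u - card {n0}" by (rule tri_le) (use n l in auto)
  then have "tri u \<le> 3" using d by simp
  from share_ge[OF v(1,2) this, of "1/7"] s show ?thesis by simp
qed

end

section \<open>Shares of vertices of larger degree, and combined bounds\<close>

context rotation
begin

text \<open>Four consecutive triangles would close up to degree four, so any four consecutive
  corners include a non-triangle. A second search starting right after the first one found ends
  within four steps, short of a full turn.\<close>

lemma tri_le_deg_ge_5: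
  assumes d: "5 \<le> deg u" and v: "adj u v" shows "tri u \<le> deg u - 2"
proof -
  have ex: "\<exists>i<4. len (u, (nx u ^^ i) w) \<noteq> 3" if w: "adj u w" for w
  proof (rule ccontr)
    assume "\<not> ?thesis"
    then have l: "len (u, (nx u ^^ i) w) = 3" if "i < 4" for i using that by blast
    define n2 n3 n4 where "n2 = nx u w" and "n3 = nx u n2" and "n4 = nx u n3"
    have A: "adj u n2" "adj u n3" "adj u n4" using w nxE by (auto simp: n2_def n3_def n4_def)
    have L: "len (u, w) = 3" "len (u, n2) = 3" "len (u, n3) = 3" "len (u, n4) = 3"
      using l[of 0] l[of 1] l[of 2] l[of 3] by (auto simp: n2_def n3_def n4_def eval_nat_numeral)
    have p: "px u n2 = w" "px u n3 = n2" "px u n4 = n3"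
      using px_nx[OF w] px_nx[OF A(1)] px_nx[OF A(2)] by (auto simp: n2_def n3_def n4_def)
    have "n4 = px u w"
      using four_triangles_close[OF corner_TC[OF w L(1)] _ _ ] corner_TC[OF A(1) L(2)]
        corner_TC[OF A(2) L(3)] corner_TC[OF A(3) L(4)] p by simp
    then have "nx u n4 = w" using nx_px[OF w] by simp
    then have "(nx u ^^ 4) w = w" by (simp add: eval_nat_numeral n2_def n3_def n4_def)
    then have "deg u \<le> 4" using period_ge_deg[OF w, of 4] by (simp add: deg_def)
    then show False using d by simp
  qed
  obtain i where i: "len (u, (nx u ^^ i) v) \<noteq> 3" using ex[OF v] by blast
  define f where "f = (nx u ^^ i) v"
  have f: "adj u f" "len (u, f) \<noteq> 3" using nxk_E[OF v] i by (auto simp: f_def)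
  obtain j where j: "j < 4" "len (u, (nx u ^^ j) (nx u f)) \<noteq> 3" using ex[OF nxE[OF f(1)]] by blast
  define g where "g = (nx u ^^ j) (nx u f)"
  have g: "adj u g" "len (u, g) \<noteq> 3" using nxk_E[OF nxE[OF f(1)]] j by (auto simp: g_def)
  have "g = (nx u ^^ Suc j) f" by (simp add: g_def funpow_swap1)
  then have "f \<noteq> g" using nxk_distinct[OF f(1), of 0 "Suc j"] j d by (simp add: deg_def)
  moreover have "tri u \<le> deg u - card {f, g}" by (rule tri_le) (use f g in auto)
  ultimately show ?thesis by simp
qed

lemma surplus_ge_deg: "real (deg u) - 4 \<le> surplus u"
  using surplus_ge[of "{}" u] by simp

lemma share_ge_third:
  assumes d: "5 \<le> deg u" and v: "adj u v" "len (u, v) = 3" shows "1/3 \<le> share u"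
proof (rule share_ge[OF v tri_le_deg_ge_5[OF d v(1)]])
  show "1/3 * real (deg u - 2) \<le> surplus u" using surplus_ge_deg[of u] d by (simp add: of_nat_diff)
qed simp

text \<open>The worst case is degree five, \<open>(1 + 6/7) / 3 = 13/21\<close>.\<close>

lemma share_ge_rim:
  assumes d: "5 \<le> deg u" and v: "adj u v" "len (u, v) = 3"
    and f: "adj u f" "7 \<le> len (u, f)" and g: "adj u g" "7 \<le> len (u, g)" and fg: "f \<noteq> g"
  shows "13/21 \<le> share u"
proof (rule share_ge[OF v tri_le_deg_ge_5[OF d v(1)]])
  have "wt (u, f) = 3/7" "wt (u, g) = 3/7" using wt_long f g by auto
  then have "real (deg u) - 4 + 6/7 \<le> surplus u" using surplus_ge[of "{f, g}" u] f g fg by simp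
  then show "13/21 * real (deg u - 2) \<le> surplus u" using d by (simp add: of_nat_diff)
qed simp

text \<open>The two exceptional corners would be those of the bowtie, so the corners closing its
  loops are triangles. By \<open>centre_corners\<close> each loop then has a further neighbour of
  \<open>a\<close> inside, but degree five leaves only one.\<close>

lemma centre_deg5:
  assumes d: "deg a = 5" and b: "adj a b" "len (a, b) = 6" "centre (a, b)"
    and T: "\<And>w. adj a w \<Longrightarrow> len (a, w) \<noteq> 3 \<Longrightarrow> w \<in> {b, f}"
  shows False
proof -
  obtain c d' e where x: "distinct [b, c, d', e]" "adj a c" "adj a d'" "adj a e" "nx a e = b" "nx a c = d'"
    "len (a, d') = 6" "nx a b = c \<Longrightarrow> len (a, c) \<noteq> 3" "nx a d' = e \<Longrightarrow> len (a, e) \<noteq> 3"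
    using centre_corners[OF b] by metis
  have df: "d' = f" using T[OF x(3)] x(1,7) by auto
  have L: "len (a, c) = 3" "len (a, e) = 3" using T[OF x(2)] T[OF x(4)] x(1) df by auto
  have ne: "nx a b \<noteq> c" "nx a d' \<noteq> e" using L x(8,9) by auto
  have N: "{w. adj a w} \<subseteq> {b, c, d', e} \<union> ({w. adj a w} - {b, c, d', e})" by auto
  have "card ({w. adj a w} - {b, c, d', e}) = deg a - card {b, c, d', e}"
    unfolding deg_def by (rule card_Diff_subset) (use x b in auto)
  also have "\<dots> = 1" using d x(1) by simp
  finally obtain h where h: "{w. adj a w} - {b, c, d', e} = {h}" by (auto simp: card_1_singleton_iff)
  have bx: "nx a b \<notin> {b, c, d', e}"
    using ne nx_ne(1)[OF b(1)] nx2[OF x(4,5)] nx_inj[OF b(1) x(2)] x by auto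
  have dx: "nx a d' \<notin> {b, c, d', e}"
    using ne nx_ne(1)[OF x(3)] nx2[OF x(2,6)] nx_inj[OF x(3) x(4)] x by auto
  have "nx a b = h" "nx a d' = h" using h bx dx nxE[OF b(1)] nxE[OF x(3)] by blast+
  then show False using nx_inj[OF b(1) x(3)] x(1) by auto
qed

lemma deg5_cyc:
  assumes v: "adj u v" and d: "deg u = 5"
  shows "nx u (nx u (nx u (nx u (nx u v)))) = v"
    "{w. adj u w} = {v, nx u v, nx u (nx u v), nx u (nx u (nx u v)), nx u (nx u (nx u (nx u v)))}"
    "distinct [v, nx u v, nx u (nx u v), nx u (nx u (nx u v)), nx u (nx u (nx u (nx u v)))]"
proof -
  have 5: "(nx u ^^ 5) v = v" using deg_bij(2)[OF v] d by (simp add: deg_def)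
  then show "nx u (nx u (nx u (nx u (nx u v)))) = v" by (simp add: eval_nat_numeral)
  have "{w. adj u w} = (\<lambda>i. (nx u ^^ i) v) ` {..<5}" by (rule nbrs_period[OF v _ 5]) simp
  also have "{..<5} = {0, 1, 2, 3, 4::nat}" by auto
  finally show N: "{w. adj u w} = {v, nx u v, nx u (nx u v), nx u (nx u (nx u v)), nx u (nx u (nx u (nx u v)))}"
    by (simp add: eval_nat_numeral)
  have "card (set [v, nx u v, nx u (nx u v), nx u (nx u (nx u v)), nx u (nx u (nx u (nx u v)))]) = 5"
    using d N by (simp add: deg_def)
  then show "distinct [v, nx u v, nx u (nx u v), nx u (nx u (nx u v)), nx u (nx u (nx u (nx u v)))]"
    by (intro card_distinct) simp
qed

text \<open>From degree six on, \<open>(d - 4) / (d - 2)\<close> suffices. At degree five, three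
  non-triangles leave surplus 1 for two triangles; with just two, the missing run of three puts both
  between triangles, so they are long, are no bowtie centres and raise the surplus to 13/7 for three
  triangles.\<close>

lemma share_ge_half:
  assumes d: "5 \<le> deg u" and v: "adj u v" "len (u, v) = 3"
    and run: "\<not> (len (u, px u v) = 3 \<and> len (u, nx u v) = 3)" "\<not> (len (u, nx u v) = 3 \<and> len (u, nx u (nx u v)) = 3)"
      "\<not> (len (u, px u v) = 3 \<and> len (u, px u (px u v)) = 3)"
  shows "1/2 \<le> share u"
proof (cases "deg u = 5")
  case False
  show ?thesis
  proof (rule share_ge[OF v tri_le_deg_ge_5[OF d v(1)]])
    show "1/2 * real (deg u - 2) \<le> surplus u" using surplus_ge_deg[of u] d False by (simp add: of_nat_diff)
  qed simp
next
  case True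
  define n1 n2 n3 n4 where "n1 = nx u v" and "n2 = nx u n1" and "n3 = nx u n2" and "n4 = nx u n3"
  have c5: "nx u n4 = v" and N: "{w. adj u w} = {v, n1, n2, n3, n4}" and D: "distinct [v, n1, n2, n3, n4]"
    using deg5_cyc[OF v(1) True] by (auto simp: n1_def n2_def n3_def n4_def)
  have A: "adj u n1" "adj u n2" "adj u n3" "adj u n4"
    using v nxE by (auto simp: n1_def n2_def n3_def n4_def)
  have P: "px u v = n4" "px u n1 = v" "px u n2 = n1" "px u n3 = n2" "px u n4 = n3"
    using px_nx[OF v(1)] px_nx[OF A(1)] px_nx[OF A(2)] px_nx[OF A(3)] px_nx[OF A(4)] c5
    by (auto simp: n1_def n2_def n3_def n4_def)
  have X: "nx u v = n1" "nx u n1 = n2" "nx u n2 = n3" "nx u n3 = n4"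
    by (simp_all add: n1_def n2_def n3_def n4_def)
  have R: "\<not> (len (u, n4) = 3 \<and> len (u, n1) = 3)" "\<not> (len (u, n1) = 3 \<and> len (u, n2) = 3)"
      "\<not> (len (u, n4) = 3 \<and> len (u, n3) = 3)"
    using run by (simp_all add: P X)
  have three: ?thesis if "f \<noteq> g" "f \<noteq> h" "g \<noteq> h" "{f, g, h} \<subseteq> {w. adj u w \<and> len (u, w) \<noteq> 3}" for f g h
  proof -
    have "tri u \<le> deg u - card {f, g, h}" by (rule tri_le) (rule that(4))
    then have "tri u \<le> 2" using True that by simp
    from share_ge[OF v this, of "1/2"] surplus_ge_deg[of u] True show ?thesis by simp
  qed
  have two: ?thesis
    if "f \<noteq> g" "adj u f" "adj u g" "len (u, f) \<noteq> 3" "len (u, g) \<noteq> 3"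
      "len (u, px u f) = 3" "len (u, nx u f) = 3" "len (u, px u g) = 3" "len (u, nx u g) = 3"
      "\<And>w. adj u w \<Longrightarrow> len (u, w) \<noteq> 3 \<Longrightarrow> w \<in> {f, g}" for f g
  proof -
    have "6 \<le> len (u, f)" "6 \<le> len (u, g)" using sandwiched that by auto
    moreover have "\<not> (len (u, f) = 6 \<and> centre (u, f))" using centre_deg5[OF True that(2) _ _ that(10)] by blast
    moreover have "\<not> (len (u, g) = 6 \<and> centre (u, g))"
      using centre_deg5[OF True that(3), of f] that(10) by (auto simp: insert_commute)
    ultimately have "wt (u, f) = 3/7" "wt (u, g) = 3/7" using wt_long by blast+
    then have s: "13/7 \<le> surplus u" using surplus_ge[of "{f, g}" u] that(1-3) True by simp
    have "tri u \<le> deg u - 2" by (rule tri_le_deg_ge_5[OF d v(1)])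
    then have "tri u \<le> 3" using True by simp
    from share_ge[OF v this, of "1/2"] s show ?thesis by simp
  qed
  have W: "w \<in> {v, n1, n2, n3, n4}" if "adj u w" for w using N that by blast
  show ?thesis
  proof (cases "len (u, n1) = 3")
    case 1: True
    then have F: "len (u, n4) \<noteq> 3" "len (u, n2) \<noteq> 3" using R by auto
    show ?thesis
    proof (cases "len (u, n3) = 3")
      case 3: True
      show ?thesis by (rule two[of n2 n4]) (use 1 3 F A P X c5 v D W in auto)
    next
      case False
      show ?thesis by (rule three[of n2 n3 n4]) (use False F A D in auto)
    qed
  next
    case 1: False
    show ?thesis
    proof (cases "len (u, n4) = 3")
      case 4: True
      then have F: "len (u, n3) \<noteq> 3" using R by auto
      show ?thesis
      proof (cases "len (u, n2) = 3")
        case 2: True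
        show ?thesis by (rule two[of n1 n3]) (use 1 2 4 F A P X c5 v D W in auto)
      next
        case False
        show ?thesis by (rule three[of n1 n2 n3]) (use 1 False F A D in auto)
      qed
    next
      case 4: False
      show ?thesis
      proof (cases "len (u, n2) = 3 \<and> len (u, n3) = 3")
        case 23: True
        show ?thesis by (rule two[of n1 n4]) (use 1 4 23 A P X c5 v D W in auto)
      next
        case False
        then consider "len (u, n2) \<noteq> 3" | "len (u, n3) \<noteq> 3" by blast
        then show ?thesis
        proof cases
          case 1 show ?thesis by (rule three[of n1 n2 n4]) (use \<open>len (u, n1) \<noteq> 3\<close> 1 4 A D in auto)
        next
          case 2 show ?thesis by (rule three[of n1 n3 n4]) (use \<open>len (u, n1) \<noteq> 3\<close> 2 4 A D in auto)
        qed
      qed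
    qed
  qed
qed

lemma deg_cases: "adj u v \<Longrightarrow> deg u = 4 \<or> 5 \<le> deg u"
  using deg_ge[of u v] by linarith

lemma run1:
  assumes v: "adj u v" "len (u, v) = 3" and l: "len (u, px u v) \<noteq> 3" and r: "len (u, nx u v) \<noteq> 3"
  shows "3/7 \<le> share u" "5 \<le> deg u \<Longrightarrow> 1/2 \<le> share u"
proof -
  show *: "1/2 \<le> share u" if "5 \<le> deg u" by (rule share_ge_half[OF that v]) (use l r in auto)
  show "3/7 \<le> share u" using run1_deg4[OF _ v l r] * deg_cases[OF v(1)] by fastforce
qed

lemma run2:
  assumes v: "adj u v" "len (u, v) = 3" and r: "len (u, nx u v) = 3"
    and l: "len (u, px u v) \<noteq> 3" and r2: "len (u, nx u (nx u v)) \<noteq> 3"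
  shows "3/14 \<le> share u" "5 \<le> deg u \<Longrightarrow> 1/2 \<le> share u"
    "len (u, px u v) \<noteq> 4 \<Longrightarrow> len (u, nx u (nx u v)) \<noteq> 4 \<Longrightarrow> 3/7 \<le> share u"
proof -
  show *: "1/2 \<le> share u" if "5 \<le> deg u" by (rule share_ge_half[OF that v]) (use l r r2 in auto)
  show "3/14 \<le> share u" using run2_deg4(1)[OF _ v r l r2] * deg_cases[OF v(1)] by fastforce
  show "3/7 \<le> share u" if "len (u, px u v) \<noteq> 4" "len (u, nx u (nx u v)) \<noteq> 4"
    using run2_deg4(2)[OF _ v r l r2] * deg_cases[OF v(1)] that by fastforce
qed

lemma run3:
  assumes v: "adj u v" "len (u, v) = 3" "len (u, nx u v) = 3" "len (u, nx u (nx u v)) = 3"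
    and l: "deg u = 4 \<Longrightarrow> len (u, px u v) \<noteq> 3"
  shows "1/7 \<le> share u" "5 \<le> deg u \<Longrightarrow> 1/3 \<le> share u"
proof -
  show *: "1/3 \<le> share u" if "5 \<le> deg u" by (rule share_ge_third[OF that v(1,2)])
  show "1/7 \<le> share u" using run3_deg4[OF _ v] l * deg_cases[OF v(1)] by fastforce
qed

lemma TC_corners:
  assumes "TC x a y"
  shows "adj a y" "adj y x" "adj x a" "adj a x" "adj y a" "adj x y"
    "px a y = x" "px y x = a" "px x a = y" "nx a x = y" "nx y a = x" "nx x y = a"
    "len (a, y) = 3" "len (y, x) = 3" "len (x, a) = 3"
    "len (a, nx a y) = len (y, a)" "len (y, nx y x) = len (x, y)" "len (x, nx x a) = len (a, x)"
  using TCD[OF assms] TCN[OF assms] TC_len[OF assms] TC_len(4)[OF TC_rot[OF assms]]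
    TC_len(4)[OF TC_rot[OF TC_rot[OF assms]]] len_next by auto

text \<open>A share below 3/7 means a quad flank at \<open>u\<close>, and then
  \<open>kite_quad_far\<close> forbids quad flanks at \<open>n1\<close>. So the two ends of the
  common edge are never both poor.\<close>

lemma kite_share:
  assumes t: "TC n0 u n1" "TC n1 u n2" and l: "len (u, n0) \<noteq> 3" and r: "len (u, nx u n2) \<noteq> 3"
  shows "3/14 \<le> share u" "share u < 3/7 \<Longrightarrow> len (n1, n2) \<noteq> 4 \<and> len (n1, nx n1 n0) \<noteq> 4"
proof -
  note A = TC_corners[OF t(1)] and B = TC_corners[OF t(2)]
  have h: "adj u n1" "len (u, n1) = 3" "len (u, nx u n1) = 3" "len (u, px u n1) \<noteq> 3"
    "len (u, nx u (nx u n1)) \<noteq> 3" using A B l r by auto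
  show "3/14 \<le> share u" by (rule run2(1)[OF h])
  have far: "len (n1, n2) \<noteq> 4 \<and> len (n1, nx n1 n0) \<noteq> 4" if q: "\<And>m'. (\<exists>c. QC c n1 n2 m') \<Longrightarrow> False"
    "\<And>m' c. QC n0 n1 c m' \<Longrightarrow> False"
  proof
    show "len (n1, n2) \<noteq> 4" using corner_QC[of n1 n2] B q(1) by blast
    show "len (n1, nx n1 n0) \<noteq> 4"
    proof
      assume "len (n1, nx n1 n0) = 4"
      from corner_QC[OF _ this] nxE[of n1 n0] px_nx[of n1 n0] A q(2) show False by auto
    qed
  qed
  assume "share u < 3/7"
  then have "len (u, n0) = 4 \<or> len (u, nx u n2) = 4" using run2(3)[OF h] A B by force
  then show "len (n1, n2) \<noteq> 4 \<and> len (n1, nx n1 n0) \<noteq> 4"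
  proof
    assume "len (u, nx u n2) = 4"
    from corner_QC[OF _ this] nxE[of u n2] px_nx[of u n2] B obtain m where "QC n2 u (nx u n2) m" by auto
    note far' = kite_quad_far[OF t this]
    show ?thesis by (rule far) (use far' in blast)+
  next
    assume "len (u, n0) = 4"
    from corner_QC[OF _ this] A obtain m where q: "QC (px u n0) u n0 m" by auto
    note far' = rotation.kite_quad_far[OF mirror, unfolded TC_mirror QC_mirror PC_mirror, OF t(2,1) q]
    show ?thesis by (rule far) (use far' in blast)+
  qed
qed

text \<open>The run at an inner rim vertex consists of two triangles of the fan, and its flanks are
  faces across rim edges, none of them a quad.\<close>

lemma fan_rim1:
  assumes t: "TC n0 v n1" "TC n1 v n2" "TC n2 v n3"
  shows "3/7 \<le> share n1" "5 \<le> deg n1 \<Longrightarrow> 1/2 \<le> share n1" "len (n1, n2) \<noteq> 3"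
proof -
  note A = TC_corners[OF t(1)] and B = TC_corners[OF t(2)] and C = TC_corners[OF t(3)]
  have m: "len (n1, n2) \<noteq> 3" "len (n1, n2) \<noteq> 4"
    using fan_rim_middle[OF t] TC_rot[OF corner_TC[of n1 n2]] corner_QC[of n1 n2] QC_rot[of _ n1 n2] B by blast+
  have e: "len (n0, n1) \<noteq> 3" "len (n0, n1) \<noteq> 4"
    using fan_rim_end[OF t] TC_rot[OF corner_TC[of n0 n1]] corner_QC[of n0 n1] QC_rot[of _ n0 n1] A by blast+
  have h: "adj n1 v" "len (n1, v) = 3" "len (n1, nx n1 v) = 3" "len (n1, px n1 v) \<noteq> 3"
    "len (n1, nx n1 (nx n1 v)) \<noteq> 3" using A B m e by auto
  show "3/7 \<le> share n1" by (rule run2(3)[OF h]) (use A B m e in auto)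
  show "5 \<le> deg n1 \<Longrightarrow> 1/2 \<le> share n1" by (rule run2(2)[OF h])
  show "len (n1, n2) \<noteq> 3" by (rule m(1))
qed

lemma fan_rim2:
  assumes t: "TC n0 v n1" "TC n1 v n2" "TC n2 v n3"
  shows "3/7 \<le> share n2" "5 \<le> deg n2 \<Longrightarrow> 1/2 \<le> share n2" "len (n2, n3) \<noteq> 3" "len (n0, n1) \<noteq> 3"
proof -
  note A = TC_corners[OF t(1)] and B = TC_corners[OF t(2)] and C = TC_corners[OF t(3)]
  have m: "len (n1, n2) \<noteq> 3" "len (n1, n2) \<noteq> 4"
    using fan_rim_middle[OF t] TC_rot[OF corner_TC[of n1 n2]] corner_QC[of n1 n2] QC_rot[of _ n1 n2] B by blast+
  have e: "len (n2, n3) \<noteq> 3" "len (n2, n3) \<noteq> 4"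
    using fan_rim_end'[OF t] corner_TC[of n2 n3] corner_QC[of n2 n3] C by blast+
  show "len (n0, n1) \<noteq> 3" using fan_rim_end[OF t] TC_rot[OF corner_TC[of n0 n1]] A by blast
  have h: "adj n2 v" "len (n2, v) = 3" "len (n2, nx n2 v) = 3" "len (n2, px n2 v) \<noteq> 3"
    "len (n2, nx n2 (nx n2 v)) \<noteq> 3" using C B m e by auto
  show "3/7 \<le> share n2" by (rule run2(3)[OF h]) (use C B m e in auto)
  show "5 \<le> deg n2 \<Longrightarrow> 1/2 \<le> share n2" by (rule run2(2)[OF h])
  show "len (n2, n3) \<noteq> 3" by (rule e(1))
qed

end

section \<open>Charges of the triangles\<close>

locale rotation_no_kite = rotation +
  assumes no_kite4: "\<lbrakk>distinct [x, y, z, w]; (x, z) \<in> E; (x, w) \<in> E; (y, z) \<in> E; (y, w) \<in> E; (z, w) \<in> E;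
      (x, y) \<notin> E; card {v. (x, v) \<in> E} = 4; card {v. (y, v) \<in> E} = 4; card {v. (z, v) \<in> E} = 4;
      card {v. (w, v) \<in> E} = 4\<rbrakk> \<Longrightarrow> False"
begin

lemma kite_deg:
  assumes t: "TC n0 u n1" "TC n1 u n2" and na: "\<not> adj n0 n2" and d: "deg u = 4"
  shows "5 \<le> deg n0 \<or> 5 \<le> deg n1 \<or> 5 \<le> deg n2"
proof (rule ccontr)
  assume n: "\<not> ?thesis"
  note A = TC_corners[OF t(1)] and B = TC_corners[OF t(2)]
  have "deg n0 = 4" "deg n1 = 4" "deg n2 = 4"
    using n deg_cases[OF A(3)] deg_cases[OF B(3)] deg_cases[OF B(2)] by auto
  moreover have "n0 \<noteq> n2" using nx_ne(2)[of u n0] A B by auto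
  then have "distinct [n0, n2, u, n1]" using TCD[OF t(1)] TCD[OF t(2)] by auto
  ultimately show False using no_kite4[of n0 n2 u n1] A B na d by (simp add: deg_def)
qed

definition hub :: "'a \<Rightarrow> bool" where
  "hub u \<longleftrightarrow> deg u = 4 \<and> (\<forall>v. adj u v \<longrightarrow> len (u, v) = 3)"

text \<open>This concerns the triangle at the corner of \<open>u\<close> before \<open>v\<close>,
  whose rim vertices are \<open>px u v\<close> and \<open>v\<close>.\<close>

definition lowrim :: "'a \<Rightarrow> 'a \<Rightarrow> bool" where
  "lowrim u v \<longleftrightarrow> deg v = 4 \<and> deg (px u v) = 4"

text \<open>Around the hub of a wheel, a triangle both of whose rim vertices have degree 4 is helped by the opposite one.\<close>

definition transfer :: "'a \<Rightarrow> 'a \<Rightarrow> real" where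
  "transfer u v = (if hub u then (of_bool (lowrim u v) - of_bool (lowrim u (nx u (nx u v)))) / 7 else 0)"

definition charge :: "'a \<Rightarrow> 'a \<Rightarrow> 'a \<Rightarrow> real" where
  "charge x a y = (share a + transfer a y) + (share y + transfer y x) + (share x + transfer x a)"

lemma charge_rot: "charge x a y = charge a y x"
  by (simp add: charge_def)

lemma transfer_eq_0: "adj u w \<Longrightarrow> len (u, w) \<noteq> 3 \<Longrightarrow> transfer u v = 0"
  by (auto simp: transfer_def hub_def)

text \<open>The triangle is a run of its own at each corner, which gives
  \<open>3 * 3/7 = 9/7\<close>.\<close>

lemma charge_no_neighbour:
  assumes t: "TC x a y" and f: "len (y, a) \<noteq> 3" "len (x, y) \<noteq> 3" "len (a, x) \<noteq> 3"
  shows "1 < charge x a y"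
proof -
  note A = TC_corners[OF t]
  have "3/7 \<le> share a" "3/7 \<le> share y" "3/7 \<le> share x"
    using run1(1)[of a y] run1(1)[of y x] run1(1)[of x a] A f by auto
  moreover have "transfer a y = 0" "transfer y x = 0" "transfer x a = 0"
    using transfer_eq_0[of a x] transfer_eq_0[of y a] transfer_eq_0[of x y] A f by auto
  ultimately show ?thesis by (simp add: charge_def)
qed

text \<open>The amounts are 1/7 from \<open>v\<close>, 3/7 from the inner rim vertex
  \<open>n1\<close>, and 3/7 from \<open>n0\<close>, where the triangle is a run of its own. They
  sum to exactly 1, and any vertex of larger degree gives more.\<close>

lemma charge_fan_start:
  assumes t: "TC n0 v n1" "TC n1 v n2" "TC n2 v n3" and l: "len (v, n0) \<noteq> 3"
  shows "1 \<le> charge n0 v n1" "5 \<le> deg v \<or> 5 \<le> deg n0 \<or> 5 \<le> deg n1 \<Longrightarrow> 1 < charge n0 v n1"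
proof -
  note A = TC_corners[OF t(1)] and B = TC_corners[OF t(2)] and C = TC_corners[OF t(3)]
  note r1 = fan_rim1[OF t] and r2 = fan_rim2[OF t]
  have h: "adj v n1" "len (v, n1) = 3" "len (v, nx v n1) = 3" "len (v, nx v (nx v n1)) = 3" "len (v, px v n1) \<noteq> 3"
    using A B C l by auto
  note cv = run3[OF h(1-4)]
  have s: "adj n0 v" "len (n0, v) = 3" "len (n0, px n0 v) \<noteq> 3" "len (n0, nx n0 v) \<noteq> 3" using A r2 l by auto
  note c0 = run1[OF s]
  have "transfer v n1 = 0" "transfer n1 n0 = 0" "transfer n0 v = 0"
    using transfer_eq_0[of v n0] transfer_eq_0[of n1 n2] transfer_eq_0[of n0 n1] A B l r1 r2 by auto
  then have charge: "charge n0 v n1 = share v + share n1 + share n0" by (simp add: charge_def)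
  show "1 \<le> charge n0 v n1" using cv(1) h(5) c0(1) r1(1) unfolding charge by simp
  assume "5 \<le> deg v \<or> 5 \<le> deg n0 \<or> 5 \<le> deg n1"
  then show "1 < charge n0 v n1" using cv h(5) c0 r1 unfolding charge by auto
qed

lemma charge_fan_end:
  assumes t: "TC n0 v n1" "TC n1 v n2" "TC n2 v n3" and l: "len (v, nx v n3) \<noteq> 3"
  shows "1 \<le> charge n2 v n3" "5 \<le> deg v \<or> 5 \<le> deg n2 \<or> 5 \<le> deg n3 \<Longrightarrow> 1 < charge n2 v n3"
proof -
  note A = TC_corners[OF t(1)] and B = TC_corners[OF t(2)] and C = TC_corners[OF t(3)]
  note r1 = fan_rim1[OF t] and r2 = fan_rim2[OF t]
  have h: "adj v n1" "len (v, n1) = 3" "len (v, nx v n1) = 3" "len (v, nx v (nx v n1)) = 3"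
    using A B C by auto
  \<comment> \<open>At degree four the corner after the last triangle is also the corner before the
    first one.\<close>
  have h5: "len (v, px v n1) \<noteq> 3" if d: "deg v = 4"
  proof -
    have "nx v (nx v (nx v (nx v n0))) = n0" using deg4_cyc(1)[OF _ d] A by blast
    then have "nx v n3 = n0" using A B C by simp
    then show ?thesis using l A by simp
  qed
  note cv = run3[OF h h5]
  have s: "adj n3 n2" "len (n3, n2) = 3" "len (n3, px n3 n2) \<noteq> 3" "len (n3, nx n3 n2) \<noteq> 3" using C r2 l by auto
  note c3 = run1[OF s]
  have n3: "adj v (nx v n3)" using nxE C by blast
  have "transfer v n3 = 0" "transfer n3 n2 = 0" "transfer n2 v = 0"
    using transfer_eq_0[OF n3 l] transfer_eq_0[of n3 v] transfer_eq_0[of n2 n3] s C r2 by auto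
  then have charge: "charge n2 v n3 = share v + share n3 + share n2" by (simp add: charge_def)
  show "1 \<le> charge n2 v n3" using cv(1) c3(1) r2(1) unfolding charge by simp
  assume "5 \<le> deg v \<or> 5 \<le> deg n2 \<or> 5 \<le> deg n3"
  then show "1 < charge n2 v n3" using cv c3 r2 unfolding charge by auto
qed

text \<open>Both rim vertices are inner ones, so again \<open>1/7 + 3/7 + 3/7 = 1\<close>.\<close>

lemma charge_fan_middle:
  assumes t: "TC n0 v n1" "TC n1 v n2" "TC n2 v n3" and l: "deg v = 4 \<Longrightarrow> len (v, n0) \<noteq> 3"
  shows "1 \<le> charge n1 v n2" "5 \<le> deg v \<or> 5 \<le> deg n1 \<or> 5 \<le> deg n2 \<Longrightarrow> 1 < charge n1 v n2"
proof -
  note A = TC_corners[OF t(1)] and B = TC_corners[OF t(2)] and C = TC_corners[OF t(3)]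
  note r1 = fan_rim1[OF t] and r2 = fan_rim2[OF t]
  have h: "adj v n1" "len (v, n1) = 3" "len (v, nx v n1) = 3" "len (v, nx v (nx v n1)) = 3"
      "deg v = 4 \<Longrightarrow> len (v, px v n1) \<noteq> 3"
    using A B C l by auto
  note cv = run3[OF h]
  have "transfer v n2 = 0"
  proof (cases "deg v = 4")
    case True
    then show ?thesis using transfer_eq_0[of v n0] l A by auto
  qed (simp add: transfer_def hub_def)
  moreover have "transfer n1 v = 0" "transfer n2 n1 = 0"
    using transfer_eq_0[of n1 n2] transfer_eq_0[of n2 n3] B C r1 r2 by auto
  ultimately have charge: "charge n1 v n2 = share v + share n1 + share n2" by (simp add: charge_def)
  show "1 \<le> charge n1 v n2" using cv(1) r1(1) r2(1) unfolding charge by simp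
  assume "5 \<le> deg v \<or> 5 \<le> deg n1 \<or> 5 \<le> deg n2"
  then show "1 < charge n1 v n2" using cv r1 r2 unfolding charge by auto
qed

text \<open>Lengths up to five are excluded as for any fan. A face of length six would be a bowtie,
  and whichever antipodal pair coincides, \<open>n0\<close> and \<open>n1\<close> get a common
  neighbour besides the hub.\<close>

lemma wheel_face:
  assumes t: "TC n0 v n1" "TC n1 v n2" "TC n2 v n3" "TC n3 v n0" shows "7 \<le> len (n0, n1)"
proof -
  note A = TC_corners[OF t(1)]
  note d = TCD[OF t(1)] and e = TCN[OF t(1)]
  note f = fan_rim_end[OF t(1-3)]
  have "len (n0, n1) \<noteq> 3" using f(1) TC_rot[OF corner_TC[of n0 n1]] A by blast
  moreover have "len (n0, n1) \<noteq> 4" using f(2) corner_QC[of n0 n1] QC_rot[of _ n0 n1] A by blast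
  moreover have "len (n0, n1) \<noteq> 5" using f(3) corner_PC[of n0 n1] PC_rot[of _ n0 n1] A by blast
  moreover have "len (n0, n1) \<noteq> 6"
  proof
    assume l: "len (n0, n1) = 6"
    have a01: "adj n0 n1" using A by simp
    obtain p q r s where w: "nx n1 n0 = p" "nx p n1 = q" "nx q p = r" "nx r q = s" "nx s r = n0" "nx n0 s = n1"
      "adj n1 p" "adj p q" "adj q r" "adj r s" "adj s n0"
      by (rule hexagon_walk[OF a01 l])
    have pv: "p \<noteq> v" using nx2[of n1 n0 v] e w A by auto
    have sv: "s \<noteq> v" using nx2[of n0 v n1] e w A by auto
    note m = wheel_common_nbr[OF t]
    have "centre (n0, n1) \<or> centre (fc (n0, n1)) \<or> centre (fc (fc (n0, n1)))" by (rule hexagon_centre[OF a01 l])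
    then have "q = n0 \<or> r = n1 \<or> s = p" using w by (auto simp: centre_def eval_nat_numeral)
    then show False using m[of p] m[of s] w pv sv Esym by auto
  qed
  ultimately show ?thesis using len_ge_3[of n0 n1] A by linarith
qed

text \<open>The faces across both rim edges at \<open>n1\<close> have length at least seven and meet
  \<open>n1\<close> at two different corners.\<close>

lemma wheel_rim:
  assumes t: "TC n0 v n1" "TC n1 v n2" "TC n2 v n3" "TC n3 v n0" shows "5 \<le> deg n1 \<Longrightarrow> 13/21 \<le> share n1"
proof -
  assume d: "5 \<le> deg n1"
  note A = TC_corners[OF t(1)] and B = TC_corners[OF t(2)]
  have l: "7 \<le> len (n0, n1)" "7 \<le> len (n1, n2)" using wheel_face t by blast+
  have e: "adj n1 (nx n1 n0)" using nxE A by blast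
  show ?thesis
  proof (rule share_ge_rim[OF d, of v n2 "nx n1 n0"])
    show "n2 \<noteq> nx n1 n0"
    proof
      assume "n2 = nx n1 n0"
      then show False using nx3[of n1 n0 n2 v] A B by auto
    qed
    show "7 \<le> len (n1, nx n1 n0)" using len_next[of n0 n1] l A by simp
  qed (use A B l e in auto)
qed

text \<open>The hub is credited with nothing. Two rim vertices of degree four give only 6/7; but
  then \<open>kite_deg\<close> makes both other rim vertices large, and their triangle, having
  \<open>2 * 13/21\<close>, can spare the missing 1/7. One large rim vertex suffices by itself, as
  \<open>13/21 + 3/7 > 1\<close>.\<close>

lemma charge_wheel:
  assumes t: "TC n0 v n1" "TC n1 v n2" "TC n2 v n3" "TC n3 v n0"
  shows "1 \<le> charge n1 v n2" "deg n1 \<noteq> 4 \<or> deg n2 \<noteq> 4 \<Longrightarrow> 1 < charge n1 v n2"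
proof -
  note A = TC_corners[OF t(1)] and B = TC_corners[OF t(2)] and C = TC_corners[OF t(3)] and D = TC_corners[OF t(4)]
  note r1 = fan_rim1[OF t(1-3)] and r2 = fan_rim2[OF t(1-3)]
  have rim1: "5 \<le> deg n1 \<Longrightarrow> 13/21 \<le> share n1" and rim2: "5 \<le> deg n2 \<Longrightarrow> 13/21 \<le> share n2"
    using wheel_rim t by blast+
  have d4: "deg v = 4"
  proof -
    have "(nx v ^^ 4) n0 = n0" using A B C D by (simp add: eval_nat_numeral)
    then have "deg v \<le> 4" using period_ge_deg[of v n0 4] A by (simp add: deg_def)
    then show ?thesis using deg_ge[of v n0] A by simp
  qed
  have nn: "nx v n0 = n1" "nx v n1 = n2" "nx v n2 = n3" using A B C by simp_all
  have "{w. adj v w} = {n0, n1, n2, n3}" using deg4_cyc(3)[of v n0, unfolded nn] A(4) d4 by simp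
  then have "w \<in> {n0, n1, n2, n3}" if "adj v w" for w using that by blast
  moreover have "len (v, n0) = 3" "len (v, n1) = 3" "len (v, n2) = 3" "len (v, n3) = 3"
    using A B C D by simp_all
  ultimately have "len (v, w) = 3" if "adj v w" for w using that by blast
  then have "hub v" unfolding hub_def using d4 by blast
  then have xv: "transfer v n2 = (of_bool (deg n2 = 4 \<and> deg n1 = 4) - of_bool (deg n0 = 4 \<and> deg n3 = 4)) / 7"
    using A B C D by (simp add: transfer_def lowrim_def)
  have cv: "0 \<le> share v" using surplus_ge_deg[of v] d4 by (simp add: share_def)
  have "transfer n1 v = 0" "transfer n2 n1 = 0"
    using transfer_eq_0[of n1 n2] transfer_eq_0[of n2 n3] B C r1 r2 by auto
  then have charge: "charge n1 v n2 = share v + share n1 + share n2 + (of_bool (deg n2 = 4 \<and> deg n1 = 4) - of_bool (deg n0 = 4 \<and> deg n3 = 4)) / 7"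
    by (simp add: charge_def xv)
  have ch: "\<not> adj n0 n2" "\<not> adj n1 n3" "\<not> adj n2 n0" "\<not> adj n3 n1"
    using wheel_no_chord t by blast+
  note k = kite_deg[OF t(1,2) ch(1) d4] kite_deg[OF t(2,3) ch(2) d4] kite_deg[OF t(3,4) ch(3) d4]
    kite_deg[OF t(4,1) ch(4) d4]
  have dc: "deg n1 = 4 \<or> 5 \<le> deg n1" "deg n2 = 4 \<or> 5 \<le> deg n2"
    using deg_cases[of n1 v] deg_cases[of n2 v] A B by auto
  show *: "1 < charge n1 v n2" if "deg n1 \<noteq> 4 \<or> deg n2 \<noteq> 4"
  proof (cases "deg n0 = 4 \<and> deg n3 = 4")
    case True
    then have "5 \<le> deg n2" "5 \<le> deg n1" using k by auto
    then show ?thesis using rim1 rim2 cv True unfolding charge by simp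
  next
    case False
    then have z: "(of_bool (deg n0 = 4 \<and> deg n3 = 4) :: real) = 0" by simp
    have "share v + share n1 + share n2 \<le> charge n1 v n2" unfolding charge z by simp
    moreover have "13/21 \<le> share n1 \<or> 13/21 \<le> share n2" using dc that rim1 rim2 by blast
    ultimately show ?thesis using cv r1(1) r2(1) by linarith
  qed
  show "1 \<le> charge n1 v n2"
  proof (cases "deg n1 = 4 \<and> deg n2 = 4")
    case True
    then have "\<not> (deg n0 = 4 \<and> deg n3 = 4)" using k by auto
    then have "charge n1 v n2 = share v + share n1 + share n2 + 1 / 7" unfolding charge using True by auto
    then show ?thesis using cv r1(1) r2(1) by linarith
  next
    case False
    then show ?thesis using * by auto
  qed
qed

text \<open>Marks the situation in which a charge may be exactly 1; strictness then has to come from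
  another triangle.\<close>

definition fan4 :: bool where
  "fan4 \<longleftrightarrow> (\<exists>n0 v n1 n2 n3. TC n0 v n1 \<and> TC n1 v n2 \<and> TC n2 v n3 \<and> deg v = 4)"

text \<open>With a third triangle at \<open>a\<close> or at \<open>y\<close> the given one is the
  end of a fan there. Otherwise it is half of a kite, whose common edge gives at least
  \<open>3/7 + 3/14\<close>, and \<open>x\<close> adds 3/7: in all 15/14.\<close>

lemma charge_one_neighbour:
  assumes t: "TC x a y" and f: "len (y, a) = 3" "len (x, y) \<noteq> 3" "len (a, x) \<noteq> 3"
  shows "1 \<le> charge x a y \<and> (1 < charge x a y \<or> fan4)"
proof -
  note A = TC_corners[OF t]
  define p where "p = px y a"
  have t': "TC y a p" using corner_TC[of y a] f A TC_rot[of p y a] by (simp add: p_def)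
  note B = TC_corners[OF t']
  have cx: "3/7 \<le> share x" by (rule run1(1)[of x a]) (use A f in auto)
  show ?thesis
  proof (cases "len (a, nx a p) = 3")
    case True
    then have t'': "TC p a (nx a p)" using corner_TC[of a "nx a p"] nxE[of a p] px_nx[of a p] B by simp
    note v = charge_fan_start[OF t t' t'' f(3)]
    show ?thesis
    proof (cases "deg a = 4")
      case True
      then have fan4 unfolding fan4_def using t t' t'' by blast
      then show ?thesis using v by blast
    next
      case False
      then show ?thesis using v deg_cases[OF A(1)] by auto
    qed
  next
    case nA: False
    show ?thesis
    proof (cases "len (y, p) = 3")
      case True
      then have t0: "TC (px y p) y p" using corner_TC[of y p] B by simp
      have l: "len (y, nx y x) \<noteq> 3" using A f by simp
      note ts = t0 TC_rot[OF TC_rot[OF t']] TC_rot[OF t]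
      note v = charge_fan_end[OF ts l]
      show ?thesis
      proof (cases "deg y = 4")
        case True
        then have fan4 unfolding fan4_def using ts by blast
        then show ?thesis using v(1) charge_rot[of x a y] by simp
      next
        case False
        then show ?thesis using v deg_cases[OF A(2)] charge_rot[of x a y] by auto
      qed
    next
      case nB: False
      note k = kite_share[OF t t' f(3) nA]
      have h: "adj y a" "len (y, a) = 3" "len (y, nx y a) = 3" "len (y, px y a) \<noteq> 3" "len (y, nx y (nx y a)) \<noteq> 3"
        using A B f nB unfolding p_def[symmetric] by simp_all
      note r = run2[OF h]
      have "9/14 \<le> share a + share y"
      proof (cases "share a < 3/7")
        case True
        then have "3/7 \<le> share y" using r(3) k(2) A p_def by auto
        then show ?thesis using k(1) by simp
      next
        case False
        then show ?thesis using r(1) by simp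
      qed
      moreover have "transfer a y = 0" "transfer y x = 0" "transfer x a = 0"
        using transfer_eq_0[of a x] transfer_eq_0[of y p] transfer_eq_0[of x y] A B f nB by auto
      ultimately show ?thesis using cx by (simp add: charge_def)
    qed
  qed
qed

text \<open>The triangle is the middle one of three around \<open>a\<close>; if \<open>a\<close> has
  degree four and a fourth triangle, it belongs to a wheel.\<close>

lemma charge_two_neighbours:
  assumes t: "TC x a y" and f: "len (y, a) = 3" "len (a, x) = 3"
  shows "1 \<le> charge x a y \<and> (1 < charge x a y \<or> fan4)"
proof -
  note A = TC_corners[OF t]
  define p where "p = px y a"
  define q where "q = px a x"
  have t1: "TC y a p" using corner_TC[of y a] f A TC_rot[of p y a] by (simp add: p_def)
  have t0: "TC q a x" using corner_TC[of a x] f A by (simp add: q_def)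
  note B = TC_corners[OF t1] and C = TC_corners[OF t0]
  show ?thesis
  proof (cases "deg a = 4")
    case d: True
    then have F: fan4 unfolding fan4_def using t0 t t1 by blast
    have "nx a (nx a (nx a (nx a q))) = q" using deg4_cyc(1)[OF _ d] C by blast
    then have pq: "nx a p = q" using A B C by simp
    show ?thesis
    proof (cases "len (a, q) = 3")
      case True
      then have "TC p a q" using corner_TC[of a q] C px_nx[of a p] B pq by auto
      from charge_wheel[OF t0 t t1 this] F show ?thesis by blast
    next
      case False
      from charge_fan_middle[OF t0 t t1] False F show ?thesis by blast
    qed
  next
    case False
    then have "5 \<le> deg a" using deg_cases[OF A(1)] by simp
    with charge_fan_middle[OF t0 t t1] False show ?thesis by auto
  qed
qed

lemma charge_ge_1:
  assumes t: "TC x a y" shows "1 \<le> charge x a y \<and> (1 < charge x a y \<or> fan4)"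
proof -
  note A = TC_corners[OF t]
  note t' = TC_rot[OF t] and t'' = TC_rot[OF TC_rot[OF t]]
  have r: "charge a y x = charge x a y" "charge y x a = charge x a y" by (simp_all add: charge_def)
  have "\<not> (len (y, a) = 3 \<and> len (x, y) = 3 \<and> len (a, x) = 3)"
  proof
    assume l: "len (y, a) = 3 \<and> len (x, y) = 3 \<and> len (a, x) = 3"
    have "TC u v (px u v)" if "adj u v" "len (u, v) = 3" for u v using TC_rot[OF corner_TC[OF that]] .
    then have "TC a x (px a x)" "TC y a (px y a)" "TC x y (px x y)" using l A by auto
    then show False using no_three_neighbours[OF t] by blast
  qed
  then consider "len (y, a) \<noteq> 3" "len (x, y) \<noteq> 3" "len (a, x) \<noteq> 3"
    | "len (y, a) = 3" "len (x, y) \<noteq> 3" "len (a, x) \<noteq> 3"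
    | "len (x, y) = 3" "len (a, x) \<noteq> 3" "len (y, a) \<noteq> 3"
    | "len (a, x) = 3" "len (y, a) \<noteq> 3" "len (x, y) \<noteq> 3"
    | "len (y, a) = 3" "len (a, x) = 3" | "len (x, y) = 3" "len (y, a) = 3" | "len (a, x) = 3" "len (x, y) = 3"
    by blast
  then show ?thesis
  proof cases
    case 1 then show ?thesis using charge_no_neighbour[OF t] by simp
  next
    case 2 then show ?thesis using charge_one_neighbour[OF t] by simp
  next
    case 3 then show ?thesis using charge_one_neighbour[OF t'] r by simp
  next
    case 4 then show ?thesis using charge_one_neighbour[OF t''] r by simp
  next
    case 5 then show ?thesis using charge_two_neighbours[OF t] by simp
  next
    case 6 then show ?thesis using charge_two_neighbours[OF t'] r by simp
  next
    case 7 then show ?thesis using charge_two_neighbours[OF t''] r by simp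
  qed
qed

text \<open>An open fan lacks one of the two chords by \<open>fan_chords\<close>, a wheel lacks them
  all, so some two of its triangles form an induced kite and \<open>kite_deg\<close> yields a rim
  vertex of degree at least five. A triangle containing this vertex is strict.\<close>

lemma fan4_strict:
  assumes fan4 shows "\<exists>x a y. TC x a y \<and> 1 < charge x a y"
proof -
  obtain n0 v n1 n2 n3 where t: "TC n0 v n1" "TC n1 v n2" "TC n2 v n3" and d: "deg v = 4"
    using assms unfolding fan4_def by blast
  note A = TC_corners[OF t(1)] and B = TC_corners[OF t(2)] and C = TC_corners[OF t(3)]
  have "nx v (nx v (nx v (nx v n0))) = n0" using deg4_cyc(1)[OF _ d] A by blast
  then have c: "nx v n3 = n0" using A B C by simp
  show ?thesis
  proof (cases "len (v, n0) = 3")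
    case True
    then have t3: "TC n3 v n0" using corner_TC[of v n0] A C px_nx[of v n3] c by auto
    have "5 \<le> deg n0 \<or> 5 \<le> deg n1 \<or> 5 \<le> deg n2"
      by (rule kite_deg[OF t(1,2) wheel_no_chord[OF t t3] d])
    then have "deg n0 \<noteq> 4 \<or> deg n1 \<noteq> 4 \<or> deg n2 \<noteq> 4" by auto
    then show ?thesis using charge_wheel(2)[OF t3 t(1,2,3)] charge_wheel(2)[OF t t3] t by blast
  next
    case False
    have "5 \<le> deg n0 \<or> 5 \<le> deg n1 \<or> 5 \<le> deg n2 \<or> 5 \<le> deg n3"
      using fan_chords[OF t] kite_deg[OF t(1,2) _ d] kite_deg[OF t(2,3) _ d] by blast
    moreover have "len (v, nx v n3) \<noteq> 3" using c False by simp
    ultimately show ?thesis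
      using charge_fan_start(2)[OF t False] charge_fan_end(2)[OF t] t by blast
  qed
qed

lemma surplus_nonneg: "adj u v \<Longrightarrow> 0 \<le> surplus u"
  using surplus_ge_deg[of u] deg_ge[of u v] by simp

lemma sum_edges: "(\<Sum>e\<in>E. h e) = (\<Sum>u\<in>fst ` E. \<Sum>v\<in>{v. adj u v}. h (u, v))"
proof -
  have "E = (SIGMA u:fst ` E. {v. adj u v})" by force
  then have "(\<Sum>e\<in>E. h e) = (\<Sum>e\<in>(SIGMA u:fst ` E. {v. adj u v}). h e)" by simp
  also have "\<dots> = (\<Sum>u\<in>fst ` E. \<Sum>v\<in>{v. adj u v}. h (u, v))"
    using sum.Sigma[of "fst ` E" "\<lambda>u. {v. adj u v}" "\<lambda>u v. h (u, v)"] finE fin_nbrs by simp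
  finally show ?thesis .
qed

text \<open>Two rotation steps permute the neighbours of \<open>u\<close>, so gains and losses
  cancel.\<close>

lemma sum_transfer: "(\<Sum>v\<in>{v. adj u v}. transfer u v) = 0"
proof (cases "hub u")
  case True
  have "bij_betw (\<lambda>v. nx u (nx u v)) {v. adj u v} {v. adj u v}"
    unfolding bij_betw_def
  proof
    show inj: "inj_on (\<lambda>v. nx u (nx u v)) {v. adj u v}"
      by (rule inj_onI) (use nx_inj nxE in blast)
    show "(\<lambda>v. nx u (nx u v)) ` {v. adj u v} = {v. adj u v}"
      by (rule card_subset_eq[OF fin_nbrs]) (use nxE card_image[OF inj] in auto)
  qed
  from sum.reindex_bij_betw[OF this, of "\<lambda>v. of_bool (lowrim u v) :: real"] True
  show ?thesis by (simp add: transfer_def sum_divide_distrib[symmetric] sum_subtractf)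
qed (simp add: transfer_def)

text \<open>Without triangles no term is negative, and a zero total would mean that all degrees and
  lengths are four, contrary to \<open>all_quads\<close>. With triangles every charge covers the
  debt 1, one of them strictly.\<close>

lemma discharging:
  assumes ne: "E \<noteq> {}"
  shows "0 < (\<Sum>e\<in>E. (1 - 4 / real (deg (fst e))) + (1 - 4 / real (len e)))"
proof -
  let ?T = "{e \<in> E. len e = 3}"
  have dge: "0 \<le> 1 - 4 / real (deg (fst e))" if "e \<in> E" for e
    using deg_ge[of "fst e" "snd e"] that by (simp add: divide_le_eq)
  have val: "1 \<le> charge x a y" if "TC x a y" for x a y using charge_ge_1[OF that] by blast
  show ?thesis
  proof (cases "?T = {}")
    case True
    have lge: "4 \<le> len e" if "e \<in> E" for e
    proof -
      have "len e \<noteq> 3" using that True by blast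
      moreover have "3 \<le> len e" using len_ge_3[of "fst e" "snd e"] that by simp
      ultimately show ?thesis by simp
    qed
    have fge: "0 \<le> 1 - 4 / real (len e)" if "e \<in> E" for e using lge[OF that] by (simp add: divide_le_eq)
    show ?thesis
    proof (rule ccontr)
      assume n: "\<not> ?thesis"
      have pos: "0 \<le> (1 - 4 / real (deg (fst e))) + (1 - 4 / real (len e))" if "e \<in> E" for e
        using dge[OF that] fge[OF that] by simp
      have "(\<Sum>e\<in>E. (1 - 4 / real (deg (fst e))) + (1 - 4 / real (len e))) = 0"
        using n sum_nonneg[of E "\<lambda>e. (1 - 4 / real (deg (fst e))) + (1 - 4 / real (len e))"] pos by fastforce
      then have z: "(1 - 4 / real (deg (fst e))) + (1 - 4 / real (len e)) = 0" if "e \<in> E" for e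
        using sum_nonneg_eq_0_iff[OF finE, of "\<lambda>e. (1 - 4 / real (deg (fst e))) + (1 - 4 / real (len e))"] pos that by blast
      have d4: "deg (fst e) = 4" "len e = 4" if "e \<in> E" for e
      proof -
        have "1 - 4 / real (deg (fst e)) = 0" "1 - 4 / real (len e) = 0"
          using z[OF that] dge[OF that] fge[OF that] by linarith+
        moreover have "0 < deg (fst e)" "0 < len e" using deg_ge[of "fst e" "snd e"] lge[OF that] that by auto
        ultimately show "deg (fst e) = 4" "len e = 4" by (auto simp: field_simps)
      qed
      obtain a n1 where e: "adj a n1" using ne by auto
      obtain n2 n3 n0 where n: "nx a n1 = n2" "nx a n2 = n3" "nx a n3 = n0" "nx a n0 = n1"
        "px a n1 = n0" "px a n2 = n1" "px a n3 = n2" "px a n0 = n3"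
        "adj a n2" "adj a n3" "adj a n0" "distinct [n0, n1, n2, n3]"
        and "surplus a = wt (a, n0) + wt (a, n1) + wt (a, n2) + wt (a, n3)" "{w. adj a w} = {n0, n1, n2, n3}"
        by (rule deg4_setup[OF _ e]) (use d4(1)[OF e] in auto)
      obtain m0 m1 m2 m3 where "QC n0 a n1 m0" "QC n1 a n2 m1" "QC n2 a n3 m2" "QC n3 a n0 m3"
        using corner_QC[OF e d4(2)[OF e]] corner_QC[OF n(9) d4(2)[OF n(9)]] corner_QC[OF n(10) d4(2)[OF n(10)]]
          corner_QC[OF n(11) d4(2)[OF n(11)]] n(5-8) by auto
      then show False by (rule all_quads)
    qed
  next
    case False
    let ?cc = "\<lambda>e. share (fst e) + transfer (fst e) (snd e)"
    have finT: "finite ?T" using finE by simp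
    have fcT: "fc e \<in> ?T" if "e \<in> ?T" for e using that fc_E len_fc by auto
    have injT: "inj_on fc ?T" by (rule inj_on_subset[OF fc_inj]) auto
    \<comment> \<open>Each triangle is counted from each of its three darts, so the charges sum to
      three times the payments at corners, without passing to a set of faces.\<close>
    have "bij_betw fc ?T ?T"
      unfolding bij_betw_def using injT fcT card_subset_eq[OF finT _ card_image[OF injT]] by blast
    note re = sum.reindex_bij_betw[OF this]
    have Vsum: "?cc e + ?cc (fc e) + ?cc (fc (fc e)) = charge (px (fst e) (snd e)) (fst e) (snd e)"
      "TC (px (fst e) (snd e)) (fst e) (snd e)" if e: "e \<in> ?T" for e
    proof -
      obtain a y where ay: "e = (a, y)" by (cases e)
      then have t: "TC (px a y) a y" using corner_TC e by auto
      then show "TC (px (fst e) (snd e)) (fst e) (snd e)" by (simp add: ay)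
      show "?cc e + ?cc (fc e) + ?cc (fc (fc e)) = charge (px (fst e) (snd e)) (fst e) (snd e)"
        using TCN[OF t] by (simp add: ay charge_def)
    qed
    have "(\<Sum>e\<in>?T. ?cc (fc e)) = (\<Sum>e\<in>?T. ?cc e)"
      by (rule re)
    moreover have "(\<Sum>e\<in>?T. ?cc (fc (fc e))) = (\<Sum>e\<in>?T. ?cc (fc e))"
      by (rule re)
    moreover have "(\<Sum>e\<in>?T. ?cc e + ?cc (fc e) + ?cc (fc (fc e)))
        = (\<Sum>e\<in>?T. ?cc e) + (\<Sum>e\<in>?T. ?cc (fc e)) + (\<Sum>e\<in>?T. ?cc (fc (fc e)))"
      by (simp only: sum.distrib)
    ultimately have "3 * (\<Sum>e\<in>?T. ?cc e) = (\<Sum>e\<in>?T. ?cc e + ?cc (fc e) + ?cc (fc (fc e)))"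
      by linarith
    also have "\<dots> = (\<Sum>e\<in>?T. charge (px (fst e) (snd e)) (fst e) (snd e))"
      by (rule sum.cong[OF refl]) (rule Vsum(1))
    also have "\<dots> > (\<Sum>e\<in>?T. 1)"
    proof (rule sum_strict_mono_ex1[OF finT])
      show "\<forall>e\<in>?T. 1 \<le> charge (px (fst e) (snd e)) (fst e) (snd e)" using val Vsum(2) by blast
      obtain e where e: "e \<in> ?T" using False by blast
      have "\<exists>x a y. TC x a y \<and> 1 < charge x a y"
        using charge_ge_1[OF Vsum(2)[OF e]] Vsum(2)[OF e] fan4_strict by blast
      then obtain x a y where x: "TC x a y" "1 < charge x a y" by blast
      have "(a, y) \<in> ?T" "px a y = x" using TC_corners[OF x(1)] by auto
      then show "\<exists>e\<in>?T. 1 < charge (px (fst e) (snd e)) (fst e) (snd e)" using x(2) by force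
    qed
    finally have big: "real (card ?T) < 3 * (\<Sum>e\<in>?T. ?cc e)" by simp
    let ?s = "\<lambda>e. (1 - 4 / real (deg (fst e))) + wt e"
    have "(\<Sum>e\<in>?T. ?cc e) = (\<Sum>e\<in>E. if len e = 3 then ?cc e else 0)"
      using finE by (simp add: sum.inter_filter)
    also have "\<dots> = (\<Sum>u\<in>fst ` E. \<Sum>v\<in>{v. adj u v}. if len (u, v) = 3 then share u + transfer u v else 0)"
      using sum_edges[of "\<lambda>e. if len e = 3 then ?cc e else 0"] by (simp only: fst_conv snd_conv)
    \<comment> \<open>The surplus of vertices without triangles is not distributed, hence an
      inequality.\<close>
    also have "\<dots> \<le> (\<Sum>u\<in>fst ` E. \<Sum>v\<in>{v. adj u v}. ?s (u, v))"
    proof (rule sum_mono)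
      fix u assume "u \<in> fst ` E"
      then obtain v0 where v0: "adj u v0" by auto
      have "(if len (u, v) = 3 then share u + transfer u v else 0) = (if len (u, v) = 3 then share u else 0) + transfer u v"
        if "v \<in> {v. adj u v}" for v
        using that transfer_eq_0[of u v v] by auto
      then have "(\<Sum>v\<in>{v. adj u v}. if len (u, v) = 3 then share u + transfer u v else 0) =
          (\<Sum>v\<in>{v. adj u v}. (if len (u, v) = 3 then share u else 0) + transfer u v)"
        by (rule sum.cong[OF refl])
      also have "\<dots> = (\<Sum>v\<in>{v. adj u v}. if len (u, v) = 3 then share u else 0)"
        by (simp add: sum.distrib sum_transfer)
      also have "\<dots> = (\<Sum>v\<in>{v. adj u v \<and> len (u, v) = 3}. share u)"
      proof -
        have "{v. adj u v \<and> len (u, v) = 3} = {v \<in> {v. adj u v}. len (u, v) = 3}" by auto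
        then show ?thesis by (simp only:) (rule sum.inter_filter[OF fin_nbrs, symmetric])
      qed
      also have "\<dots> = real (tri u) * share u" by (simp add: tri_def)
      also have "\<dots> \<le> surplus u" using surplus_nonneg[OF v0] by (simp add: share_def)
      also have "surplus u = (\<Sum>v\<in>{v. adj u v}. ?s (u, v))"
      proof -
        have "(\<Sum>v\<in>{v. adj u v}. ?s (u, v)) = real (deg u) * (1 - 4 / real (deg u)) + (\<Sum>v\<in>{v. adj u v}. wt (u, v))"
          by (simp add: sum.distrib deg_def)
        also have "real (deg u) * (1 - 4 / real (deg u)) = real (deg u) - 4"
          using deg_ge[OF v0] by (simp add: right_diff_distrib)
        finally show ?thesis by (simp add: surplus_def)
      qed
      finally show "(\<Sum>v\<in>{v. adj u v}. if len (u, v) = 3 then share u + transfer u v else 0) \<le> (\<Sum>v\<in>{v. adj u v}. ?s (u, v))" .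
    qed
    also have "\<dots> = (\<Sum>e\<in>E. ?s e)" by (rule sum_edges[symmetric])
    finally have "real (card ?T) / 3 < (\<Sum>e\<in>E. 1 - 4 / real (deg (fst e))) + (\<Sum>e\<in>E. wt e)"
      using big by (simp add: sum.distrib)
    then have "0 < (\<Sum>e\<in>E. 1 - 4 / real (deg (fst e))) + (\<Sum>e\<in>E. 1 - 4 / real (len e))"
      using sum_wt_le by linarith
    then show ?thesis by (simp only: sum.distrib)
  qed
qed

end

section \<open>Copies of small graphs\<close>

definition map_graph :: "('a \<Rightarrow> 'b) \<Rightarrow> 'a pair_pre_digraph \<Rightarrow> 'b pair_pre_digraph" where
  "map_graph f H = \<lparr>pverts = f ` pverts H, parcs = map_prod f f ` parcs H\<rparr>"

lemma digraph_iso_map_graph: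
  assumes "parcs H \<subseteq> pverts H \<times> pverts H" and "inj_on f (pverts H)"
  shows "digraph_iso (with_proj H) (with_proj (map_graph f H))"
proof -
  let ?h = "\<lparr>iso_verts = f, iso_arcs = map_prod f f, iso_head = snd, iso_tail = fst\<rparr>"
  have "wf_digraph (with_proj H)" using assms(1) by unfold_locales auto
  moreover have "inj_on (map_prod f f) (parcs H)"
    by (rule inj_on_subset[OF map_prod_inj_on[OF assms(2) assms(2)] assms(1)])
  ultimately have "pre_digraph.digraph_isomorphism (with_proj H) ?h"
    using assms(2) by (auto simp: pre_digraph.digraph_isomorphism_def)
  moreover have "with_proj (map_graph f H) = app_iso ?h (with_proj H)"
    by (simp add: with_proj_def map_graph_def app_iso_def)
  ultimately show ?thesis unfolding digraph_iso_def by blast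
qed

lemma subgraph_map_graph:
  assumes "pair_graph G" and "parcs H \<subseteq> pverts H \<times> pverts H"
    and "f ` pverts H \<subseteq> pverts G" and "\<And>i j. (i, j) \<in> parcs H \<Longrightarrow> (f i, f j) \<in> parcs G"
  shows "subgraph (with_proj (map_graph f H)) (with_proj G)"
proof -
  interpret g: pair_graph G by fact
  have "wf_digraph (with_proj (map_graph f H))" using assms(2) by unfold_locales (auto simp: map_graph_def)
  moreover have "parcs (map_graph f H) \<subseteq> parcs G" using assms(4) by (auto simp: map_graph_def)
  ultimately show ?thesis
    using assms(3) g.wf_digraph_axioms by (simp add: subgraph_def compatible_def map_graph_def)
qed

lemma contains_copyI:
  assumes "pair_graph G" and "parcs H \<subseteq> pverts H \<times> pverts H"
    and "f ` pverts H \<subseteq> pverts G" and "inj_on f (pverts H)"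
    and "\<And>i j. (i, j) \<in> parcs H \<Longrightarrow> (f i, f j) \<in> parcs G"
  shows "contains_copy G H"
  using subgraph_map_graph[OF assms(1-3,5)] digraph_iso_map_graph[OF assms(2,4)]
  unfolding contains_copy_def by blast

lemma (in pair_graph) contains_cycle_6I:
  assumes "(a, b) \<in> parcs G" "(b, c) \<in> parcs G" "(c, d) \<in> parcs G" "(d, e) \<in> parcs G" "(e, f) \<in> parcs G"
    "(f, a) \<in> parcs G" "distinct [a, b, c, d, e, f]"
  shows "contains_copy G (cycle_graph 6)"
proof (rule contains_copyI[of _ _ "\<lambda>i. [a, b, c, d, e, f] ! i"])
  show "pair_graph G" by unfold_locales
  have s: "(v, u) \<in> parcs G" if "(u, v) \<in> parcs G" for u v using that arcs_symmetric by blast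
  have six: "i \<in> {0, 1, 2, 3, 4, 5}" if "i < 6" for i :: nat using that by auto
  show "parcs (cycle_graph 6) \<subseteq> pverts (cycle_graph 6) \<times> pverts (cycle_graph 6)"
    by (auto simp: cycle_graph_def graph_of_def)
  show "(!) [a, b, c, d, e, f] ` pverts (cycle_graph 6) \<subseteq> pverts G"
    using assms in_arcsD1 by (auto simp: cycle_graph_def graph_of_def dest!: six)
  show "inj_on ((!) [a, b, c, d, e, f]) (pverts (cycle_graph 6))"
    by (rule inj_on_nth[OF assms(7)]) (simp add: cycle_graph_def graph_of_def)
  have "([a, b, c, d, e, f] ! i, [a, b, c, d, e, f] ! (Suc i mod 6)) \<in> parcs G" if "i < 6" for i
    using six[OF that] assms by auto
  then show "([a, b, c, d, e, f] ! i, [a, b, c, d, e, f] ! j) \<in> parcs G" if "(i, j) \<in> parcs (cycle_graph 6)" for i j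
    using that s by (auto simp: cycle_graph_def graph_of_def)
qed

lemma (in pair_graph) contains_K5_minusI:
  assumes "distinct [a, b, c, d, e]" "(a, c) \<in> parcs G" "(a, d) \<in> parcs G" "(a, e) \<in> parcs G"
    "(b, c) \<in> parcs G" "(b, d) \<in> parcs G" "(b, e) \<in> parcs G" "(c, d) \<in> parcs G" "(c, e) \<in> parcs G"
    "(d, e) \<in> parcs G"
  shows "contains_copy G K5_minus"
proof (rule contains_copyI[of _ _ "\<lambda>i. [a, b, c, d, e] ! i"])
  show "pair_graph G" by unfold_locales
  have s: "(v, u) \<in> parcs G" if "(u, v) \<in> parcs G" for u v using that arcs_symmetric by blast
  have five: "i \<in> {0, 1, 2, 3, 4}" if "i < 5" for i :: nat using that by auto
  show "parcs K5_minus \<subseteq> pverts K5_minus \<times> pverts K5_minus"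
    by (auto simp: K5_minus_def graph_of_def)
  show "(!) [a, b, c, d, e] ` pverts K5_minus \<subseteq> pverts G"
    using assms in_arcsD1 in_arcsD2 by (auto simp: K5_minus_def graph_of_def dest!: five)
  show "inj_on ((!) [a, b, c, d, e]) (pverts K5_minus)"
    by (rule inj_on_nth[OF assms(1)]) (simp add: K5_minus_def graph_of_def)
  have "\<forall>j<5. \<forall>i<j. (i, j) \<noteq> (0, 1) \<longrightarrow> ([a, b, c, d, e] ! i, [a, b, c, d, e] ! j) \<in> parcs G"
    using assms by (simp add: All_less_Suc eval_nat_numeral)
  then show "([a, b, c, d, e] ! i, [a, b, c, d, e] ! j) \<in> parcs G" if "(i, j) \<in> parcs K5_minus" for i j
    using that s by (auto simp: K5_minus_def graph_of_def)
qed

text \<open>The vertices \<open>x\<close> and \<open>y\<close> take positions 0 and 1, the pair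
  whose edge is missing in \<open>kite\<close>.\<close>

lemma (in pair_graph) induced_kiteI:
  assumes "distinct [x, y, z, w]" "(x, z) \<in> parcs G" "(x, w) \<in> parcs G" "(y, z) \<in> parcs G"
    "(y, w) \<in> parcs G" "(z, w) \<in> parcs G" "(x, y) \<notin> parcs G"
  shows "\<exists>H. induced_subgraph (with_proj H) (with_proj G) \<and> digraph_iso (with_proj kite) (with_proj H)
    \<and> pverts H = {x, y, z, w}"
proof -
  let ?f = "\<lambda>i. [x, y, z, w] ! i"
  let ?H = "map_graph ?f kite"
  have G: "pair_graph G" by unfold_locales
  have s: "(v, u) \<in> parcs G" if "(u, v) \<in> parcs G" for u v using that arcs_symmetric by blast
  have four: "i \<in> {0, 1, 2, 3}" if "i < 4" for i :: nat using that by auto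
  have k: "parcs kite \<subseteq> pverts kite \<times> pverts kite"
    by (auto simp: kite_def graph_of_def)
  have in_G: "?f ` pverts kite \<subseteq> pverts G"
    using assms in_arcsD1 in_arcsD2 by (auto simp: kite_def graph_of_def dest!: four)
  have inj: "inj_on ?f (pverts kite)"
    by (rule inj_on_nth[OF assms(1)]) (simp add: kite_def graph_of_def)
  have "\<forall>j<4. \<forall>i<j. (i, j) \<noteq> (0, 1) \<longrightarrow> (?f i, ?f j) \<in> parcs G"
    using assms by (simp add: All_less_Suc eval_nat_numeral)
  then have e: "(?f i, ?f j) \<in> parcs G" if "(i, j) \<in> parcs kite" for i j
    using that s by (auto simp: kite_def graph_of_def)
  have V: "pverts ?H = {x, y, z, w}"
  proof -
    have "pverts kite = {0, 1, 2, 3}" by (auto simp: kite_def graph_of_def)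
    then show ?thesis by (simp add: map_graph_def)
  qed
  note sub = subgraph_map_graph[OF G k in_G e]
  have "(u, v) \<in> parcs ?H" if uv: "(u, v) \<in> parcs G" "u \<in> pverts ?H" "v \<in> pverts ?H" for u v
  proof -
    obtain i j where ij: "i < 4" "j < 4" "u = ?f i" "v = ?f j"
      using uv(2,3) by (auto simp: map_graph_def kite_def graph_of_def)
    have "i \<noteq> j" using ij uv(1) no_loops'[of u v] by auto
    moreover have "(y, x) \<notin> parcs G" using s assms(7) by blast
    then have "\<not> (i = 0 \<and> j = 1)" "\<not> (i = 1 \<and> j = 0)"
      using ij uv(1) assms(7) nth_Cons_0 by (metis One_nat_def nth_Cons_Suc)+
    ultimately have "(i, j) \<in> parcs kite" using ij(1,2) by (auto simp: kite_def graph_of_def)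
    then show ?thesis unfolding ij(3,4) by (force simp: map_graph_def)
  qed
  then have "parcs ?H = {e \<in> parcs G. fst e \<in> pverts ?H \<and> snd e \<in> pverts ?H}"
    using e k by (auto simp: map_graph_def)
  then have "induced_subgraph (with_proj ?H) (with_proj G)"
    using sub by (simp add: induced_subgraph_def)
  then show ?thesis using digraph_iso_map_graph[OF k inj] V by blast
qed

lemma vdegree_eq_card: "vdegree G v = card {w. (v, w) \<in> parcs G}"
proof -
  have "out_arcs (with_proj G) v = Pair v ` {w. (v, w) \<in> parcs G}"
    by (auto simp: out_arcs_def)
  then show ?thesis by (simp add: vdegree_def out_degree_def card_image inj_on_def)
qed

lemma induced_kite_of_degree_4:
  fixes G :: "'a pair_pre_digraph"
  assumes G: "pair_graph G" and conn: "Digraph_Component.connected (with_proj G)" and tor: "toroidal G"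
    and K5: "\<not> contains_copy G K5_minus" and C6: "\<not> contains_copy G (cycle_graph 6)"
    and deg: "4 \<le> min_degree G"
  shows "\<exists>H. induced_subgraph (with_proj H) (with_proj G) \<and> digraph_iso (with_proj kite) (with_proj H)
    \<and> (\<forall>v\<in>pverts H. vdegree G v = 4)"
proof (rule ccontr)
  assume no_kite: "\<not> ?thesis"
  interpret g: pair_graph G by fact
  let ?E = "parcs G"
  have s: "(v, u) \<in> ?E" if "(u, v) \<in> ?E" for u v using that g.arcs_symmetric by blast
  have fin: "finite {w. (u, w) \<in> ?E}" for u
    by (rule finite_subset[of _ "pverts G"]) (use g.in_arcsD2 in auto)
  have dg: "4 \<le> card {w. (v, w) \<in> ?E}" if "v \<in> pverts G" for v
  proof -
    have "min_degree G \<le> vdegree G v" using that unfolding min_degree_def by simp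
    then show ?thesis using deg by (simp add: vdegree_eq_card)
  qed
  \<comment> \<open>Connectedness includes having a vertex, and a vertex of degree at least four
    supplies an arc.\<close>
  have "pverts G \<noteq> {}" using conn
    by (simp add: Digraph_Component.connected_def strongly_connected_def mk_symmetric_def)
  then obtain v where "v \<in> pverts G" by blast
  then have "{w. (v, w) \<in> ?E} \<noteq> {}" using dg[of v] by (metis card.empty not_numeral_le_zero)
  then have ne: "?E \<noteq> {}" by blast
  obtain nx where nxE: "\<And>u v. (u, v) \<in> ?E \<Longrightarrow> (u, nx u v) \<in> ?E"
    and cyc: "\<And>u v w. (u, v) \<in> ?E \<Longrightarrow> (u, w) \<in> ?E \<Longrightarrow> \<exists>k. (nx u ^^ k) v = w"
    and inj: "\<And>u v w. (u, v) \<in> ?E \<Longrightarrow> (u, w) \<in> ?E \<Longrightarrow> nx u v = nx u w \<Longrightarrow> v = w"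
    and euler: "0 \<le> (\<Sum>(u, v)\<in>?E. 1 / real (card {w. (u, w) \<in> ?E})
      + 1 / real (card (range (\<lambda>k. ((\<lambda>(x, y). (y, nx y x)) ^^ k) (u, v)))) - 1/2)"
    using toroidal_rotation_exists[OF G tor ne] by blast
  define px where "px u v = inv_into {w. (u, w) \<in> ?E} (nx u) v" for u v
  have onto: "nx u ` {w. (u, w) \<in> ?E} = {w. (u, w) \<in> ?E}" for u
    by (rule card_subset_eq[OF fin]) (use nxE inj in \<open>auto intro!: card_image inj_onI\<close>)
  have px: "(u, px u v) \<in> ?E \<and> nx u (px u v) = v" if "(u, v) \<in> ?E" for u v
    using that inv_into_into[of v "nx u" "{w. (u, w) \<in> ?E}"] f_inv_into_f[of v "nx u" "{w. (u, w) \<in> ?E}"]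
    by (simp add: px_def onto)
  have px': "px u (nx u v) = v" if "(u, v) \<in> ?E" for u v
    unfolding px_def by (rule inv_into_f_f) (use inj that in \<open>auto intro!: inj_onI\<close>)
  interpret r: rotation ?E nx px
  proof (unfold_locales, goal_cases)
    case 1 then show ?case by (rule g.pair_finite_arcs)
  next
    case (3 u) then show ?case using g.no_loops' by blast
  next
    case (8 u v w) then show ?case by (rule cyc)
  next
    case (9 u v) then show ?case using dg g.in_arcsD1 by blast
  next
    case 10 then show ?case using C6 g.contains_cycle_6I by blast
  next
    case 11 then show ?case using K5 g.contains_K5_minusI by blast
  qed (use s nxE px px' in auto)
  interpret r: rotation_no_kite ?E nx px
  proof (unfold_locales, goal_cases)
    case (1 x y z w)
    obtain H where H: "induced_subgraph (with_proj H) (with_proj G)" "digraph_iso (with_proj kite) (with_proj H)"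
      "pverts H = {x, y, z, w}"
      using g.induced_kiteI[OF 1(1-7)] by blast
    have "\<forall>v\<in>pverts H. vdegree G v = 4" using 1(8-11) H(3) by (simp add: vdegree_eq_card)
    then show ?case using no_kite H(1,2) by blast
  qed
  have "0 \<le> (\<Sum>e\<in>?E. 1 / real (r.deg (fst e)) + 1 / real (r.len e) - 1/2)"
    using euler by (simp add: r.deg_def r.len_def r.fc_def case_prod_unfold)
  \<comment> \<open>Up to the factor \<open>- 1/4\<close> the Euler sum is the sum shown positive by
    discharging.\<close>
  also have "\<dots> = (\<Sum>e\<in>?E. - (1/4) * ((1 - 4 / real (r.deg (fst e))) + (1 - 4 / real (r.len e))))"
    by (rule sum.cong) (simp_all add: algebra_simps)
  also have "\<dots> = - (1/4) * (\<Sum>e\<in>?E. (1 - 4 / real (r.deg (fst e))) + (1 - 4 / real (r.len e)))"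
    by (rule sum_distrib_left[symmetric])
  finally show False using r.discharging[OF ne] by linarith
qed

theorem theorem1p2:
  fixes G :: "'a pair_pre_digraph"
  assumes "pair_graph G"
    and "Digraph_Component.connected (with_proj G)"
    and "toroidal G"
    and "\<not> contains_copy G K5_minus"
    and "\<not> contains_copy G (cycle_graph 6)"
  shows "min_degree G \<le> 3
    \<or> (\<exists>v1 v2 v3 v4 v5. distinct [v1, v2, v3, v4, v5]
        \<and> induced_subgraph
            (with_proj (graph_of {v1, v2, v3, v4, v5}
              {(v1, v2), (v2, v3), (v3, v4), (v4, v5), (v5, v1), (v3, v5), (v1, v3), (v1, v4)}))
            (with_proj G)
        \<and> (\<forall>v \<in> {v1, v2, v3, v4, v5}. vdegree G v = 4))
    \<or> (\<exists>H. induced_subgraph (with_proj H) (with_proj G)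
        \<and> digraph_iso (with_proj kite) (with_proj H)
        \<and> (\<forall>v \<in> pverts H. vdegree G v = 4))
    \<or> (\<exists>H. induced_subgraph (with_proj H) (with_proj G)
        \<and> digraph_iso (with_proj house) (with_proj H)
        \<and> (\<forall>v \<in> pverts H. vdegree G v = 4))"
  using induced_kite_of_degree_4[OF assms] by (cases "min_degree G \<le> 3") simp_all

end
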